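(* Let $\Sigma$ be an oriented surface of genus $g\geq 1$ with $n\geq 0$ punctures, with $2g-2+n>0$. A faithful representation $\rho:\pi_1(\Sigma)\to\mathrm{SL}_2(\mathbb{C})$ cannot have finite $\mathrm{Mod}(\Sigma)$-orbit in the character variety $\mathrm{Hom}(\pi_1(\Sigma),\mathrm{SL}_2(\mathbb{C}))/\!/\mathrm{SL}_2(\mathbb{C})$. Likewise, a faithful representation $\rho:\pi_1(\Sigma)\to\mathrm{PSL}_2(\mathbb{C})$ cannot have finite $\mathrm{Mod}(\Sigma)$-orbit in the character variety $\mathrm{Hom}(\pi_1(\Sigma),\mathrm{PSL}_2(\mathbb{C}))/\!/\mathrm{PSL}_2(\mathbb{C})$.
   Context: A surface of genus $g$ with $n$ punctures is a (connected) closed oriented surface of genus $g$ with $n$ points removed. $\mathrm{Mod}(\Sigma)$ is the pure mapping class group: isotopy classes of orientation-preserving homeomorphisms of $\Sigma$ fixing each puncture individually. It acts on the character varieties (affine GIT quotients by conjugation) by precomposition, through outer automorphisms of $\pi_1(\Sigma)$. The orbit of $\rho$ means the orbit of the point determined by $\rho$ in the character variety. *)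

theory Defs
  imports "HOL-Analysis.Analysis" "HOL-Algebra.Algebra" "HOL-Homology.Homology"
begin

section \<open>Surfaces\<close>

text \<open>
  The boundary circle of the closed unit disc is cut into \<open>4 g\<close> arcs, read counterclockwise as
  the word \<open>a b a' b'\<close> repeated \<open>g\<close> times, where \<open>a'\<close>, \<open>b'\<close> are \<open>a\<close>, \<open>b\<close> traversed backwards.
  The closed surface of genus \<open>g \<ge> 1\<close> is the disc with equally labelled arcs glued.
  (For \<open>g = 0\<close> there are no arcs and the definitions below are not meaningful.)
\<close>

definition polygon_edge :: "nat \<Rightarrow> nat \<Rightarrow> real \<Rightarrow> complex" where
  "polygon_edge g k t = cis (2 * pi * (real k + t) / (4 * real g))"

definition polygon_glue :: "nat \<Rightarrow> complex \<Rightarrow> complex \<Rightarrow> bool" where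
  "polygon_glue g z w \<longleftrightarrow> (\<exists>j<g. \<exists>t\<in>{0..1}.
     z = polygon_edge g (4 * j) t \<and> w = polygon_edge g (4 * j + 2) (1 - t) \<or>
     z = polygon_edge g (4 * j + 1) t \<and> w = polygon_edge g (4 * j + 3) (1 - t))"

text \<open>\<open>S\<close> is homeomorphic to the glued polygon, i.e. it is a quotient of the disc whose fibres are
  exactly the classes of the equivalence relation generated by the gluing.\<close>

definition closed_surface :: "nat \<Rightarrow> 'a::topological_space set \<Rightarrow> bool" where
  "closed_surface g S \<longleftrightarrow> (\<exists>q.
     quotient_map (top_of_set (cball (0::complex) 1)) (top_of_set S) q \<and>
     (\<forall>z\<in>cball 0 1. \<forall>w\<in>cball 0 1. q z = q w \<longleftrightarrow> equivclp (polygon_glue g) z w))"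

text \<open>An orientation is a fundamental class, i.e. a generator of the infinite cyclic second
  homology group.\<close>

definition orientation_class :: "'a::topological_space set \<Rightarrow> 'a chain set \<Rightarrow> bool" where
  "orientation_class S \<omega> \<longleftrightarrow>
     \<omega> \<in> carrier (homology_group 2 (top_of_set S)) \<and>
     carrier (subgroup_generated (homology_group 2 (top_of_set S)) {\<omega>}) =
       carrier (homology_group 2 (top_of_set S))"

text \<open>The surface with punctures is \<open>S - P\<close>.\<close>

definition oriented_punctured_surface ::
    "nat \<Rightarrow> nat \<Rightarrow> 'a::topological_space set \<Rightarrow> 'a chain set \<Rightarrow> 'a set \<Rightarrow> bool" where
  "oriented_punctured_surface g n S \<omega> P \<longleftrightarrow>
     closed_surface g S \<and> orientation_class S \<omega> \<and> P \<subseteq> S \<and> finite P \<and> card P = n"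

section \<open>The pure mapping class group\<close>

text \<open>A homeomorphism of \<open>S - P\<close> extends uniquely to one of \<open>S\<close> permuting \<open>P\<close>; those fixing each
  puncture are the homeomorphisms of \<open>S\<close> fixing \<open>P\<close> pointwise.\<close>

definition pure_homeos :: "'a::topological_space set \<Rightarrow> 'a chain set \<Rightarrow> 'a set \<Rightarrow> ('a \<Rightarrow> 'a) set" where
  "pure_homeos S \<omega> P = {h.
     homeomorphic_map (top_of_set S) (top_of_set S) h \<and>
     hom_induced 2 (top_of_set S) {} (top_of_set S) {} h \<omega> = \<omega> \<and>
     (\<forall>p\<in>P. h p = p)}"

definition isotopy_rel ::
    "'a::topological_space set \<Rightarrow> 'a chain set \<Rightarrow> 'a set \<Rightarrow> (('a \<Rightarrow> 'a) \<times> ('a \<Rightarrow> 'a)) set" where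
  "isotopy_rel S \<omega> P =
     {(h, k). homotopic_with (\<lambda>f. f \<in> pure_homeos S \<omega> P) (top_of_set S) (top_of_set S) h k}"

definition mapping_class_group ::
    "'a::topological_space set \<Rightarrow> 'a chain set \<Rightarrow> 'a set \<Rightarrow> ('a \<Rightarrow> 'a) set set" where
  "mapping_class_group S \<omega> P = pure_homeos S \<omega> P // isotopy_rel S \<omega> P"

section \<open>The fundamental group and the outer action\<close>

definition fundamental_group ::
    "'a::topological_space set \<Rightarrow> 'a \<Rightarrow> (real \<Rightarrow> 'a) set monoid" where
  "fundamental_group T x = \<lparr>
     carrier = {Collect (homotopic_paths T p) | p.
                  path p \<and> path_image p \<subseteq> T \<and> pathstart p = x \<and> pathfinish p = x},
     mult = (\<lambda>A B. {r. \<exists>p\<in>A. \<exists>q\<in>B. homotopic_paths T (p +++ q) r}),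
     one = Collect (homotopic_paths T (\<lambda>t. x))\<rparr>"

text \<open>For a path \<open>c\<close> from \<open>x\<close> to \<open>h x\<close>: the map \<open>[p] \<mapsto> [c \<cdot> (h \<circ> p) \<cdot> c\<inverse>]\<close>.\<close>

definition induced_aut ::
    "'a::topological_space set \<Rightarrow> ('a \<Rightarrow> 'a) \<Rightarrow> (real \<Rightarrow> 'a) \<Rightarrow> (real \<Rightarrow> 'a) set \<Rightarrow> (real \<Rightarrow> 'a) set" where
  "induced_aut T h c A = {r. \<exists>p\<in>A. homotopic_paths T ((c +++ (h \<circ> p)) +++ reversepath c) r}"

text \<open>The outer automorphism given by a mapping class \<open>m\<close>, as a set of automorphisms: changing \<open>c\<close>
  changes the automorphism by an inner one.\<close>

definition induced_outer_aut ::
    "'a::topological_space set \<Rightarrow> 'a \<Rightarrow> ('a \<Rightarrow> 'a) set \<Rightarrow> ((real \<Rightarrow> 'a) set \<Rightarrow> (real \<Rightarrow> 'a) set) set" where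
  "induced_outer_aut T x m = {induced_aut T h c | h c.
     h \<in> m \<and> path c \<and> path_image c \<subseteq> T \<and> pathstart c = x \<and> pathfinish c = h x}"

section \<open>The groups and their coordinate rings\<close>

inductive_set fun_algebra :: "('b \<Rightarrow> complex) set \<Rightarrow> ('b \<Rightarrow> complex) set"
  for F :: "('b \<Rightarrow> complex) set" where
  gen: "f \<in> F \<Longrightarrow> f \<in> fun_algebra F"
| const: "(\<lambda>_. c) \<in> fun_algebra F"
| add: "f \<in> fun_algebra F \<Longrightarrow> h \<in> fun_algebra F \<Longrightarrow> (\<lambda>x. f x + h x) \<in> fun_algebra F"
| mult: "f \<in> fun_algebra F \<Longrightarrow> h \<in> fun_algebra F \<Longrightarrow> (\<lambda>x. f x * h x) \<in> fun_algebra F"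

definition SL2C :: "(complex^2^2) monoid" where
  "SL2C = \<lparr>carrier = {A. det A = 1}, mult = (**), one = mat 1\<rparr>"

definition SL2C_ring :: "(complex^2^2 \<Rightarrow> complex) set" where
  "SL2C_ring = fun_algebra {\<lambda>A. A $ i $ j | i j. True}"

definition PSL2C :: "(complex^2^2) set monoid" where
  "PSL2C = SL2C Mod {mat 1, - mat 1}"

text \<open>The regular functions on the quotient variety are those that pull back to regular functions.\<close>

definition PSL2C_ring :: "((complex^2^2) set \<Rightarrow> complex) set" where
  "PSL2C_ring = {f. \<exists>p\<in>SL2C_ring. \<forall>A\<in>carrier SL2C. f ({mat 1, - mat 1} #>\<^bsub>SL2C\<^esub> A) = p A}"

section \<open>Character varieties\<close>

text \<open>
  \<open>R\<close> is the coordinate ring of the affine algebraic group \<open>G\<close>. The coordinate ring of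
  \<open>Hom(\<Gamma>, G)\<close> is generated by the functions \<open>\<rho> \<mapsto> c (\<rho> \<gamma>)\<close>. All functions are total on
  \<open>'p \<Rightarrow> 'g\<close>, but only their values on \<open>hom \<Gamma> G\<close> are relevant.
\<close>

definition hom_ring ::
    "('p, 'u) monoid_scheme \<Rightarrow> ('g \<Rightarrow> complex) set \<Rightarrow> (('p \<Rightarrow> 'g) \<Rightarrow> complex) set" where
  "hom_ring \<Gamma> R = fun_algebra {\<lambda>\<rho>. c (\<rho> \<gamma>) | c \<gamma>. c \<in> R \<and> \<gamma> \<in> carrier \<Gamma>}"

definition invariant_ring ::
    "('p, 'u) monoid_scheme \<Rightarrow> ('g, 'v) monoid_scheme \<Rightarrow> ('g \<Rightarrow> complex) set
       \<Rightarrow> (('p \<Rightarrow> 'g) \<Rightarrow> complex) set" where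
  "invariant_ring \<Gamma> G R = {f \<in> hom_ring \<Gamma> R. \<forall>\<rho>\<in>hom \<Gamma> G. \<forall>a\<in>carrier G.
     f (\<lambda>\<gamma>. a \<otimes>\<^bsub>G\<^esub> \<rho> \<gamma> \<otimes>\<^bsub>G\<^esub> inv\<^bsub>G\<^esub> a) = f \<rho>}"

text \<open>The point of the affine GIT quotient \<open>Spec\<close> of the invariant ring determined by \<open>\<rho>\<close>, namely
  the maximal ideal of invariants vanishing at \<open>\<rho>\<close>.\<close>

definition character_point ::
    "('p, 'u) monoid_scheme \<Rightarrow> ('g, 'v) monoid_scheme \<Rightarrow> ('g \<Rightarrow> complex) set
       \<Rightarrow> ('p \<Rightarrow> 'g) \<Rightarrow> (('p \<Rightarrow> 'g) \<Rightarrow> complex) set" where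
  "character_point \<Gamma> G R \<rho> = {f \<in> invariant_ring \<Gamma> G R. f \<rho> = 0}"

text \<open>Precomposing with \<open>\<phi>\<close> instead of its inverse does not change the orbit.\<close>

definition mcg_orbit ::
    "'a::topological_space set \<Rightarrow> 'a chain set \<Rightarrow> 'a set \<Rightarrow> 'a
       \<Rightarrow> ('g, 'v) monoid_scheme \<Rightarrow> ('g \<Rightarrow> complex) set \<Rightarrow> ((real \<Rightarrow> 'a) set \<Rightarrow> 'g)
       \<Rightarrow> (((real \<Rightarrow> 'a) set \<Rightarrow> 'g) \<Rightarrow> complex) set set" where
  "mcg_orbit S \<omega> P x G R \<rho> =
     {character_point (fundamental_group (S - P) x) G R (\<rho> \<circ> \<phi>) | \<phi> m.
        m \<in> mapping_class_group S \<omega> P \<and> \<phi> \<in> induced_outer_aut (S - P) x m}"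

end

theory Submission
  imports Defs
begin

text \<open>
  Let \<open>a\<close> and \<open>b\<close> be loops crossing once, and let \<open>T\<close> be the Dehn twist along \<open>a\<close>, so that
  \<open>T\<^sup>k b = a\<^sup>k b\<close>. A power of \<open>T\<close> fixes the orientation class, because an automorphism of a cyclic
  group has finite order on a generator. If the orbit of \<open>\<rho>\<close> is finite, then the traces of
  \<open>A\<^sup>N\<^sup>k B\<close>, with \<open>A = \<rho> a\<close> and \<open>B = \<rho> b\<close>, take finitely many values. They satisfy a second order
  linear recurrence, hence are periodic in \<open>k\<close>. It follows that \<open>trace B = 0\<close>, or that \<open>A\<close> has a
  unipotent power whose fixed line is preserved by \<open>B\<close>. In the first case \<open>B\<^sup>2 = -1\<close>. In the second
  case \<open>A\<close> commutes with \<open>B A B\<inverse>\<close>, unless \<open>A\<close> has finite order.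

  For faithful \<open>\<rho>\<close> this contradicts the fundamental group: \<open>a\<close> has infinite order, \<open>b\<^sup>4 \<noteq> 1\<close>, and \<open>a\<close>
  does not commute with \<open>b a b\<inverse>\<close>, since there is a map from the surface to the Klein bottle that takes
  \<open>a\<close> and \<open>b\<close> to the standard generators of its fundamental group, \<open>a\<close> being the orientation
  reversing one. For \<open>g = 1\<close> this map exists only in the complement of a puncture, which may be
  moved to the vertex of the polygon because the torus is homogeneous.
\<close>

section \<open>Traces of twisted products\<close>

text \<open>The fundamental group is never computed. Three statements about words in
  \<open>a\<close> and \<open>b\<close> suffice, and they are detected by the monodromy of a map to
  the Klein bottle, whose universal cover is the plane. An abelian target could not separate the two
  products. In the Klein bottle group \<open>a b a^-1 = b^-1\<close>, hence
  \<open>b a b^-1 = b^2 a\<close>, and the products of \<open>a\<close> and \<open>b a b^-1\<close>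
  in the two orders are \<open>b^-2 a^2\<close> and \<open>b^2 a^2\<close>. The commutator of
  \<open>a\<close> and \<open>b\<close> is not trivial there, so one handle alone cannot be closed
  up: on the torus a puncture has to absorb the commutator (the group of the closed torus is
  abelian), and for \<open>g \<ge> 2\<close> a second handle with the roles of the generators
  exchanged cancels it.

  Both groups are treated through the square of the trace, which does not see the sign of a lift to
  \<open>SL2C\<close>. The sign is also why \<open>b^4\<close> occurs: \<open>trace B = 0\<close>
  gives \<open>B^2 = -1\<close>, and only the fourth power is the identity in
  \<open>SL2C\<close>.\<close>

lemma trace_2: "trace (A :: complex^2^2) = A$1$1 + A$2$2"
  by (simp add: trace_def sum_2)

lemma mat_mul_2: "((A :: complex^2^2) ** B) $ i $ j = A$i$1 * B$1$j + A$i$2 * B$2$j"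
  by (simp add: matrix_matrix_mult_def sum_2)

lemma mat_eq_2: "(A :: complex^2^2) = B \<longleftrightarrow>
    A$1$1 = B$1$1 \<and> A$1$2 = B$1$2 \<and> A$2$1 = B$2$1 \<and> A$2$2 = B$2$2"
  by (auto simp: vec_eq_iff forall_2)

lemma mat_1_2 [simp]:
  "(mat 1 :: complex^2^2)$1$1 = 1" "(mat 1 :: complex^2^2)$1$2 = 0"
  "(mat 1 :: complex^2^2)$2$1 = 0" "(mat 1 :: complex^2^2)$2$2 = 1"
  by (simp_all add: mat_def)

lemma matrix_mul_minus:
  fixes A B :: "complex^2^2"
  shows "(- A) ** B = - (A ** B)" "A ** (- B) = - (A ** B)"
  by (simp_all add: mat_eq_2 mat_mul_2)

lemma det_minus_2: "det (- (A :: complex^2^2)) = det A"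
  by (simp add: det_2)

text \<open>The adjugate, that is \<open>trace A - A\<close>. On \<open>SL2C\<close> it is the
  inverse, and being linear in the entries it keeps the later computations polynomial.\<close>

definition adj2 :: "complex^2^2 \<Rightarrow> complex^2^2" where
  "adj2 A = (\<chi> i j. (if i = j then trace A else 0) - A $ i $ j)"

lemma adj2_nth [simp]:
  "adj2 A $ 1 $ 1 = A$2$2" "adj2 A $ 1 $ 2 = - A$1$2"
  "adj2 A $ 2 $ 1 = - A$2$1" "adj2 A $ 2 $ 2 = A$1$1"
  by (simp_all add: adj2_def trace_2)

lemma mul_adj2:
  assumes "det A = 1"
  shows "A ** adj2 A = mat 1" "adj2 A ** A = mat 1"
  using assms by (simp_all add: mat_eq_2 mat_mul_2 det_2 algebra_simps)

lemma group_SL2C: "group SL2C"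
proof (rule groupI)
  show "\<exists>y\<in>carrier SL2C. y \<otimes>\<^bsub>SL2C\<^esub> A = \<one>\<^bsub>SL2C\<^esub>" if "A \<in> carrier SL2C" for A
    by (rule bexI[of _ "adj2 A"]) (use that mul_adj2[of A] in \<open>auto simp: SL2C_def det_2 mult.commute\<close>)
qed (auto simp: SL2C_def det_mul matrix_mul_assoc)

lemma SL2C_simps [simp]:
  "carrier SL2C = {A. det A = 1}" "mult SL2C = (**)" "one SL2C = mat 1"
  by (simp_all add: SL2C_def)

lemma inv_SL2C: "det A = 1 \<Longrightarrow> inv\<^bsub>SL2C\<^esub> A = adj2 A"
  using mul_adj2[of A] group.inv_equality[OF group_SL2C, of "adj2 A" A] by (simp add: det_2 mult.commute)

text \<open>Cayley-Hamilton, \<open>A^2 = trace A * A - det A\<close>, multiplied by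
  \<open>C\<close> on the right and traced.\<close>

lemma trace_mul_recurrence:
  fixes A C :: "complex^2^2"
  assumes "det A = 1"
  shows "trace (A ** (A ** C)) = trace A * trace (A ** C) - trace C"
proof -
  have "A$1$1 * A$2$2 - A$1$2 * A$2$1 = 1" using assms by (simp add: det_2)
  moreover have "a * (a * x + b * y) + b * (c * x + d * y) + (c * (a * z + b * w) + d * (c * z + d * w)) =
      (a + d) * (a * x + b * y + (c * z + d * w)) - (x + w)"
    if "a * d - b * c = 1" for a b c d x y z w :: complex
  proof -
    have "x + w = (a * d - b * c) * (x + w)" using that by simp
    then show ?thesis by (simp add: algebra_simps)
  qed
  ultimately show ?thesis unfolding trace_2 mat_mul_2 by blast
qed

text \<open>Cayley-Hamilton without the linear term.\<close>

lemma trace_zero_square: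
  fixes B :: "complex^2^2"
  assumes "det B = 1" "trace B = 0"
  shows "B ** B = - mat 1"
proof -
  have "B$1$1 + B$2$2 = 0" "B$1$1 * B$2$2 - B$1$2 * B$2$1 = 1"
    using assms by (simp_all add: trace_2 det_2)
  moreover have "a * a + b * c = - 1" "a * b + b * d = 0" "c * a + d * c = 0" "c * b + d * d = - 1"
    if "a + d = 0" "a * d - b * c = 1" for a b c d :: complex
  proof -
    have d: "d = - a" using that(1) by (simp add: eq_neg_iff_add_eq_0 add.commute)
    have "- (a * a) - b * c = 1" using that(2) by (simp add: d)
    then show "a * a + b * c = - 1" by (metis minus_add_distrib minus_minus uminus_add_conv_diff add.commute)
    then show "a * b + b * d = 0" "c * a + d * c = 0" "c * b + d * d = - 1"
      by (simp_all add: d algebra_simps)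
  qed
  ultimately show ?thesis by (simp add: mat_eq_2 mat_mul_2)
qed

text \<open>For \<open>n = R - 1\<close>, nilpotent of rank one, \<open>A\<close> is a polynomial in \<open>n\<close>, while
  \<open>n B n = trace (n B) n = 0\<close> and likewise \<open>n B\<inverse> n = 0\<close>.\<close>

lemma unipotent_commutes_conjugate:
  fixes R A B :: "complex^2^2"
  assumes R: "det R = 1" "trace R = 2" "R \<noteq> mat 1"
    and comm: "R ** A = A ** R" and B: "det B = 1" and tr: "trace (R ** B) = trace B"
  shows "A ** (B ** A ** adj2 B) = (B ** A ** adj2 B) ** A"
proof -
  define p where "p = R$1$1 - 1"
  define q where "q = R$1$2"
  define r where "r = R$2$1"
  have R11: "R$1$1 = 1 + p" and R12: "R$1$2 = q" and R21: "R$2$1 = r" by (simp_all add: p_def q_def r_def)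
  have R22: "R$2$2 = 1 - p" using R(2) by (simp add: trace_2 p_def algebra_simps)
  have n2: "p * p + q * r = 0"
    using R(1) unfolding det_2 R11 R12 R21 R22 by (simp add: algebra_simps)
  have qr: "q \<noteq> 0 \<or> r \<noteq> 0"
    using n2 R(3) R11 R12 R21 R22 by (auto simp: mat_eq_2)
  define a b c d where "a = A$1$1" and "b = A$1$2" and "c = A$2$1" and "d = A$2$2"
  define e f g h where "e = B$1$1" and "f = B$1$2" and "g = B$2$1" and "h = B$2$2"
  note defs = a_def[symmetric] b_def[symmetric] c_def[symmetric] d_def[symmetric]
    e_def[symmetric] f_def[symmetric] g_def[symmetric] h_def[symmetric]
  have c1: "q * c = b * r" and c2: "q * d + p * b = a * q - b * p" and c3: "r * a - p * c = c * p + d * r"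
  proof -
    have "(1 + p) * a + q * c = a * (1 + p) + b * r" "(1 + p) * b + q * d = a * q + b * (1 - p)"
      "r * a + (1 - p) * c = c * (1 + p) + d * r"
      using comm unfolding mat_eq_2 mat_mul_2 R11 R12 R21 R22 defs by blast+
    then show "q * c = b * r" "q * d + p * b = a * q - b * p" "r * a - p * c = c * p + d * r"
      by (simp_all add: algebra_simps)
  qed
  have t: "p * e + q * g + r * f - p * h = 0"
    using tr unfolding trace_2 mat_mul_2 R11 R12 R21 R22 defs by (simp add: algebra_simps)
  \<comment> \<open>Only the polynomials \<open>x + y n\<close> in a nonzero nilpotent 2x2 matrix
    \<open>n = R - 1\<close> commute with it. If \<open>q \<noteq> 0\<close>, the upper right entry
    gives \<open>y\<close>; otherwise \<open>r\<close> is the only nonzero entry of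
    \<open>n\<close>.\<close>
  obtain x y where A: "a = x + y * p" "b = y * q" "c = y * r" "d = x - y * p"
  proof (cases "q = 0")
    case False
    have "c = b * r / q" using c1 False by (simp add: eq_divide_eq mult.commute)
    moreover have "d = (a * q - 2 * (b * p)) / q"
      using c2 False by (simp add: eq_divide_eq algebra_simps)
    ultimately show ?thesis
      by (intro that[of "a - b * p / q" "b / q"]) (simp_all add: False diff_divide_distrib)
  next
    case True
    then have "r \<noteq> 0" "p = 0" "b = 0" using qr n2 c1 by auto
    show ?thesis
      by (rule that[of a "c / r"]) (use True \<open>r \<noteq> 0\<close> \<open>p = 0\<close> \<open>b = 0\<close> c3 in \<open>simp_all add: field_simps\<close>)
  qed
  define n where "n = R - mat 1"
  have n_nth: "n$1$1 = p" "n$1$2 = q" "n$2$1 = r" "n$2$2 = - p"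
    by (simp_all add: n_def R11 R12 R21 R22)
  \<comment> \<open>The assumption says \<open>trace (n C) = 0\<close>; for \<open>n\<close> of rank
    one, \<open>n C n\<close> is this trace times \<open>n\<close>.\<close>
  have sandwich: "n ** C ** n = 0" if "p * C$1$1 + q * C$2$1 + r * C$1$2 - p * C$2$2 = 0" for C
  proof -
    let ?t = "p * C$1$1 + q * C$2$1 + r * C$1$2 - p * C$2$2" and ?d = "p * p + q * r"
    have "(n ** C ** n)$1$1 = p * ?t + C$2$2 * ?d" "(n ** C ** n)$1$2 = q * ?t - C$1$2 * ?d"
      "(n ** C ** n)$2$1 = r * ?t - C$2$1 * ?d" "(n ** C ** n)$2$2 = - p * ?t + C$1$1 * ?d"
      unfolding mat_mul_2 n_nth by (simp_all add: algebra_simps)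
    then show ?thesis using that n2 by (simp add: mat_eq_2)
  qed
  have nBn: "n ** B ** n = 0" by (rule sandwich) (use t in \<open>simp add: defs\<close>)
  \<comment> \<open>\<open>trace (n B^-1) = trace n * trace B - trace (n B)\<close>, where both
    terms vanish.\<close>
  have nBn': "n ** adj2 B ** n = 0"
    by (rule sandwich) (use t in \<open>simp add: defs algebra_simps\<close>)
  define m where "m = B ** n ** adj2 B"
  define W where "W = B ** A ** adj2 B"
  have "n ** m = (n ** B ** n) ** adj2 B" by (simp add: m_def matrix_mul_assoc)
  then have nm: "n ** m = 0" by (simp add: nBn mat_eq_2 mat_mul_2)
  have "m ** n = B ** (n ** adj2 B ** n)" by (simp add: m_def matrix_mul_assoc)
  then have mn: "m ** n = 0" by (simp add: nBn' mat_eq_2 mat_mul_2)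
  have Bd: "e * h = 1 + f * g" using B by (simp add: det_2 defs diff_eq_eq)
  have m_nth: "m$1$1 = (e * p + f * r) * h - (e * q - f * p) * g"
    "m$1$2 = (e * q - f * p) * e - (e * p + f * r) * f"
    "m$2$1 = (g * p + h * r) * h - (g * q - h * p) * g"
    "m$2$2 = (g * q - h * p) * e - (g * p + h * r) * f"
    unfolding m_def mat_mul_2 adj2_nth n_nth defs by (simp_all add: algebra_simps)
  \<comment> \<open>Conjugation by \<open>B\<close> turns \<open>A = x + y n\<close> into
    \<open>W = x + y m\<close>. Since \<open>n m = m n = 0\<close>, both products of
    \<open>A\<close> and \<open>W\<close> are \<open>x^2 + x y (n + m)\<close>.\<close>
  have W_nth: "W$1$1 = x + y * m$1$1" "W$1$2 = y * m$1$2" "W$2$1 = y * m$2$1" "W$2$2 = x + y * m$2$2"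
  proof -
    have "W$1$1 = x * (e * h - f * g) + y * m$1$1" "W$1$2 = y * m$1$2"
      "W$2$1 = y * m$2$1" "W$2$2 = x * (e * h - f * g) + y * m$2$2"
      unfolding W_def mat_mul_2 adj2_nth m_nth defs A by (simp_all add: algebra_simps)
    then show "W$1$1 = x + y * m$1$1" "W$1$2 = y * m$1$2" "W$2$1 = y * m$2$1" "W$2$2 = x + y * m$2$2"
      using Bd by simp_all
  qed
  have "A ** W = (\<chi> i j. (x * x) * mat 1 $ i $ j + x * y * (n $ i $ j + m $ i $ j) + y * y * (n ** m) $ i $ j)"
    by (simp add: mat_eq_2 mat_mul_2 W_nth defs A n_nth algebra_simps)
  moreover have "W ** A = (\<chi> i j. (x * x) * mat 1 $ i $ j + x * y * (n $ i $ j + m $ i $ j) + y * y * (m ** n) $ i $ j)"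
    by (simp add: mat_eq_2 mat_mul_2 W_nth defs A n_nth algebra_simps)
  ultimately show ?thesis by (simp add: W_def[symmetric] nm mn)
qed


text \<open>Some pair of consecutive values occurs twice, and such a pair determines the sequence in
  both directions: the coefficient of \<open>x k\<close> is \<open>-1\<close>, so the recurrence
  also runs backwards. Hence the period starts at index 0.\<close>

lemma recurrence_finite_range_periodic:
  fixes x :: "nat \<Rightarrow> complex"
  assumes rec: "\<And>k. x (Suc (Suc k)) = t * x (Suc k) - x k" and fin: "finite (range x)"
  obtains p where "p > 0" "\<And>k. x (k + p) = x k"
proof -
  have "finite (range (\<lambda>k. (x k, x (Suc k))))"
    by (rule finite_subset[OF _ finite_cartesian_product[OF fin fin]]) auto
  then have "\<not> inj (\<lambda>k. (x k, x (Suc k)))"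
    using finite_imageD by blast
  then obtain i j where "i < j" and ij: "x i = x j" "x (Suc i) = x (Suc j)"
    unfolding inj_on_def by (metis nat_neq_iff Pair_inject)
  define p where "p = j - i"
  define P where "P k \<longleftrightarrow> x (k + p) = x k \<and> x (Suc k + p) = x (Suc k)" for k
  have "P i" using ij \<open>i < j\<close> by (simp add: P_def p_def)
  have up: "P (Suc k)" if "P k" for k
    using that rec[of k] rec[of "k + p"] by (simp add: P_def)
  have prev: "x k = t * x (Suc k) - x (Suc (Suc k))" for k
    using rec[of k] by simp
  have down: "P k" if "P (Suc k)" for k
    using that prev[of k] prev[of "k + p"] by (simp add: P_def)
  have "P 0" using \<open>P i\<close> by (induction i) (use down in simp_all)
  then have "P k" for k by (induction k) (use up in simp_all)
  then show ?thesis using that[of p] \<open>i < j\<close> by (simp add: P_def p_def)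
qed

lemma finite_traces_imp_commute:
  fixes A B :: "complex^2^2" and N :: nat
  assumes A: "det A = 1" and B: "det B = 1" and "N > 0"
    and fin: "finite (range (\<lambda>k. trace ((A [^]\<^bsub>SL2C\<^esub> (N * k)) ** B)))"
    and inf: "\<And>m::nat. m > 0 \<Longrightarrow> A [^]\<^bsub>SL2C\<^esub> m \<noteq> mat 1"
    and B2: "B ** B \<noteq> - mat 1"
  shows "A ** (B ** A ** adj2 B) = (B ** A ** adj2 B) ** A"
proof -
  interpret SL: group SL2C by (rule group_SL2C)
  define M where "M = A [^]\<^bsub>SL2C\<^esub> N"
  have detp: "det (A [^]\<^bsub>SL2C\<^esub> k) = 1" for k :: nat
    using SL.nat_pow_closed[of A k] A by simp
  have Mp: "M [^]\<^bsub>SL2C\<^esub> k = A [^]\<^bsub>SL2C\<^esub> (N * k)" for k :: nat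
    using SL.nat_pow_pow[of A N k] A by (simp add: M_def)
  define x where "x k = trace ((M [^]\<^bsub>SL2C\<^esub> k) ** B)" for k :: nat
  have MS: "M [^]\<^bsub>SL2C\<^esub> Suc k = M ** M [^]\<^bsub>SL2C\<^esub> k" for k :: nat
    using SL.nat_pow_Suc2[of M k] detp by (simp add: M_def)
  have detM: "det M = 1" by (simp add: M_def detp)
  have rec: "x (Suc (Suc k)) = trace M * x (Suc k) - x k" for k
    using trace_mul_recurrence[OF detM, of "M [^]\<^bsub>SL2C\<^esub> k ** B"]
    unfolding x_def MS by (simp add: matrix_mul_assoc)
  have "finite (range x)" using fin by (simp add: x_def Mp)
  then obtain p where p: "p > 0" "\<And>k. x (k + p) = x k"
    using recurrence_finite_range_periodic[of x, OF rec] by blast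
  define R where "R = M [^]\<^bsub>SL2C\<^esub> p"
  have R: "R = A [^]\<^bsub>SL2C\<^esub> (N * p)" by (simp add: R_def Mp)
  have detR: "det R = 1" by (simp add: R detp)
  have "R ** R = M [^]\<^bsub>SL2C\<^esub> (p + p)"
    using SL.nat_pow_mult[of M p p] detM by (simp add: R_def)
  then have x: "x 0 = trace B" "x p = trace (R ** B)" "x (p + p) = trace (R ** (R ** B))"
    by (simp_all add: x_def R_def matrix_mul_assoc)
  have trR: "trace (R ** B) = trace B" "trace (R ** (R ** B)) = trace B"
    using x p(2)[of 0] p(2)[of p] by simp_all
  \<comment> \<open>Two steps by \<open>R\<close> leave the trace unchanged, so the recurrence reads
    \<open>trace B = trace R * trace B - trace B\<close>.\<close>
  have "trace B * (2 - trace R) = 0"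
    using trace_mul_recurrence[OF detR, of B] trR by (simp add: algebra_simps)
  moreover have "trace B \<noteq> 0" using trace_zero_square B B2 by blast
  ultimately have "trace R = 2" by simp
  moreover have "R \<noteq> mat 1" using inf[of "N * p"] \<open>N > 0\<close> p(1) by (simp add: R)
  moreover have "R ** A = A ** R"
    using SL.nat_pow_Suc2[of A "N * p"] SL.nat_pow_Suc[of A "N * p"] A by (simp add: R)
  ultimately show ?thesis
    using unipotent_commutes_conjugate detR trR(1) B by blast
qed

section \<open>From points of the character variety to traces\<close>

text \<open>A class function evaluated at \<open>\<gamma>\<close> is an invariant. After subtraction
  of a constant \<open>c\<close> it lies in the ideal of \<open>\<sigma>\<close> exactly when
  \<open>c\<close> is the value at \<open>\<sigma>\<close>, so the value can be read off from the
  point.\<close>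

lemma character_point_finite_values:
  fixes \<Gamma> :: "('p, 'u) monoid_scheme" and G :: "('g, 'v) monoid_scheme"
  assumes h: "h \<in> R" and \<gamma>: "\<gamma> \<in> carrier \<Gamma>"
    and class_fun: "\<And>a c. a \<in> carrier G \<Longrightarrow> c \<in> carrier G \<Longrightarrow> h (a \<otimes>\<^bsub>G\<^esub> c \<otimes>\<^bsub>G\<^esub> inv\<^bsub>G\<^esub> a) = h c"
    and fin: "finite (character_point \<Gamma> G R ` Z)"
  shows "finite ((\<lambda>\<sigma>. h (\<sigma> \<gamma>)) ` Z)"
proof -
  define f where "f c = (\<lambda>\<sigma>. h (\<sigma> \<gamma>) + - c)" for c
  have inv: "f c \<in> invariant_ring \<Gamma> G R" for c
  proof -
    have "f c \<in> hom_ring \<Gamma> R"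
      unfolding hom_ring_def f_def
      by (rule fun_algebra.add[OF fun_algebra.gen fun_algebra.const]) (use h \<gamma> in blast)
    moreover have "\<sigma> \<gamma> \<in> carrier G" if "\<sigma> \<in> hom \<Gamma> G" for \<sigma>
      using that \<gamma> by (auto simp: hom_def)
    ultimately show ?thesis using class_fun by (simp add: invariant_ring_def f_def)
  qed
  have "h (\<sigma> \<gamma>) = (THE c. f c \<in> character_point \<Gamma> G R \<sigma>)" for \<sigma>
  proof (rule the_equality[symmetric])
    show "f (h (\<sigma> \<gamma>)) \<in> character_point \<Gamma> G R \<sigma>"
      using inv[of "h (\<sigma> \<gamma>)"] by (simp add: character_point_def f_def)
    show "c = h (\<sigma> \<gamma>)" if "f c \<in> character_point \<Gamma> G R \<sigma>" for c
      using that by (simp add: character_point_def f_def)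
  qed
  then have "(\<lambda>\<sigma>. h (\<sigma> \<gamma>)) ` Z = (\<lambda>V. THE c. f c \<in> V) ` character_point \<Gamma> G R ` Z"
    by (simp add: image_image)
  with fin show ?thesis by simp
qed

text \<open>One condition against each way in which the traces of \<open>A^(N k) B\<close> can be
  finite in number: \<open>A\<close> has finite order, \<open>B^2 = -1\<close>, or \<open>A\<close>
  commutes with \<open>B A B^-1\<close>.\<close>

definition twisting_pair :: "('p, 'u) monoid_scheme \<Rightarrow> 'p \<Rightarrow> 'p \<Rightarrow> bool" where
  "twisting_pair \<Gamma> a b \<longleftrightarrow> a \<in> carrier \<Gamma> \<and> b \<in> carrier \<Gamma> \<and>
     (\<forall>m::nat. m > 0 \<longrightarrow> a [^]\<^bsub>\<Gamma>\<^esub> m \<noteq> \<one>\<^bsub>\<Gamma>\<^esub>) \<and> b [^]\<^bsub>\<Gamma>\<^esub> (4::nat) \<noteq> \<one>\<^bsub>\<Gamma>\<^esub> \<and>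
     a \<otimes>\<^bsub>\<Gamma>\<^esub> (b \<otimes>\<^bsub>\<Gamma>\<^esub> a \<otimes>\<^bsub>\<Gamma>\<^esub> inv\<^bsub>\<Gamma>\<^esub> b) \<noteq> (b \<otimes>\<^bsub>\<Gamma>\<^esub> a \<otimes>\<^bsub>\<Gamma>\<^esub> inv\<^bsub>\<Gamma>\<^esub> b) \<otimes>\<^bsub>\<Gamma>\<^esub> a"

text \<open>Serves to move the pair from the crossing point of the loops to the given base
  point.\<close>

lemma twisting_pair_mon:
  fixes \<Gamma> :: "('p, 'u) monoid_scheme" and \<Delta> :: "('q, 'v) monoid_scheme"
  assumes "group \<Gamma>" "group \<Delta>" and f: "f \<in> mon \<Gamma> \<Delta>" and ab: "twisting_pair \<Gamma> a b"
  shows "twisting_pair \<Delta> (f a) (f b)"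
proof -
  interpret \<Gamma>: group \<Gamma> by fact
  interpret \<Delta>: group \<Delta> by fact
  interpret f: group_hom \<Gamma> \<Delta> f by unfold_locales (use f in \<open>simp add: mon_def\<close>)
  have inj: "f u = f v \<longleftrightarrow> u = v" if "u \<in> carrier \<Gamma>" "v \<in> carrier \<Gamma>" for u v
    using f that by (auto simp: mon_def dest: inj_onD)
  have c: "a \<in> carrier \<Gamma>" "b \<in> carrier \<Gamma>" using ab by (auto simp: twisting_pair_def)
  have pow: "f u [^]\<^bsub>\<Delta>\<^esub> m = \<one>\<^bsub>\<Delta>\<^esub> \<longleftrightarrow> u [^]\<^bsub>\<Gamma>\<^esub> m = \<one>\<^bsub>\<Gamma>\<^esub>" if "u \<in> carrier \<Gamma>" for u and m :: nat
    using that inj[of "u [^]\<^bsub>\<Gamma>\<^esub> m" "\<one>\<^bsub>\<Gamma>\<^esub>"] by (simp add: f.hom_nat_pow)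
  show ?thesis
    using ab c inj[of "a \<otimes>\<^bsub>\<Gamma>\<^esub> (b \<otimes>\<^bsub>\<Gamma>\<^esub> a \<otimes>\<^bsub>\<Gamma>\<^esub> inv\<^bsub>\<Gamma>\<^esub> b)" "(b \<otimes>\<^bsub>\<Gamma>\<^esub> a \<otimes>\<^bsub>\<Gamma>\<^esub> inv\<^bsub>\<Gamma>\<^esub> b) \<otimes>\<^bsub>\<Gamma>\<^esub> a"]
    by (simp add: twisting_pair_def pow)
qed

text \<open>Common setting for both groups: \<open>\<pi>\<close> is the identity, or the projection to the quotient.\<close>

lemma infinite_character_points:
  fixes \<Gamma> :: "('p, 'u) monoid_scheme" and G :: "('g, 'v) monoid_scheme" and \<phi> :: "nat \<Rightarrow> 'p \<Rightarrow> 'p"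
  assumes "group \<Gamma>" and "group G"
    and \<pi>: "\<pi> \<in> hom SL2C G" "\<pi> ` carrier SL2C = carrier G"
    and h: "h \<in> R" "\<And>A. det A = 1 \<Longrightarrow> h (\<pi> A) = (trace A)\<^sup>2"
    and \<rho>: "\<rho> \<in> mon \<Gamma> G"
    and pair: "twisting_pair \<Gamma> a b" and "N > 0"
    and \<phi>: "\<And>k. \<phi> k b = a [^]\<^bsub>\<Gamma>\<^esub> (N * k) \<otimes>\<^bsub>\<Gamma>\<^esub> b"
    and fin: "finite (range (\<lambda>k. character_point \<Gamma> G R (\<rho> \<circ> \<phi> k)))"
  shows False
proof -
  interpret \<Gamma>: group \<Gamma> by fact
  interpret G: group G by fact
  interpret SL: group SL2C by (rule group_SL2C)
  have ab: "a \<in> carrier \<Gamma>" "b \<in> carrier \<Gamma>"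
    and a: "\<And>m::nat. m > 0 \<Longrightarrow> a [^]\<^bsub>\<Gamma>\<^esub> m \<noteq> \<one>\<^bsub>\<Gamma>\<^esub>" and b: "b [^]\<^bsub>\<Gamma>\<^esub> (4::nat) \<noteq> \<one>\<^bsub>\<Gamma>\<^esub>"
    using pair by (auto simp: twisting_pair_def)
  have \<rho>h: "\<rho> \<in> hom \<Gamma> G" and inj: "inj_on \<rho> (carrier \<Gamma>)" using \<rho> by (auto simp: mon_def)
  interpret \<rho>: group_hom \<Gamma> G \<rho> by unfold_locales (fact \<rho>h)
  interpret \<pi>: group_hom SL2C G \<pi> by unfold_locales (fact \<pi>)
  have \<pi>m: "\<pi> (C ** D) = \<pi> C \<otimes>\<^bsub>G\<^esub> \<pi> D" if "det C = 1" "det D = 1" for C D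
    using \<pi>.hom_mult[of C D] that by simp
  have \<pi>i: "inv\<^bsub>G\<^esub> \<pi> C = \<pi> (adj2 C)" if "det C = 1" for C
    using \<pi>.hom_inv[of C] that inv_SL2C by simp
  have det_adj: "det (adj2 C) = det C" for C by (simp add: det_2 algebra_simps)
  have lift: "\<exists>C. det C = 1 \<and> \<pi> C = c" if "c \<in> carrier G" for c
  proof -
    have "c \<in> \<pi> ` carrier SL2C" using that by (simp only: \<pi>(2))
    then show ?thesis by auto
  qed
  have class_fun: "h (c \<otimes>\<^bsub>G\<^esub> d \<otimes>\<^bsub>G\<^esub> inv\<^bsub>G\<^esub> c) = h d" if cd: "c \<in> carrier G" "d \<in> carrier G" for c d
  proof -
    obtain C where C: "det C = 1" "\<pi> C = c" using lift[OF cd(1)] by blast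
    obtain D where D: "det D = 1" "\<pi> D = d" using lift[OF cd(2)] by blast
    have "trace (C ** D ** adj2 C) = trace D"
      using trace_mul_sym[of "C ** D" "adj2 C"] mul_adj2(2)[OF C(1)] by (simp add: matrix_mul_assoc)
    moreover have "c \<otimes>\<^bsub>G\<^esub> d \<otimes>\<^bsub>G\<^esub> inv\<^bsub>G\<^esub> c = \<pi> (C ** D ** adj2 C)"
      unfolding C(2)[symmetric] D(2)[symmetric] using C(1) D(1)
      by (simp add: \<pi>m \<pi>i det_mul det_adj)
    ultimately show ?thesis using C D h(2)[of "C ** D ** adj2 C"] h(2)[of D]
      by (simp add: det_mul det_adj)
  qed
  \<comment> \<open>With lifts fixed once, \<open>A^(N k) B\<close> lifts the image of the twisted
    element for every \<open>k\<close>, so the recurrence holds for actual matrices and not only up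
    to sign.\<close>
  obtain A where A: "det A = 1" "\<pi> A = \<rho> a" using lift[OF \<rho>.hom_closed[OF ab(1)]] by blast
  obtain B where B: "det B = 1" "\<pi> B = \<rho> b" using lift[OF \<rho>.hom_closed[OF ab(2)]] by blast
  have \<pi>p: "\<pi> (C [^]\<^bsub>SL2C\<^esub> k) = \<pi> C [^]\<^bsub>G\<^esub> k" if "det C = 1" for C and k :: nat
    using \<pi>.hom_nat_pow[of C k] that by simp
  have detp: "det (A [^]\<^bsub>SL2C\<^esub> k) = 1" for k :: nat
    using SL.nat_pow_closed[of A k] A by simp
  have eq: "h (\<rho> (\<phi> k b)) = (trace (A [^]\<^bsub>SL2C\<^esub> (N * k) ** B))\<^sup>2" for k
  proof -
    have "\<rho> (\<phi> k b) = \<pi> (A [^]\<^bsub>SL2C\<^esub> (N * k) ** B)"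
      using ab A B by (simp add: \<phi> \<pi>m \<pi>p detp \<rho>.hom_nat_pow)
    then show ?thesis using h(2)[of "A [^]\<^bsub>SL2C\<^esub> (N * k) ** B"] detp B by (simp add: det_mul)
  qed
  have "finite ((\<lambda>\<sigma>. h (\<sigma> b)) ` range (\<lambda>k. \<rho> \<circ> \<phi> k))"
    by (rule character_point_finite_values[where G = G and R = R])
      (use h(1) ab class_fun fin in \<open>auto simp: image_image\<close>)
  then have fin2: "finite (range (\<lambda>k. (trace (A [^]\<^bsub>SL2C\<^esub> (N * k) ** B))\<^sup>2))"
    by (simp add: image_image eq)
  \<comment> \<open>What is known so far concerns squares of traces; each square comes from at most
    two traces.\<close>
  have "finite (range (\<lambda>k. trace (A [^]\<^bsub>SL2C\<^esub> (N * k) ** B)))"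
  proof (rule finite_subset)
    let ?F = "range (\<lambda>k. (trace (A [^]\<^bsub>SL2C\<^esub> (N * k) ** B))\<^sup>2)"
    show "range (\<lambda>k. trace (A [^]\<^bsub>SL2C\<^esub> (N * k) ** B)) \<subseteq> csqrt ` ?F \<union> (\<lambda>z. - csqrt z) ` ?F"
    proof
      fix z assume "z \<in> range (\<lambda>k. trace (A [^]\<^bsub>SL2C\<^esub> (N * k) ** B))"
      then have "z\<^sup>2 \<in> ?F" by blast
      moreover have "z = csqrt (z\<^sup>2) \<or> z = - csqrt (z\<^sup>2)"
        by (metis power2_csqrt power2_eq_iff)
      ultimately show "z \<in> csqrt ` ?F \<union> (\<lambda>z. - csqrt z) ` ?F" by blast
    qed
    show "finite (csqrt ` ?F \<union> (\<lambda>z. - csqrt z) ` ?F)" using fin2 by blast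
  qed
  moreover have "A [^]\<^bsub>SL2C\<^esub> m \<noteq> mat 1" if "m > 0" for m :: nat
  proof
    assume "A [^]\<^bsub>SL2C\<^esub> m = mat 1"
    then have "\<rho> (a [^]\<^bsub>\<Gamma>\<^esub> m) = \<rho> \<one>\<^bsub>\<Gamma>\<^esub>"
      using \<pi>p[of A m] A ab \<pi>.hom_one by (simp add: \<rho>.hom_nat_pow)
    then show False using inj_onD[OF inj, of "a [^]\<^bsub>\<Gamma>\<^esub> m" "\<one>\<^bsub>\<Gamma>\<^esub>"] a[OF that] ab by simp
  qed
  moreover have "B ** B \<noteq> - mat 1"
  proof
    assume "B ** B = - mat 1"
    then have "B [^]\<^bsub>SL2C\<^esub> (4::nat) = mat 1"
      by (simp add: numeral_eq_Suc matrix_mul_minus flip: matrix_mul_assoc)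
    then have "\<rho> (b [^]\<^bsub>\<Gamma>\<^esub> (4::nat)) = \<rho> \<one>\<^bsub>\<Gamma>\<^esub>"
      using \<pi>p[of B 4] B ab \<pi>.hom_one by (simp add: \<rho>.hom_nat_pow)
    then show False using inj_onD[OF inj, of "b [^]\<^bsub>\<Gamma>\<^esub> (4::nat)" "\<one>\<^bsub>\<Gamma>\<^esub>"] b ab by simp
  qed
  ultimately have "A ** (B ** A ** adj2 B) = (B ** A ** adj2 B) ** A"
    using finite_traces_imp_commute A(1) B(1) \<open>N > 0\<close> by blast
  then have "\<pi> (A ** (B ** A ** adj2 B)) = \<pi> ((B ** A ** adj2 B) ** A)" by simp
  then have "\<rho> (a \<otimes>\<^bsub>\<Gamma>\<^esub> (b \<otimes>\<^bsub>\<Gamma>\<^esub> a \<otimes>\<^bsub>\<Gamma>\<^esub> inv\<^bsub>\<Gamma>\<^esub> b)) = \<rho> ((b \<otimes>\<^bsub>\<Gamma>\<^esub> a \<otimes>\<^bsub>\<Gamma>\<^esub> inv\<^bsub>\<Gamma>\<^esub> b) \<otimes>\<^bsub>\<Gamma>\<^esub> a)"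
    using A B ab by (simp add: \<pi>m \<pi>i[symmetric] det_mul det_adj)
  from inj_onD[OF inj this] show False using pair ab by (simp add: twisting_pair_def)
qed

section \<open>The square of the trace on the two groups\<close>

lemma trace_square_ring: "(\<lambda>A. (trace A)\<^sup>2) \<in> SL2C_ring"
proof -
  have "(\<lambda>A. (A$1$1 + A$2$2) * (A$1$1 + A$2$2)) \<in> SL2C_ring"
    unfolding SL2C_ring_def by (intro fun_algebra.mult fun_algebra.add fun_algebra.gen) auto
  then show ?thesis by (simp add: trace_2 power2_eq_square)
qed

lemma normal_center_SL2C: "{mat 1, - mat 1} \<lhd> SL2C"
proof -
  interpret SL: group SL2C by (rule group_SL2C)
  have "subgroup {mat 1, - mat 1} SL2C"
  proof (rule SL.subgroupI)
    show "inv\<^bsub>SL2C\<^esub> A \<in> {mat 1, - mat 1}" if "A \<in> {mat 1, - mat 1}" for A :: "complex^2^2"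
    proof -
      have "adj2 (mat 1) = mat 1" "adj2 (- mat 1) = - mat 1" by (simp_all add: mat_eq_2)
      then show ?thesis using that by (auto simp: inv_SL2C det_minus_2)
    qed
  qed (auto simp: det_minus_2 matrix_mul_minus)
  then show ?thesis
    by (rule SL.normalI) (auto simp: r_coset_def l_coset_def matrix_mul_minus)
qed

lemma PSL2C_projection:
  defines "\<pi> \<equiv> \<lambda>A. {mat 1, - mat 1} #>\<^bsub>SL2C\<^esub> A"
  shows "group PSL2C" "\<pi> \<in> hom SL2C PSL2C" "\<pi> ` carrier SL2C = carrier PSL2C"
    "\<And>A. \<pi> A = {A, - A}"
proof -
  interpret normal "{mat 1, - mat 1}" SL2C by (rule normal_center_SL2C)
  show "group PSL2C" unfolding PSL2C_def by (rule factorgroup_is_group)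
  show "\<pi> \<in> hom SL2C PSL2C" unfolding PSL2C_def \<pi>_def by (rule r_coset_hom_Mod)
  show "\<pi> ` carrier SL2C = carrier PSL2C"
    unfolding PSL2C_def \<pi>_def by (auto simp: FactGroup_def RCOSETS_def)
  show "\<pi> A = {A, - A}" for A unfolding \<pi>_def by (auto simp: r_coset_def matrix_mul_minus)
qed

text \<open>The representative is arbitrary: on a coset \<open>{A, - A}\<close> the square removes
  the sign.\<close>

definition PSL2C_trace_square :: "(complex^2^2) set \<Rightarrow> complex" where
  "PSL2C_trace_square Z = (trace (SOME A. A \<in> Z))\<^sup>2"

lemma PSL2C_trace_square_coset: "PSL2C_trace_square ({mat 1, - mat 1} #>\<^bsub>SL2C\<^esub> A) = (trace A)\<^sup>2"
proof -
  have "(SOME C. C \<in> {A, - A}) \<in> {A, - A}" by (rule someI[of _ A]) simp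
  then have "(SOME C. C \<in> {A, - A}) = A \<or> (SOME C. C \<in> {A, - A}) = - A" by simp
  moreover have "(trace (- A))\<^sup>2 = (trace A)\<^sup>2" by (simp add: trace_2 power2_eq_square algebra_simps)
  ultimately show ?thesis unfolding PSL2C_trace_square_def PSL2C_projection(4) by metis
qed

lemma PSL2C_trace_square_ring: "PSL2C_trace_square \<in> PSL2C_ring"
  unfolding PSL2C_ring_def using trace_square_ring PSL2C_trace_square_coset
  by (auto intro!: bexI[of _ "\<lambda>A. (trace A)\<^sup>2"])

section \<open>The fundamental group\<close>

text \<open>The library states the unit and inverse laws for paths in normed spaces only; in general
  they follow by applying the path to the corresponding homotopies in the unit interval.\<close>

lemma path_laws:
  fixes p :: "real \<Rightarrow> 'a::topological_space"
  assumes "path p" "path_image p \<subseteq> T"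
  shows homotopic_paths_const_right: "homotopic_paths T (p +++ (\<lambda>_. pathfinish p)) p"
    and homotopic_paths_const_left: "homotopic_paths T ((\<lambda>_. pathstart p) +++ p) p"
    and homotopic_paths_inverse_right: "homotopic_paths T (p +++ reversepath p) (\<lambda>_. pathstart p)"
    and homotopic_paths_inverse_left: "homotopic_paths T (reversepath p +++ p) (\<lambda>_. pathfinish p)"
proof -
  let ?i = "linepath 0 (1::real)" and ?I = "{0..1::real}"
  have img: "homotopic_paths T (p \<circ> r) (p \<circ> s)" if "homotopic_paths ?I r s" for r s
    using homotopic_paths_continuous_image[OF that, of p T] assms by (auto simp: path_def path_image_def)
  have i: "path ?i" "path_image ?i \<subseteq> ?I" by (auto simp: closed_segment_eq_real_ivl)
  have p: "p \<circ> ?i = p" "p \<circ> linepath 0 0 = (\<lambda>_. p 0)" "p \<circ> linepath 1 1 = (\<lambda>_. p 1)"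
    "p \<circ> linepath 1 0 = reversepath p"
    by (auto simp: linepath_def reversepath_def)
  note simps = p path_compose_join pathstart_def pathfinish_def
  show "homotopic_paths T (p +++ (\<lambda>_. pathfinish p)) p"
    using img[OF homotopic_paths_rid[OF i]] by (simp add: simps)
  show "homotopic_paths T ((\<lambda>_. pathstart p) +++ p) p"
    using img[OF homotopic_paths_lid[OF i]] by (simp add: simps)
  show "homotopic_paths T (p +++ reversepath p) (\<lambda>_. pathstart p)"
    using img[OF homotopic_paths_rinv[OF i]] by (simp add: simps)
  show "homotopic_paths T (reversepath p +++ p) (\<lambda>_. pathfinish p)"
    using img[OF homotopic_paths_linv[OF i]] by (simp add: simps)
qed

definition path_class :: "'a::topological_space set \<Rightarrow> (real \<Rightarrow> 'a) \<Rightarrow> (real \<Rightarrow> 'a) set" where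
  "path_class T p = Collect (homotopic_paths T p)"

definition loop_at :: "'a::topological_space set \<Rightarrow> 'a \<Rightarrow> (real \<Rightarrow> 'a) \<Rightarrow> bool" where
  "loop_at T x p \<longleftrightarrow> path p \<and> path_image p \<subseteq> T \<and> pathstart p = x \<and> pathfinish p = x"

lemma loop_at_base: "loop_at T x p \<Longrightarrow> x \<in> T"
  using pathstart_in_path_image by (auto simp: loop_at_def)

lemma path_class_eqI: "homotopic_paths T p q \<Longrightarrow> path_class T p = path_class T q"
  unfolding path_class_def by (intro Collect_cong) (meson homotopic_paths_sym homotopic_paths_trans)

lemma path_class_eq_iff:
  "path p \<Longrightarrow> path_image p \<subseteq> T \<Longrightarrow> path_class T p = path_class T q \<longleftrightarrow> homotopic_paths T p q"
proof
  assume "path p" "path_image p \<subseteq> T" "path_class T p = path_class T q"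
  then have "p \<in> path_class T q" by (simp add: path_class_def set_eq_iff) (metis homotopic_paths_refl)
  then show "homotopic_paths T p q" by (simp add: path_class_def homotopic_paths_sym)
qed (rule path_class_eqI)

lemma carrier_fundamental_group: "carrier (fundamental_group T x) = path_class T ` Collect (loop_at T x)"
  by (auto simp: fundamental_group_def path_class_def loop_at_def)

lemma path_class_in_carrier: "loop_at T x p \<Longrightarrow> path_class T p \<in> carrier (fundamental_group T x)"
  by (simp add: carrier_fundamental_group)

lemma one_fundamental_group: "\<one>\<^bsub>fundamental_group T x\<^esub> = path_class T (\<lambda>_. x)"
  by (simp add: fundamental_group_def path_class_def)

lemma loop_at_join: "loop_at T x p \<Longrightarrow> loop_at T x q \<Longrightarrow> loop_at T x (p +++ q)"
  by (auto simp: loop_at_def path_image_join)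

lemma loop_at_const: "x \<in> T \<Longrightarrow> loop_at T x (\<lambda>_. x)"
  by (auto simp: loop_at_def path_def path_image_def pathstart_def pathfinish_def)

lemma loop_at_reversepath: "loop_at T x p \<Longrightarrow> loop_at T x (reversepath p)"
  by (auto simp: loop_at_def)

lemma mult_fundamental_group:
  assumes "loop_at T x p" "loop_at T x q"
  shows "path_class T p \<otimes>\<^bsub>fundamental_group T x\<^esub> path_class T q = path_class T (p +++ q)"
proof -
  have "(\<exists>p'\<in>path_class T p. \<exists>q'\<in>path_class T q. homotopic_paths T (p' +++ q') r)
      \<longleftrightarrow> homotopic_paths T (p +++ q) r" for r
  proof
    assume "\<exists>p'\<in>path_class T p. \<exists>q'\<in>path_class T q. homotopic_paths T (p' +++ q') r"
    then obtain p' q' where "homotopic_paths T p p'" "homotopic_paths T q q'" "homotopic_paths T (p' +++ q') r"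
      by (auto simp: path_class_def)
    moreover from this have "homotopic_paths T (p +++ q) (p' +++ q')"
      using assms by (intro homotopic_paths_join) (auto simp: loop_at_def)
    ultimately show "homotopic_paths T (p +++ q) r" using homotopic_paths_trans by metis
  next
    assume "homotopic_paths T (p +++ q) r"
    then show "\<exists>p'\<in>path_class T p. \<exists>q'\<in>path_class T q. homotopic_paths T (p' +++ q') r"
      using assms by (rule_tac bexI[of _ p], rule_tac bexI[of _ q]) (auto simp: path_class_def loop_at_def)
  qed
  then show ?thesis by (simp add: fundamental_group_def path_class_def)
qed

lemma group_fundamental_group:
  assumes "x \<in> T"
  shows "group (fundamental_group T x)" (is "group ?G")
proof (rule groupI)
  show "\<one>\<^bsub>?G\<^esub> \<in> carrier ?G"
    unfolding one_fundamental_group by (intro path_class_in_carrier loop_at_const assms)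
next
  fix a assume "a \<in> carrier ?G"
  then obtain p where p: "loop_at T x p" "a = path_class T p" by (auto simp: carrier_fundamental_group)
  show "\<one>\<^bsub>?G\<^esub> \<otimes>\<^bsub>?G\<^esub> a = a"
    unfolding one_fundamental_group p(2) mult_fundamental_group[OF loop_at_const[OF assms] p(1)]
    by (rule path_class_eqI, use p homotopic_paths_const_left[of p T] in \<open>auto simp: loop_at_def\<close>)
  have "path_class T (reversepath p) \<otimes>\<^bsub>?G\<^esub> a = \<one>\<^bsub>?G\<^esub>"
    unfolding one_fundamental_group p(2) mult_fundamental_group[OF loop_at_reversepath[OF p(1)] p(1)]
    by (rule path_class_eqI) (use homotopic_paths_inverse_left[of p T] p in \<open>auto simp: loop_at_def\<close>)
  then show "\<exists>b\<in>carrier ?G. b \<otimes>\<^bsub>?G\<^esub> a = \<one>\<^bsub>?G\<^esub>"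
    using path_class_in_carrier[OF loop_at_reversepath[OF p(1)]] by blast
next
  fix a b assume "a \<in> carrier ?G" "b \<in> carrier ?G"
  then obtain p q where p: "loop_at T x p" "a = path_class T p" and q: "loop_at T x q" "b = path_class T q"
    by (auto simp: carrier_fundamental_group)
  show "a \<otimes>\<^bsub>?G\<^esub> b \<in> carrier ?G"
    unfolding p(2) q(2) mult_fundamental_group[OF p(1) q(1)]
    by (intro path_class_in_carrier loop_at_join p q)
  fix c assume "c \<in> carrier ?G"
  then obtain r where r: "loop_at T x r" "c = path_class T r" by (auto simp: carrier_fundamental_group)
  have "path_class T ((p +++ q) +++ r) = path_class T (p +++ (q +++ r))"
    using p q r homotopic_paths_assoc[of p T q r]
    by (intro path_class_eqI[symmetric]) (auto simp: loop_at_def)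
  then show "a \<otimes>\<^bsub>?G\<^esub> b \<otimes>\<^bsub>?G\<^esub> c =
      a \<otimes>\<^bsub>?G\<^esub> (b \<otimes>\<^bsub>?G\<^esub> c)"
    unfolding p(2) q(2) r(2) by (simp add: mult_fundamental_group loop_at_join p(1) q(1) r(1))
qed

lemma inv_fundamental_group:
  assumes "loop_at T x p"
  shows "inv\<^bsub>fundamental_group T x\<^esub> (path_class T p) = path_class T (reversepath p)"
proof -
  let ?G = "fundamental_group T x"
  have "x \<in> T" using assms by (rule loop_at_base)
  then interpret group "?G" by (rule group_fundamental_group)
  have "path_class T (reversepath p) \<otimes>\<^bsub>?G\<^esub> path_class T p = \<one>\<^bsub>?G\<^esub>"
    unfolding one_fundamental_group mult_fundamental_group[OF loop_at_reversepath[OF assms] assms]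
    by (rule path_class_eqI) (use homotopic_paths_inverse_left[of p T] assms in \<open>auto simp: loop_at_def\<close>)
  then show ?thesis
    by (intro inv_equality) (auto intro!: path_class_in_carrier loop_at_reversepath assms)
qed

section \<open>Action of homeomorphisms on loops, and change of base point\<close>

text \<open>Free cancellation of \<open>D^-1 D\<close> inside a product; identities between
  conjugated loops are reduced to it by reassociating.\<close>

lemma homotopic_paths_cancel_middle:
  assumes "path u" "path_image u \<subseteq> T" "path D" "path_image D \<subseteq> T" "path Z" "path_image Z \<subseteq> T"
    and "pathfinish u = pathfinish D" "pathstart Z = pathfinish D"
  shows "homotopic_paths T ((u +++ reversepath D) +++ (D +++ Z)) (u +++ Z)"
proof -
  have 1: "homotopic_paths T ((u +++ reversepath D) +++ (D +++ Z)) (((u +++ reversepath D) +++ D) +++ Z)"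
    by (rule homotopic_paths_assoc) (use assms in \<open>auto simp: path_image_join\<close>)
  have 2: "homotopic_paths T ((u +++ reversepath D) +++ D) (u +++ (reversepath D +++ D))"
    by (rule homotopic_paths_sym, rule homotopic_paths_assoc) (use assms in \<open>auto simp: path_image_join\<close>)
  have 3: "homotopic_paths T (u +++ (reversepath D +++ D)) (u +++ (\<lambda>_. pathfinish D))"
    by (rule homotopic_paths_join) (use assms homotopic_paths_inverse_left in auto)
  have 4: "homotopic_paths T (u +++ (\<lambda>_. pathfinish D)) u"
    using assms homotopic_paths_const_right[of u T] by simp
  have 5: "homotopic_paths T (((u +++ reversepath D) +++ D) +++ Z) (u +++ Z)"
    by (rule homotopic_paths_join[OF homotopic_paths_trans[OF 2 homotopic_paths_trans[OF 3 4]]])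
      (use assms in auto)
  show ?thesis by (rule homotopic_paths_trans[OF 1 5])
qed

lemma induced_aut_path_class:
  assumes "loop_at T y p" and h: "continuous_on T h" "h \<in> T \<rightarrow> T"
    and c: "path c" "path_image c \<subseteq> T" "pathfinish c = h y"
  shows "induced_aut T h c (path_class T p) = path_class T ((c +++ (h \<circ> p)) +++ reversepath c)"
proof -
  have hom: "homotopic_paths T ((c +++ (h \<circ> p)) +++ reversepath c) ((c +++ (h \<circ> p')) +++ reversepath c)"
    if "homotopic_paths T p p'" for p'
    by (intro homotopic_paths_join homotopic_paths_continuous_image[OF that h])
      (use c assms in \<open>auto simp: pathstart_compose pathfinish_compose loop_at_def\<close>)
  have "(\<exists>p'\<in>path_class T p. homotopic_paths T ((c +++ (h \<circ> p')) +++ reversepath c) r) \<longleftrightarrow>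
      homotopic_paths T ((c +++ (h \<circ> p)) +++ reversepath c) r" for r
  proof
    assume "\<exists>p'\<in>path_class T p. homotopic_paths T ((c +++ (h \<circ> p')) +++ reversepath c) r"
    then obtain p' where p': "homotopic_paths T p p'" "homotopic_paths T ((c +++ (h \<circ> p')) +++ reversepath c) r"
      by (auto simp: path_class_def)
    show "homotopic_paths T ((c +++ (h \<circ> p)) +++ reversepath c) r"
      by (rule homotopic_paths_trans[OF hom[OF p'(1)] p'(2)])
  next
    assume "homotopic_paths T ((c +++ (h \<circ> p)) +++ reversepath c) r"
    then show "\<exists>p'\<in>path_class T p. homotopic_paths T ((c +++ (h \<circ> p')) +++ reversepath c) r"
      using assms(1) by (intro bexI[of _ p]) (auto simp: path_class_def loop_at_def)
  qed
  then show ?thesis by (simp add: induced_aut_def path_class_def)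
qed

lemma loop_at_conjugate:
  assumes "loop_at T y p" "path d" "path_image d \<subseteq> T" "pathstart d = x" "pathfinish d = y"
  shows "loop_at T x ((d +++ p) +++ reversepath d)"
  using assms by (auto simp: loop_at_def path_image_join)

lemma loop_at_compose:
  assumes "loop_at T y p" "continuous_on T h" "h \<in> T \<rightarrow> T'"
  shows "loop_at T' (h y) (h \<circ> p)"
  using assms path_continuous_image[of p h]
  by (auto simp: loop_at_def pathstart_compose pathfinish_compose path_image_compose
      intro: continuous_on_subset)

text \<open>If \<open>h\<close> fixes \<open>y\<close>, its action on loops at \<open>y\<close> is transported along \<open>d\<close> to a
  representative of the outer automorphism at the base point \<open>x\<close>.\<close>

lemma induced_aut_conjugate:
  assumes p: "loop_at T y p" and h: "continuous_on T h" "h \<in> T \<rightarrow> T" "h y = y"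
    and d: "path d" "path_image d \<subseteq> T" "pathstart d = x" "pathfinish d = y"
  shows "induced_aut T h (d +++ reversepath (h \<circ> d)) (path_class T ((d +++ p) +++ reversepath d)) =
    path_class T ((d +++ (h \<circ> p)) +++ reversepath d)"
proof -
  define D where "D = h \<circ> d"
  define P where "P = h \<circ> p"
  have hc: "continuous_on (path_image d) h" using h(1) d(2) continuous_on_subset by blast
  have D: "path D" "path_image D \<subseteq> T" "pathstart D = h x" "pathfinish D = y"
    using d h path_continuous_image[OF d(1) hc]
    by (auto simp: D_def path_image_compose pathstart_compose pathfinish_compose)
  have P: "path P" "path_image P \<subseteq> T" "pathstart P = y" "pathfinish P = y"
    using loop_at_compose[OF p h(1,2)] h(3) by (auto simp: P_def loop_at_def)
  have "h \<circ> ((d +++ p) +++ reversepath d) = (D +++ P) +++ reversepath D"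
    by (simp add: D_def P_def path_compose_join path_compose_reversepath)
  \<comment> \<open>The connecting path is \<open>d D^-1\<close> because \<open>h\<close> turns
    \<open>d p d^-1\<close> into \<open>D P D^-1\<close>; both copies of \<open>D\<close> then
    cancel.\<close>
  then have "induced_aut T h (d +++ reversepath D) (path_class T ((d +++ p) +++ reversepath d)) =
      path_class T (((d +++ reversepath D) +++ ((D +++ P) +++ reversepath D)) +++ reversepath (d +++ reversepath D))"
    using induced_aut_path_class[OF loop_at_conjugate[OF p d] h(1,2), of "d +++ reversepath D"] d D
    by (simp add: path_image_join)
  also have "reversepath (d +++ reversepath D) = D +++ reversepath d"
    by (subst reversepath_joinpaths) (use d D in auto)
  also have "path_class T (((d +++ reversepath D) +++ ((D +++ P) +++ reversepath D)) +++ (D +++ reversepath d)) =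
      path_class T (((d +++ P) +++ reversepath D) +++ (D +++ reversepath d))"
  proof (rule path_class_eqI, rule homotopic_paths_join)
    have 1: "homotopic_paths T ((d +++ reversepath D) +++ ((D +++ P) +++ reversepath D))
        ((d +++ reversepath D) +++ (D +++ (P +++ reversepath D)))"
      by (rule homotopic_paths_join[OF _ homotopic_paths_sym[OF homotopic_paths_assoc]])
        (use d D P in \<open>auto simp: path_image_join\<close>)
    have 2: "homotopic_paths T ((d +++ reversepath D) +++ (D +++ (P +++ reversepath D))) (d +++ (P +++ reversepath D))"
      by (rule homotopic_paths_cancel_middle) (use d D P in \<open>auto simp: path_image_join\<close>)
    have 3: "homotopic_paths T (d +++ (P +++ reversepath D)) ((d +++ P) +++ reversepath D)"
      by (rule homotopic_paths_assoc) (use d D P in auto)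
    show "homotopic_paths T ((d +++ reversepath D) +++ ((D +++ P) +++ reversepath D)) ((d +++ P) +++ reversepath D)"
      by (rule homotopic_paths_trans[OF 1 homotopic_paths_trans[OF 2 3]])
  qed (use d D P in \<open>auto simp: path_image_join\<close>)
  also have "\<dots> = path_class T ((d +++ P) +++ reversepath d)"
    by (intro path_class_eqI homotopic_paths_cancel_middle) (use d D P in \<open>auto simp: path_image_join\<close>)
  finally show ?thesis unfolding D_def P_def .
qed

text \<open>The change of base point is the special case \<open>h = id\<close> of \<open>induced_aut\<close>.\<close>

lemma base_change_mon:
  assumes d: "path d" "path_image d \<subseteq> T" "pathstart d = x" "pathfinish d = y"
  shows "induced_aut T id d \<in> mon (fundamental_group T y) (fundamental_group T x)"
    "\<And>p. loop_at T y p \<Longrightarrow> induced_aut T id d (path_class T p) = path_class T ((d +++ p) +++ reversepath d)"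
proof -
  show ind: "induced_aut T id d (path_class T p) = path_class T ((d +++ p) +++ reversepath d)" if "loop_at T y p" for p
    using induced_aut_path_class[OF that, of id d] d by simp
  have "induced_aut T id d (path_class T p \<otimes>\<^bsub>fundamental_group T y\<^esub> path_class T q) =
      induced_aut T id d (path_class T p) \<otimes>\<^bsub>fundamental_group T x\<^esub> induced_aut T id d (path_class T q)"
    if p: "loop_at T y p" and q: "loop_at T y q" for p q
  proof -
    have pq: "path p" "path_image p \<subseteq> T" "pathstart p = y" "pathfinish p = y"
      "path q" "path_image q \<subseteq> T" "pathstart q = y" "pathfinish q = y"
      using p q by (auto simp: loop_at_def)
    have 1: "homotopic_paths T (((d +++ p) +++ reversepath d) +++ ((d +++ q) +++ reversepath d))
        (((d +++ p) +++ reversepath d) +++ (d +++ (q +++ reversepath d)))"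
      by (rule homotopic_paths_join[OF _ homotopic_paths_sym[OF homotopic_paths_assoc]])
        (use d pq in \<open>auto simp: path_image_join\<close>)
    have 2: "homotopic_paths T (((d +++ p) +++ reversepath d) +++ (d +++ (q +++ reversepath d)))
        ((d +++ p) +++ (q +++ reversepath d))"
      by (rule homotopic_paths_cancel_middle) (use d pq in \<open>auto simp: path_image_join\<close>)
    have 3: "homotopic_paths T ((d +++ p) +++ (q +++ reversepath d)) (((d +++ p) +++ q) +++ reversepath d)"
      by (rule homotopic_paths_assoc) (use d pq in \<open>auto simp: path_image_join\<close>)
    have 4: "homotopic_paths T (((d +++ p) +++ q) +++ reversepath d) ((d +++ (p +++ q)) +++ reversepath d)"
      by (rule homotopic_paths_join[OF homotopic_paths_sym[OF homotopic_paths_assoc]])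
        (use d pq in \<open>auto simp: path_image_join\<close>)
    have "homotopic_paths T (((d +++ p) +++ reversepath d) +++ ((d +++ q) +++ reversepath d)) ((d +++ (p +++ q)) +++ reversepath d)"
      by (rule homotopic_paths_trans[OF 1 homotopic_paths_trans[OF 2 homotopic_paths_trans[OF 3 4]]])
    from path_class_eqI[OF this] show ?thesis
      by (simp add: ind p q mult_fundamental_group loop_at_join loop_at_conjugate[OF _ d])
  qed
  moreover have "induced_aut T id d (path_class T p) \<in> carrier (fundamental_group T x)" if "loop_at T y p" for p
    unfolding ind[OF that] by (intro path_class_in_carrier loop_at_conjugate[OF that d])
  ultimately have "induced_aut T id d \<in> hom (fundamental_group T y) (fundamental_group T x)"
    by (intro homI) (auto simp: carrier_fundamental_group)
  moreover have "inj_on (induced_aut T id d) (carrier (fundamental_group T y))"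
  proof (rule inj_onI)
    fix a b assume ab: "a \<in> carrier (fundamental_group T y)" "b \<in> carrier (fundamental_group T y)"
      "induced_aut T id d a = induced_aut T id d b"
    obtain p q where p: "loop_at T y p" "a = path_class T p" and q: "loop_at T y q" "b = path_class T q"
      using ab(1,2) by (auto simp: carrier_fundamental_group)
    have dr: "path (reversepath d)" "path_image (reversepath d) \<subseteq> T" "pathstart (reversepath d) = y" "pathfinish (reversepath d) = x"
      using d by auto
    \<comment> \<open>Conjugating back along \<open>reversepath d\<close> recovers the loop, which
      yields injectivity.\<close>
    have undo: "homotopic_paths T ((reversepath d +++ ((d +++ p) +++ reversepath d)) +++ d) p"
      if p: "loop_at T y p" for p
    proof -
      have p': "path p" "path_image p \<subseteq> T" "pathstart p = y" "pathfinish p = y" using p by (auto simp: loop_at_def)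
      let ?c = "\<lambda>_::real. y"
      have y: "y \<in> T" using d by (auto simp: pathfinish_in_path_image)
      have 0: "homotopic_paths T (reversepath d +++ ((d +++ p) +++ reversepath d)) (reversepath d +++ (d +++ (p +++ reversepath d)))"
        by (rule homotopic_paths_join[OF _ homotopic_paths_sym[OF homotopic_paths_assoc]])
          (use d p' in \<open>auto simp: path_image_join\<close>)
      have 1: "homotopic_paths T (reversepath d +++ (d +++ (p +++ reversepath d))) ((reversepath d +++ d) +++ (p +++ reversepath d))"
        by (rule homotopic_paths_assoc) (use d p' in \<open>auto simp: path_image_join\<close>)
      have 2: "homotopic_paths T ((reversepath d +++ d) +++ (p +++ reversepath d)) (?c +++ (p +++ reversepath d))"
        by (rule homotopic_paths_join) (use d p' homotopic_paths_inverse_left[of d T] in \<open>auto simp: path_image_join\<close>)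
      have 3: "homotopic_paths T (?c +++ (p +++ reversepath d)) (p +++ reversepath d)"
        using d p' homotopic_paths_const_left[of "p +++ reversepath d" T] by (simp add: path_image_join)
      have "homotopic_paths T (reversepath d +++ ((d +++ p) +++ reversepath d)) (p +++ reversepath d)"
        by (rule homotopic_paths_trans[OF 0 homotopic_paths_trans[OF 1 homotopic_paths_trans[OF 2 3]]])
      then have 4: "homotopic_paths T ((reversepath d +++ ((d +++ p) +++ reversepath d)) +++ d) ((p +++ reversepath d) +++ d)"
        by (rule homotopic_paths_join) (use d p' in auto)
      have 5: "homotopic_paths T ((p +++ reversepath d) +++ d) (p +++ (reversepath d +++ d))"
        by (rule homotopic_paths_sym[OF homotopic_paths_assoc]) (use d p' in auto)
      have 6: "homotopic_paths T (p +++ (reversepath d +++ d)) (p +++ ?c)"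
        by (rule homotopic_paths_join) (use d p' homotopic_paths_inverse_left[of d T] in auto)
      have 7: "homotopic_paths T (p +++ ?c) p"
        using p' homotopic_paths_const_right[of p T] by simp
      show ?thesis by (rule homotopic_paths_trans[OF 4 homotopic_paths_trans[OF 5 homotopic_paths_trans[OF 6 7]]])
    qed
    have "homotopic_paths T ((d +++ p) +++ reversepath d) ((d +++ q) +++ reversepath d)"
      using ab(3) ind[OF p(1)] ind[OF q(1)] p(2) q(2) loop_at_conjugate[OF p(1) d]
      by (simp add: path_class_eq_iff loop_at_def)
    note hom_pq = this
    have "homotopic_paths T ((reversepath d +++ ((d +++ p) +++ reversepath d)) +++ d)
        ((reversepath d +++ ((d +++ q) +++ reversepath d)) +++ d)"
      by (rule homotopic_paths_join[OF homotopic_paths_join[OF _ hom_pq]]) (use d p q in \<open>auto simp: loop_at_def\<close>)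
    then have "homotopic_paths T p q"
      by (rule homotopic_paths_trans[OF homotopic_paths_sym[OF undo[OF p(1)]]
            homotopic_paths_trans[OF _ undo[OF q(1)]]])
    then show "a = b" using p q path_class_eqI by blast
  qed
  ultimately show "induced_aut T id d \<in> mon (fundamental_group T y) (fundamental_group T x)"
    by (simp add: mon_def)
qed

text \<open>As \<open>h\<close> fixes \<open>a\<close> up to homotopy, applying \<open>h\<close>
  once more to \<open>a^k b\<close> only replaces \<open>b\<close> by \<open>a b\<close>.\<close>

lemma twist_power_path_class:
  assumes h: "continuous_on T h" "h \<in> T \<rightarrow> T" "h y = y"
    and a: "loop_at T y a" and b: "loop_at T y b"
    and ha: "homotopic_paths T (h \<circ> a) a" and hb: "homotopic_paths T (h \<circ> b) (a +++ b)"
  shows "path_class T ((h ^^ k) \<circ> b) =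
    path_class T a [^]\<^bsub>fundamental_group T y\<^esub> k \<otimes>\<^bsub>fundamental_group T y\<^esub> path_class T b"
proof -
  let ?G = "fundamental_group T y"
  have "y \<in> T" using a by (rule loop_at_base)
  then interpret G: group ?G by (rule group_fundamental_group)
  \<comment> \<open>\<open>h\<close> acts on loops and not on classes, so the power of
    \<open>a\<close> is carried along as a loop \<open>p\<close> that \<open>h\<close> fixes up to
    homotopy.\<close>
  have "\<exists>p. loop_at T y p \<and> path_class T p = path_class T a [^]\<^bsub>?G\<^esub> k \<and> homotopic_paths T (h \<circ> p) p" for k :: nat
  proof (induction k)
    case 0
    have "h \<circ> (\<lambda>_::real. y) = (\<lambda>_. y)" using h(3) by auto
    then show ?case
      using loop_at_const[OF \<open>y \<in> T\<close>]
      by (intro exI[of _ "\<lambda>_. y"]) (simp add: one_fundamental_group loop_at_def)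
  next
    case (Suc k)
    then obtain p where p: "loop_at T y p" "path_class T p = path_class T a [^]\<^bsub>?G\<^esub> k" "homotopic_paths T (h \<circ> p) p" by blast
    have "homotopic_paths T (h \<circ> (p +++ a)) (p +++ a)"
      unfolding path_compose_join
      by (rule homotopic_paths_join) (use p a ha h(3) in \<open>auto simp: loop_at_def pathstart_compose pathfinish_compose\<close>)
    then show ?case
      using p a by (intro exI[of _ "p +++ a"]) (auto simp: o_def loop_at_join simp flip: mult_fundamental_group)
  qed
  note pow = this
  have power_loop: "loop_at T y ((h ^^ k) \<circ> b)" for k
  proof (induction k)
    case (Suc k)
    then show ?case using loop_at_compose[OF Suc h(1,2)] h(3) by (simp add: o_def)
  qed (use b in simp)
  show ?thesis
  proof (induction k)
    case 0
    then show ?case using path_class_in_carrier[OF b] by simp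
  next
    case (Suc k)
    obtain p where p: "loop_at T y p" "path_class T p = path_class T a [^]\<^bsub>?G\<^esub> k" "homotopic_paths T (h \<circ> p) p"
      using pow by blast
    have "path_class T ((h ^^ k) \<circ> b) = path_class T (p +++ b)"
      using Suc p b by (simp add: o_def flip: mult_fundamental_group)
    then have "homotopic_paths T ((h ^^ k) \<circ> b) (p +++ b)"
      using power_loop[of k] by (simp add: path_class_eq_iff loop_at_def)
    then have "homotopic_paths T (h \<circ> ((h ^^ k) \<circ> b)) (h \<circ> (p +++ b))"
      by (rule homotopic_paths_continuous_image[OF _ h(1,2)])
    moreover have "homotopic_paths T (h \<circ> (p +++ b)) (p +++ (a +++ b))"
      unfolding path_compose_join
      by (rule homotopic_paths_join) (use p b hb h(3) in \<open>auto simp: loop_at_def pathstart_compose pathfinish_compose\<close>)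
    ultimately have "path_class T ((h ^^ Suc k) \<circ> b) = path_class T (p +++ (a +++ b))"
      by (intro path_class_eqI) (simp add: o_def, rule homotopic_paths_trans)
    also have "\<dots> = path_class T p \<otimes>\<^bsub>?G\<^esub> (path_class T a \<otimes>\<^bsub>?G\<^esub> path_class T b)"
      using p(1) a b by (simp add: mult_fundamental_group loop_at_join)
    finally show ?case
      using a b by (simp add: o_def p(2) path_class_in_carrier G.m_assoc)
  qed
qed

lemma homeomorphic_map_complement:
  assumes h: "homeomorphic_map (top_of_set S) (top_of_set S) h" "\<And>p. p \<in> P \<Longrightarrow> h p = p"
  shows "continuous_on (S - P) h" "h \<in> S - P \<rightarrow> S - P"
proof -
  have "continuous_on S h" using homeomorphic_imp_continuous_map[OF h(1)] by simp
  then show "continuous_on (S - P) h" by (rule continuous_on_subset) auto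
  have inj: "inj_on h S" and im: "h ` S = S"
    using homeomorphic_imp_injective_map[OF h(1)] homeomorphic_imp_surjective_map[OF h(1)] by simp_all
  show "h \<in> S - P \<rightarrow> S - P"
  proof
    fix v assume v: "v \<in> S - P"
    then have "h v \<in> S" using im by blast
    moreover have "h v \<notin> P"
    proof
      assume "h v \<in> P"
      then have "h (h v) = h v" using h(2) by simp
      then have "h v = v" using inj_onD[OF inj, of "h v" v] v \<open>h v \<in> S\<close> by simp
      then show False using v \<open>h v \<in> P\<close> by simp
    qed
    ultimately show "h v \<in> S - P" by blast
  qed
qed

section \<open>The Klein bottle\<close>

text \<open>\<open>klein\<close> is the quotient map from the plane to the Klein bottle, embedded in Euclidean space,
  and \<open>deck m n\<close> are its deck transformations.\<close>

definition klein :: "real \<times> real \<Rightarrow> complex \<times> real \<times> complex" where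
  "klein x = (cis (2 * pi * fst x), cos (2 * pi * snd x), cis (pi * fst x) * sin (2 * pi * snd x))"

definition deck :: "int \<Rightarrow> int \<Rightarrow> real \<times> real \<Rightarrow> real \<times> real" where
  "deck m n x = (fst x + m, (if even m then snd x else - snd x) + n)"

lemma cis_pi_int: "cis (pi * of_int m) = (if even m then 1 else -1)"
  by (auto simp: complex_eq_iff cos_int_times_real sin_int_times_real mult.commute elim!: evenE oddE)

text \<open>For odd \<open>m\<close> the factor \<open>cis (pi * fst x)\<close> changes its sign,
  which compensates the sign of the sine under the reflection of the second coordinate.\<close>

lemma klein_deck [simp]: "klein (deck m n x) = klein x"
proof -
  have 1: "cis (2 * pi * (fst x + of_int m)) = cis (2 * pi * fst x)"
    by (simp add: distrib_left flip: cis_mult)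
  have 2: "cis (pi * (fst x + of_int m)) = cis (pi * fst x) * (if even m then 1 else -1)"
    by (simp only: distrib_left cis_mult[symmetric] cis_pi_int)
  have 3: "cos (2 * pi * (y + of_int n)) = cos (2 * pi * y)" "sin (2 * pi * (y + of_int n)) = sin (2 * pi * y)" for y
    using cos.plus_of_int[of "2 * pi * y" n] sin.plus_of_int[of "2 * pi * y" n] by (simp_all add: algebra_simps)
  show ?thesis
    unfolding klein_def deck_def by (simp add: 1 2 3)
qed

lemma cis_eq_iff_int: "cis (2 * pi * a) = cis (2 * pi * b) \<longleftrightarrow> (\<exists>m::int. b = a + m)"
proof -
  have "cis (2 * pi * a) = cis (2 * pi * b) \<longleftrightarrow> exp (\<i> * of_real (2 * pi * b)) = exp (\<i> * of_real (2 * pi * a))"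
    by (auto simp: cis_conv_exp)
  also have "\<dots> \<longleftrightarrow> (\<exists>m::int. b = a + m)"
  proof -
    have "pi * (b * 2) = pi * (a * 2) + pi * (of_int m * 2) \<longleftrightarrow> (2 * pi) * b = (2 * pi) * (a + of_int m)" for m
      by (simp add: algebra_simps)
    also have "\<dots> m \<longleftrightarrow> b = a + of_int m" for m by (subst mult_cancel_left) simp
    finally show ?thesis unfolding exp_eq by (simp add: complex_eq_iff mult.commute mult.left_commute)
  qed
  finally show ?thesis .
qed

lemma cis_eqI: "cos a = cos b \<Longrightarrow> sin a = sin b \<Longrightarrow> cis a = cis b"
  by (simp add: complex_eq_iff)

text \<open>The first coordinate gives the shift \<open>m\<close>. Once \<open>deck m 0\<close> has
  been applied, the factor in front of the sine agrees, and cosine and sine leave only an integer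
  translation.\<close>

lemma klein_eqD:
  assumes "klein x = klein y"
  obtains m n where "y = deck m n x"
proof -
  obtain m :: int where m: "fst y = fst x + m"
    using assms cis_eq_iff_int by (auto simp: klein_def)
  define s where "s = (if even m then snd x else - snd x)"
  have "klein (deck m 0 x) = klein y" using assms by simp
  then have "cos (2 * pi * s) = cos (2 * pi * snd y)" "sin (2 * pi * s) = sin (2 * pi * snd y)"
    by (auto simp: klein_def deck_def m s_def)
  then obtain n :: int where "snd y = s + n" using cis_eq_iff_int cis_eqI by metis
  then show ?thesis using that[of m n] m by (simp add: deck_def s_def prod_eq_iff)
qed

lemma continuous_on_deck: "continuous_on A (deck m n)"
  unfolding deck_def by (cases "even m") (auto intro!: continuous_intros)

lemma continuous_int_valued_constant:
  fixes f :: "'a::topological_space \<Rightarrow> real"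
  assumes "connected T" "continuous_on T f" "\<And>t. t \<in> T \<Longrightarrow> f t \<in> \<int>" "s \<in> T" "t \<in> T"
  shows "f s = f t"
proof -
  have "f constant_on T"
  proof (rule continuous_discrete_range_constant[OF assms(1,2)])
    fix x assume x: "x \<in> T"
    have "1 \<le> norm (f y - f x)" if y: "y \<in> T" "f y \<noteq> f x" for y
    proof -
      obtain i j where ij: "f x = of_int i" "f y = of_int j"
        using assms(3)[OF x] assms(3)[OF y(1)] by (auto elim!: Ints_cases)
      then have "i \<noteq> j" using y by auto
      then have "1 \<le> \<bar>j - i\<bar>" by simp
      then show ?thesis unfolding ij real_norm_def by linarith
    qed
    then show "\<exists>e>0. \<forall>y. y \<in> T \<and> f y \<noteq> f x \<longrightarrow> e \<le> norm (f y - f x)"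
      by (intro exI[of _ 1]) auto
  qed
  then show ?thesis using assms by (auto simp: constant_on_def)
qed

section \<open>Lifting maps and homotopies to the plane\<close>

text \<open>The difference of the first coordinates is a constant integer, hence zero. Only then is
  the deck transformation between the two lifts a translation, so that the difference of the second
  coordinates is an integer as well.\<close>

lemma klein_lift_unique:
  fixes l l' :: "'a::topological_space \<Rightarrow> real \<times> real"
  assumes T: "connected T" "s \<in> T" "t \<in> T" and c: "continuous_on T l" "continuous_on T l'"
    and eq: "\<And>t. t \<in> T \<Longrightarrow> klein (l t) = klein (l' t)" and s: "l s = l' s"
  shows "l t = l' t"
proof -
  have fst_eq: "fst (l r) = fst (l' r)" if "r \<in> T" for r
  proof -
    have "fst (l' r) - fst (l r) = fst (l' s) - fst (l s)"
    proof (rule continuous_int_valued_constant[OF T(1) _ _ that T(2)])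
      show "continuous_on T (\<lambda>r. fst (l' r) - fst (l r))" by (intro continuous_intros c)
      show "fst (l' r) - fst (l r) \<in> \<int>" if "r \<in> T" for r
        using klein_eqD[OF eq[OF that]] by (metis add_diff_cancel_left' deck_def fst_conv Ints_of_int)
    qed
    then show ?thesis using s by simp
  qed
  have "snd (l' t) - snd (l t) = snd (l' s) - snd (l s)"
  proof (rule continuous_int_valued_constant[OF T(1) _ _ T(3,2)])
    show "continuous_on T (\<lambda>r. snd (l' r) - snd (l r))" by (intro continuous_intros c)
    show "snd (l' r) - snd (l r) \<in> \<int>" if r: "r \<in> T" for r
    proof -
      obtain m n where mn: "l' r = deck m n (l r)" using klein_eqD[OF eq[OF r]] .
      then have "fst (l' r) = fst (l r) + m" by (simp add: deck_def)
      then have "m = 0" using fst_eq[OF r] by simp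
      then show ?thesis using mn by (simp add: deck_def)
    qed
  qed
  then show ?thesis using s fst_eq[OF T(3)] by (simp add: prod_eq_iff)
qed

text \<open>The lift is the imaginary part of a continuous logarithm; modulus one makes the real
  part vanish.\<close>

lemma unit_circle_lift:
  fixes f :: "'a::real_normed_vector \<Rightarrow> complex"
  assumes "contractible T" "continuous_on T f" "\<And>t. t \<in> T \<Longrightarrow> cmod (f t) = 1"
  obtains u where "continuous_on T u" "\<And>t. t \<in> T \<Longrightarrow> f t = cis (2 * pi * u t)"
proof -
  have nz: "f t \<noteq> 0" if "t \<in> T" for t using assms(3)[OF that] by auto
  obtain g where g: "continuous_on T g" "\<And>t. t \<in> T \<Longrightarrow> f t = exp (g t)"
    using continuous_logarithm_on_contractible[OF assms(2,1) nz] by metis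
  show ?thesis
  proof
    show "continuous_on T (\<lambda>t. Im (g t) / (2 * pi))" by (intro continuous_intros g(1)) auto
    show "f t = cis (2 * pi * (Im (g t) / (2 * pi)))" if "t \<in> T" for t
    proof -
      have "exp (Re (g t)) = 1" using assms(3)[OF that] g(2)[OF that] by simp
      then have "Re (g t) = 0" by simp
      then show ?thesis using g(2)[OF that] by (simp add: exp_eq_polar)
    qed
  qed
qed

text \<open>Once the first coordinate is lifted to \<open>u\<close>, multiplying the third by
  \<open>cis (- (pi * u t))\<close> makes it real. Together with the second coordinate it then forms
  a map \<open>W\<close> to the unit circle, which is lifted in turn.\<close>

lemma klein_lift_exists:
  fixes f :: "'a::real_normed_vector \<Rightarrow> complex \<times> real \<times> complex"
  assumes T: "contractible T" and f: "continuous_on T f" "f ` T \<subseteq> range klein"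
  obtains l where "continuous_on T l" "\<And>t. t \<in> T \<Longrightarrow> klein (l t) = f t"
proof -
  define A B C where "A = (\<lambda>t. fst (f t))" and "B = (\<lambda>t. fst (snd (f t)))" and "C = (\<lambda>t. snd (snd (f t)))"
  have c: "continuous_on T A" "continuous_on T B" "continuous_on T C"
    unfolding A_def B_def C_def by (intro continuous_intros f(1))+
  have ex: "\<exists>x. A t = cis (2 * pi * fst x) \<and> B t = cos (2 * pi * snd x) \<and> C t = cis (pi * fst x) * sin (2 * pi * snd x)"
    if "t \<in> T" for t
    using f(2) that unfolding A_def B_def C_def by (force simp: klein_def)
  have "cmod (A t) = 1" if "t \<in> T" for t using ex[OF that] by auto
  then obtain u where u: "continuous_on T u" "\<And>t. t \<in> T \<Longrightarrow> A t = cis (2 * pi * u t)"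
    using unit_circle_lift[OF T c(1)] by metis
  define W where "W t = complex_of_real (B t) + \<i> * (cis (- (pi * u t)) * C t)" for t
  have cW: "continuous_on T W"
    unfolding W_def by (intro continuous_intros c u(1) continuous_on_cis)
  \<comment> \<open>\<open>u\<close> may differ by an integer \<open>m\<close> from the first
    coordinate of a given preimage; moving the preimage by \<open>deck m 0\<close> absorbs the
    difference.\<close>
  have ex2: "\<exists>v. B t = cos (2 * pi * v) \<and> cis (- (pi * u t)) * C t = sin (2 * pi * v)" if t: "t \<in> T" for t
  proof -
    obtain x where x: "A t = cis (2 * pi * fst x)" "B t = cos (2 * pi * snd x)" "C t = cis (pi * fst x) * sin (2 * pi * snd x)"
      using ex[OF t] by blast
    obtain m :: int where m: "u t = fst x + m" using x(1) u(2)[OF t] cis_eq_iff_int by metis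
    have "klein (deck m 0 x) = klein x" by simp
    then have "B t = cos (2 * pi * snd (deck m 0 x))" "C t = cis (pi * u t) * sin (2 * pi * snd (deck m 0 x))"
      using x m by (auto simp: klein_def deck_def)
    then show ?thesis by (intro exI[of _ "snd (deck m 0 x)"]) (simp add: cis_mult flip: mult.assoc)
  qed
  have "cmod (W t) = 1" if t: "t \<in> T" for t
  proof -
    obtain v where "B t = cos (2 * pi * v)" "cis (- (pi * u t)) * C t = sin (2 * pi * v)" using ex2[OF t] by blast
    then have "W t = cis (2 * pi * v)" by (simp add: W_def complex_eq_iff)
    then show ?thesis by simp
  qed
  then obtain v where v: "continuous_on T v" "\<And>t. t \<in> T \<Longrightarrow> W t = cis (2 * pi * v t)"
    using unit_circle_lift[OF T cW] by metis
  show ?thesis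
  proof
    show "continuous_on T (\<lambda>t. (u t, v t))" by (intro continuous_intros u v)
    show "klein (u t, v t) = f t" if t: "t \<in> T" for t
    proof -
      obtain v' where v': "B t = cos (2 * pi * v')" "cis (- (pi * u t)) * C t = sin (2 * pi * v')" using ex2[OF t] by blast
      have "cis (2 * pi * v t) = cis (2 * pi * v')"
        using v(2)[OF t] v' by (simp add: W_def complex_eq_iff)
      then have "B t = cos (2 * pi * v t)" "cis (- (pi * u t)) * C t = sin (2 * pi * v t)"
        using v' by (simp_all add: complex_eq_iff)
      moreover from this(2) have "C t = cis (pi * u t) * sin (2 * pi * v t)"
        by (metis cis_mult cis_zero add.right_inverse mult.assoc mult_1)
      ultimately show ?thesis
        using u(2)[OF t] by (simp add: klein_def A_def B_def C_def prod_eq_iff)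
    qed
  qed
qed

lemma deck_deck: "deck m n (deck i j x) = deck (m + i) ((if even m then j else - j) + n) x"
  by (cases "even m"; cases "even i") (auto simp: deck_def)

lemma deck_zero [simp]: "deck 0 0 x = x"
  by (simp add: deck_def)

lemma deck_eqD: "deck m n x = deck m n' x \<Longrightarrow> n = n'"
  by (simp add: deck_def)

text \<open>A relation between endpoints of lifts: explicit lifts of pieces can be joined, reversed
  and moved by deck transformations, and the monodromy depends on the endpoint alone.\<close>

definition klein_path ::
    "('a \<Rightarrow> complex \<times> real \<times> complex) \<Rightarrow> (real \<Rightarrow> 'a) \<Rightarrow> real \<times> real \<Rightarrow> real \<times> real \<Rightarrow> bool" where
  "klein_path \<Phi> p x x' \<longleftrightarrow>
     (\<exists>l. path l \<and> pathstart l = x \<and> pathfinish l = x' \<and> (\<forall>t\<in>{0..1}. klein (l t) = \<Phi> (p t)))"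

lemma klein_path_join:
  assumes "klein_path \<Phi> p x x'" "klein_path \<Phi> q x' x''"
  shows "klein_path \<Phi> (p +++ q) x x''"
proof -
  obtain l where l: "path l" "pathstart l = x" "pathfinish l = x'" "\<And>t. t \<in> {0..1} \<Longrightarrow> klein (l t) = \<Phi> (p t)"
    using assms(1) by (auto simp: klein_path_def)
  obtain k where k: "path k" "pathstart k = x'" "pathfinish k = x''" "\<And>t. t \<in> {0..1} \<Longrightarrow> klein (k t) = \<Phi> (q t)"
    using assms(2) by (auto simp: klein_path_def)
  show ?thesis
    unfolding klein_path_def
    using l k by (intro exI[of _ "l +++ k"] conjI) (simp_all, simp add: joinpaths_def)
qed

lemma klein_path_reverse:
  assumes "klein_path \<Phi> p x x'"
  shows "klein_path \<Phi> (reversepath p) x' x"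
proof -
  obtain l where "path l" "pathstart l = x" "pathfinish l = x'" "\<And>t. t \<in> {0..1} \<Longrightarrow> klein (l t) = \<Phi> (p t)"
    using assms by (auto simp: klein_path_def)
  then show ?thesis
    unfolding klein_path_def by (intro exI[of _ "reversepath l"] conjI) (simp_all, simp add: reversepath_def)
qed

lemma klein_path_deck:
  assumes "klein_path \<Phi> p x x'"
  shows "klein_path \<Phi> p (deck m n x) (deck m n x')"
proof -
  obtain l where "path l" "pathstart l = x" "pathfinish l = x'" "\<And>t. t \<in> {0..1} \<Longrightarrow> klein (l t) = \<Phi> (p t)"
    using assms by (auto simp: klein_path_def)
  then show ?thesis
    unfolding klein_path_def
    by (intro exI[of _ "deck m n \<circ> l"])
      (auto simp: pathstart_compose pathfinish_compose intro!: path_continuous_image continuous_on_deck)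
qed

text \<open>Homotopy lifting: a lift \<open>L\<close> of the homotopy over the unit square is
  compared on its four sides with \<open>l\<close>, with \<open>k\<close> and with two constant
  lifts, by uniqueness of lifts.\<close>

lemma klein_path_homotopic:
  fixes \<Phi> :: "'a::topological_space \<Rightarrow> complex \<times> real \<times> complex"
  assumes hom: "homotopic_paths Y p q" and \<Phi>: "continuous_on Y \<Phi>" "\<Phi> ` Y \<subseteq> range klein"
    and p: "klein_path \<Phi> p x x'" and q: "klein_path \<Phi> q x x''"
  shows "x' = x''"
proof -
  let ?I = "{0..1::real}"
  obtain l where l: "path l" "pathstart l = x" "pathfinish l = x'" "\<And>t. t \<in> {0..1} \<Longrightarrow> klein (l t) = \<Phi> (p t)"
    using p by (auto simp: klein_path_def)
  obtain k where k: "path k" "pathstart k = x" "pathfinish k = x''" "\<And>t. t \<in> {0..1} \<Longrightarrow> klein (k t) = \<Phi> (q t)"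
    using q by (auto simp: klein_path_def)
  obtain h where h: "continuous_on (?I \<times> ?I) h" "h \<in> ?I \<times> ?I \<rightarrow> Y"
    "\<And>t. t \<in> ?I \<Longrightarrow> h (0, t) = p t" "\<And>t. t \<in> ?I \<Longrightarrow> h (1, t) = q t"
    "\<And>s. s \<in> ?I \<Longrightarrow> h (s, 0) = p 0" "\<And>s. s \<in> ?I \<Longrightarrow> h (s, 1) = p 1"
    using hom unfolding homotopic_paths by (auto simp: pathstart_def pathfinish_def)
  have "contractible (?I \<times> ?I)" by (intro convex_imp_contractible convex_Times) auto
  moreover have "continuous_on (?I \<times> ?I) (\<Phi> \<circ> h)"
    using h(1,2) \<Phi>(1) by (intro continuous_on_compose) (auto intro: continuous_on_subset)
  moreover have "(\<Phi> \<circ> h) ` (?I \<times> ?I) \<subseteq> range klein" using h(2) \<Phi>(2) by auto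
  ultimately obtain L0 where L0: "continuous_on (?I \<times> ?I) L0" "\<And>z. z \<in> ?I \<times> ?I \<Longrightarrow> klein (L0 z) = \<Phi> (h z)"
    using klein_lift_exists[of "?I \<times> ?I" "\<Phi> \<circ> h"] by (metis comp_apply)
  \<comment> \<open>A lift over the square may start at any preimage; a deck transformation makes it
    start at \<open>x\<close>.\<close>
  have "klein (L0 (0, 0)) = klein (l 0)" using L0(2)[of "(0, 0)"] l(4)[of 0] h(3)[of 0] by simp
  then obtain m n where mn: "l 0 = deck m n (L0 (0, 0))" using klein_eqD by metis
  define L where "L = deck m n \<circ> L0"
  have L: "continuous_on (?I \<times> ?I) L" "\<And>z. z \<in> ?I \<times> ?I \<Longrightarrow> klein (L z) = \<Phi> (h z)" "L (0, 0) = x"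
    using L0 mn l(2) by (auto simp: L_def pathstart_def intro!: continuous_on_compose2[OF continuous_on_deck])
  have sub: "continuous_on ?I (\<lambda>t. L (f t))" if "continuous_on ?I f" "f ` ?I \<subseteq> ?I \<times> ?I" for f
    using continuous_on_compose2[OF L(1) that] .
  have l': "continuous_on ?I l" and k': "continuous_on ?I k" using l(1) k(1) by (simp_all add: path_def)
  have c: "connected ?I" "0 \<in> ?I" "1 \<in> ?I" by auto
  have left: "L (0, 1) = x'"
  proof -
    have "L (0, 1) = l 1"
    proof (rule klein_lift_unique[OF c, where l = "\<lambda>t. L (0, t)" and l' = l])
      show "continuous_on ?I (\<lambda>t. L (0, t))" by (rule sub) (auto intro!: continuous_intros)
      show "klein (L (0, t)) = klein (l t)" if "t \<in> ?I" for t using that L(2) l(4) h(3) by simp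
      show "L (0, 0) = l 0" using L(3) l(2) by (simp add: pathstart_def)
    qed (rule l')
    then show ?thesis using l(3) by (simp add: pathfinish_def)
  qed
  have bottom: "L (1, 0) = x"
  proof -
    have "L (1, 0) = L (0, 0)"
    proof (rule klein_lift_unique[OF c, where l = "\<lambda>s. L (s, 0)" and l' = "\<lambda>_. L (0, 0)"])
      show "continuous_on ?I (\<lambda>s. L (s, 0))" by (rule sub) (auto intro!: continuous_intros)
      show "klein (L (s, 0)) = klein (L (0, 0))" if "s \<in> ?I" for s using that L(2) h(5) by simp
    qed auto
    then show ?thesis using L(3) by simp
  qed
  have top: "L (1, 1) = L (0, 1)"
  proof -
    have "L (1, 1) = L (0, 1)"
    proof (rule klein_lift_unique[OF c, where l = "\<lambda>s. L (s, 1)" and l' = "\<lambda>_. L (0, 1)"])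
      show "continuous_on ?I (\<lambda>s. L (s, 1))" by (rule sub) (auto intro!: continuous_intros)
      show "klein (L (s, 1)) = klein (L (0, 1))" if "s \<in> ?I" for s using that L(2) h(6) by simp
    qed auto
    then show ?thesis by simp
  qed
  have "L (1, 1) = k 1"
  proof (rule klein_lift_unique[OF c, where l = "\<lambda>t. L (1, t)" and l' = k])
    show "continuous_on ?I (\<lambda>t. L (1, t))" by (rule sub) (auto intro!: continuous_intros)
    show "klein (L (1, t)) = klein (k t)" if "t \<in> ?I" for t using that L(2) k(4) h(4) by simp
    show "L (1, 0) = k 0" using bottom k(2) by (simp add: pathstart_def)
  qed (rule k')
  then show ?thesis using top left k(3) by (simp add: pathfinish_def)
qed

text \<open>Lifting makes the group act on the orbit of \<open>x\<close> under deck transformations: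
  \<open>\<alpha>\<close> raises \<open>m\<close> by one, and \<open>\<beta>\<close> changes
  \<open>n\<close> by one, upwards for even \<open>m\<close> and downwards for odd \<open>m\<close>.
  Two words are different as soon as they move \<open>x\<close> to different points.\<close>

lemma klein_monodromy:
  fixes \<Phi> :: "'a::topological_space \<Rightarrow> complex \<times> real \<times> complex"
  assumes \<Phi>: "continuous_on Y \<Phi>" "\<Phi> ` Y \<subseteq> range klein"
    and a: "loop_at Y y a" "klein_path \<Phi> a x (deck 1 0 x)"
    and b: "loop_at Y y b" "klein_path \<Phi> b x (deck 0 1 x)"
  shows "twisting_pair (fundamental_group Y y) (path_class Y a) (path_class Y b)"
proof -
  define \<Gamma> \<alpha> \<beta> where "\<Gamma> = fundamental_group Y y" and "\<alpha> = path_class Y a" and "\<beta> = path_class Y b"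
  have y: "y \<in> Y" using a(1) by (rule loop_at_base)
  interpret group \<Gamma> unfolding \<Gamma>_def using y by (rule group_fundamental_group)
  define act where "act A z z' \<longleftrightarrow> (\<exists>p. loop_at Y y p \<and> A = path_class Y p \<and> klein_path \<Phi> p z z')" for A z z'
  have act_unique: "z' = z''" if act: "act A z z'" "act A z z''" for A z z' z''
  proof -
    obtain p q where "loop_at Y y p" "A = path_class Y p" "klein_path \<Phi> p z z'"
      "A = path_class Y q" "klein_path \<Phi> q z z''"
      using act unfolding act_def by blast
    then show ?thesis
      using klein_path_homotopic[OF _ \<Phi>] by (metis path_class_eq_iff loop_at_def)
  qed
  have act_mult: "act (A \<otimes>\<^bsub>\<Gamma>\<^esub> B) z z''" if act: "act A z z'" "act B z' z''" for A B z z' z''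
  proof -
    obtain p where p: "loop_at Y y p" "A = path_class Y p" "klein_path \<Phi> p z z'"
      using act(1) unfolding act_def by blast
    obtain q where q: "loop_at Y y q" "B = path_class Y q" "klein_path \<Phi> q z' z''"
      using act(2) unfolding act_def by blast
    show ?thesis
      unfolding act_def
      by (rule exI[of _ "p +++ q"])
        (simp add: p(2) q(2) \<Gamma>_def mult_fundamental_group p(1) q(1) loop_at_join klein_path_join[OF p(3) q(3)])
  qed
  have act_inv: "act (inv\<^bsub>\<Gamma>\<^esub> A) z' z" if act: "act A z z'" for A z z'
  proof -
    obtain p where p: "loop_at Y y p" "A = path_class Y p" "klein_path \<Phi> p z z'"
      using act unfolding act_def by blast
    show ?thesis
      unfolding act_def
      by (rule exI[of _ "reversepath p"])
        (simp add: p(2) \<Gamma>_def inv_fundamental_group p(1) loop_at_reversepath klein_path_reverse[OF p(3)])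
  qed
  have "klein x = \<Phi> y"
    using a unfolding klein_path_def loop_at_def pathstart_def by force
  have act_one: "act \<one>\<^bsub>\<Gamma>\<^esub> x x"
    unfolding act_def \<Gamma>_def one_fundamental_group klein_path_def
    using y \<open>klein x = \<Phi> y\<close>
    by (intro exI[of _ "\<lambda>_. y"] conjI loop_at_const refl exI[of _ "\<lambda>_. x"])
      (auto simp: path_def pathstart_def pathfinish_def)
  have act_deck: "act A (deck m n z) (deck m n z')" if "act A z z'" for A z z' m n
    using that klein_path_deck unfolding act_def by blast
  have "act \<alpha> x (deck 1 0 x)" "act \<beta> x (deck 0 1 x)"
    using a b unfolding act_def \<alpha>_def \<beta>_def by blast+
  then have act_\<alpha>: "act \<alpha> (deck m n x) (deck (m + 1) n x)"
    and act_\<beta>: "act \<beta> (deck m n x) (deck m (n + (if even m then 1 else - 1)) x)" for m n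
    using act_deck[of \<alpha> x "deck 1 0 x" m n] act_deck[of \<beta> x "deck 0 1 x" m n]
    by (simp_all add: deck_deck add.commute split: if_splits)
  have "act (\<alpha> [^]\<^bsub>\<Gamma>\<^esub> k) x (deck (int k) 0 x)" for k :: nat
  proof (induction k)
    case (Suc k)
    then show ?case using act_mult[OF Suc act_\<alpha>[of "int k" 0]] by (simp add: add.commute)
  qed (use act_one in simp)
  then have pow: "\<alpha> [^]\<^bsub>\<Gamma>\<^esub> m \<noteq> \<one>\<^bsub>\<Gamma>\<^esub>" if "m > 0" for m :: nat
    using act_unique[OF act_one] that by (metis add_cancel_right_right deck_def fst_conv of_int_of_nat_eq of_nat_0_eq_iff not_gr_zero)
  have "act (\<beta> [^]\<^bsub>\<Gamma>\<^esub> k) x (deck 0 (int k) x)" for k :: nat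
  proof (induction k)
    case (Suc k)
    then show ?case using act_mult[OF Suc act_\<beta>[of 0 "int k"]] by (simp add: add.commute)
  qed (use act_one in simp)
  from this[of 4] have four: "\<beta> [^]\<^bsub>\<Gamma>\<^esub> (4::nat) \<noteq> \<one>\<^bsub>\<Gamma>\<^esub>"
    using act_unique[OF act_one, of "deck 0 4 x"] deck_eqD[of 0 0 x 4] by auto
  \<comment> \<open>The points reached are, as pairs \<open>(m, n)\<close>, \<open>(1, 0)\<close>,
    \<open>(1, -1)\<close>, \<open>(2, -1)\<close>, \<open>(2, -2)\<close>; for the other order they
    are \<open>(0, 1)\<close>, \<open>(1, 1)\<close>, \<open>(1, 2)\<close>,
    \<open>(2, 2)\<close>.\<close>
  have 1: "act (\<alpha> \<otimes>\<^bsub>\<Gamma>\<^esub> (\<beta> \<otimes>\<^bsub>\<Gamma>\<^esub> \<alpha> \<otimes>\<^bsub>\<Gamma>\<^esub> inv\<^bsub>\<Gamma>\<^esub> \<beta>)) x (deck 2 (-2) x)"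
    using act_\<alpha>[of 0 0] act_\<beta>[of 1 0] act_\<alpha>[of 1 "-1"] act_inv[OF act_\<beta>[of 2 "-2"]]
    by (auto intro!: act_mult)
  have 2: "act ((\<beta> \<otimes>\<^bsub>\<Gamma>\<^esub> \<alpha> \<otimes>\<^bsub>\<Gamma>\<^esub> inv\<^bsub>\<Gamma>\<^esub> \<beta>) \<otimes>\<^bsub>\<Gamma>\<^esub> \<alpha>) x (deck 2 2 x)"
    using act_\<beta>[of 0 0] act_\<alpha>[of 0 1] act_inv[OF act_\<beta>[of 1 2]] act_\<alpha>[of 1 2]
    by (auto intro!: act_mult)
  have "\<alpha> \<otimes>\<^bsub>\<Gamma>\<^esub> (\<beta> \<otimes>\<^bsub>\<Gamma>\<^esub> \<alpha> \<otimes>\<^bsub>\<Gamma>\<^esub> inv\<^bsub>\<Gamma>\<^esub> \<beta>) \<noteq> (\<beta> \<otimes>\<^bsub>\<Gamma>\<^esub> \<alpha> \<otimes>\<^bsub>\<Gamma>\<^esub> inv\<^bsub>\<Gamma>\<^esub> \<beta>) \<otimes>\<^bsub>\<Gamma>\<^esub> \<alpha>"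
    using act_unique[OF 1, of "deck 2 2 x"] 2 deck_eqD[of 2 "-2" x 2] by auto
  moreover have "\<alpha> \<in> carrier \<Gamma>" "\<beta> \<in> carrier \<Gamma>"
    unfolding \<alpha>_def \<beta>_def \<Gamma>_def using a(1) b(1) path_class_in_carrier by blast+
  ultimately show ?thesis
    using pow four by (simp add: twisting_pair_def \<Gamma>_def \<alpha>_def \<beta>_def)
qed

text \<open>In a cyclic group an automorphism has finite order on a generator: the generator has
  finitely many images if it has finite order, and otherwise it is mapped to itself or its inverse.\<close>

lemma cyclic_automorphism_power_fixes_generator:
  assumes "group H" and w: "w \<in> carrier H" "carrier (subgroup_generated H {w}) = carrier H"
    and f: "f \<in> hom H H" "bij_betw f (carrier H) (carrier H)"
  obtains N where "N > 0" "(f ^^ N) w = w"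
proof -
  interpret group H by fact
  interpret f: group_hom H H f by unfold_locales (fact f(1))
  have gen: "carrier H = range (\<lambda>k::int. w [^]\<^bsub>H\<^esub> k)"
    using carrier_subgroup_generated_by_singleton[OF w(1)] w(2) by simp
  have fk: "(f ^^ k) x \<in> carrier H" if "x \<in> carrier H" for k x
    using that by (induction k) auto
  have fpow: "f (w [^]\<^bsub>H\<^esub> k) = f w [^]\<^bsub>H\<^esub> k" for k :: int
    using f.hom_int_pow w(1) by simp
  obtain k :: int where k: "f w = w [^]\<^bsub>H\<^esub> k" using f.hom_closed[OF w(1)] gen by auto
  show ?thesis
  proof (cases "finite (carrier H)")
    case True
    then have "\<not> inj (\<lambda>k. (f ^^ k) w)"
      using fk[OF w(1)] by (meson finite_subset finite_imageD image_subset_iff infinite_UNIV_nat)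
    then obtain i j where ij: "i < j" "(f ^^ i) w = (f ^^ j) w"
      unfolding inj_on_def by (metis nat_neq_iff)
    have inj: "inj_on (f ^^ i) (carrier H)" for i
    proof (induction i)
      case (Suc i)
      show ?case
        unfolding funpow.simps using f(2) Suc fk
        by (intro comp_inj_on) (auto simp: bij_betw_def intro: inj_on_subset)
    qed simp
    have "(f ^^ j) w = (f ^^ i) ((f ^^ (j - i)) w)"
      using ij(1) funpow_add[of i "j - i" f] by simp
    then have "(f ^^ (j - i)) w = w"
      using inj_onD[OF inj, of i "(f ^^ (j - i)) w" w] fk w(1) ij(2) by simp
    then show ?thesis using that[of "j - i"] ij(1) by simp
  next
    case False
    have "w \<in> f ` carrier H" using f(2) w(1) by (simp add: bij_betw_def)
    then obtain x where x: "x \<in> carrier H" "f x = w" by auto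
    then obtain l :: int where "x = w [^]\<^bsub>H\<^esub> l" using gen by auto
    with x(2) have l: "f (w [^]\<^bsub>H\<^esub> l) = w" by simp
    have "w [^]\<^bsub>H\<^esub> (k * l) = w"
      using l fpow[of l] w(1) by (simp add: k int_pow_pow)
    have inj: "inj (\<lambda>k::int. w [^]\<^bsub>H\<^esub> k)"
      using False infinite_cyclic_subgroup_int[OF w(1)] w(2) by (auto simp: inj_def)
    have "w [^]\<^bsub>H\<^esub> (k * l) = w [^]\<^bsub>H\<^esub> (1::int)"
      using \<open>w [^]\<^bsub>H\<^esub> (k * l) = w\<close> w(1) by (simp add: int_pow_1)
    then have "k * l = 1" using inj by (simp add: inj_eq)
    then have "k * k = 1" by (metis zmult_eq_1_iff mult_1 mult_minus1 minus_minus)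
    then have "f (f w) = w" using fpow[of k] w(1) by (simp add: k int_pow_pow int_pow_1)
    then show ?thesis using that[of 2] by (simp add: numeral_2_eq_2)
  qed
qed

text \<open>Supplies the condition on \<open>\<omega>\<close> in \<open>pure_homeos\<close> without
  computing the degree of the twist: by functoriality only the induced automorphism of a cyclic
  group matters.\<close>

lemma homeomorphism_power_preserves_orientation:
  assumes "orientation_class S \<omega>" and h: "homeomorphic_map (top_of_set S) (top_of_set S) h"
  obtains N where "N > 0" "\<And>k. hom_induced 2 (top_of_set S) {} (top_of_set S) {} (h ^^ (N * k)) \<omega> = \<omega>"
proof -
  let ?X = "top_of_set S"
  let ?H = "homology_group 2 ?X"
  let ?f = "\<lambda>h. hom_induced 2 ?X {} ?X {} h"
  have \<omega>: "\<omega> \<in> carrier ?H" "carrier (subgroup_generated ?H {\<omega>}) = carrier ?H"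
    using assms(1) by (auto simp: orientation_class_def)
  have hom: "?f h \<in> hom ?H ?H" by (rule hom_induced_empty_hom)
  have cont: "continuous_map ?X ?X h" using h homeomorphic_imp_continuous_map by blast
  have iso: "?f h \<in> iso ?H ?H"
    using h by (rule homeomorphic_map_homology_iso)
  then have bij: "bij_betw (?f h) (carrier ?H) (carrier ?H)" by (simp add: iso_def)
  obtain N where N: "N > 0" "(?f h ^^ N) \<omega> = \<omega>"
    using cyclic_automorphism_power_fixes_generator[OF _ \<omega> hom bij] by auto
  have contk: "continuous_map ?X ?X (h ^^ k)" for k
    
  proof (induction k)
    case (Suc k)
    then show ?case unfolding funpow.simps by (rule continuous_map_compose[OF _ cont])
  qed simp
  have fk: "?f (h ^^ k) \<omega> = (?f h ^^ k) \<omega>" for k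
  proof (induction k)
    case 0
    show ?case using hom_induced_id[OF \<omega>(1)] by (simp add: id_def)
  next
    case (Suc k)
    then show ?case
      using hom_induced_compose_empty[OF contk cont, of 2] by (simp add: o_def)
  qed
  have "(?f h ^^ (N * k)) \<omega> = \<omega>" for k
    using N(2) by (induction k) (simp_all add: funpow_add)
  then show ?thesis using that[OF N(1)] fk by simp
qed

section \<open>The polygon model\<close>

text \<open>Cosine decreases on \<open>[0, pi]\<close> and is symmetric about \<open>pi\<close>.
  This bounds the projections of the edges far from an axis.\<close>

lemma cos_le_cos_outer:
  assumes "0 \<le> c" "c \<le> a" "a \<le> 2 * pi - c"
  shows "cos a \<le> cos c"
proof (cases "a \<le> pi")
  case True
  then show ?thesis using assms by (intro cos_monotone_0_pi_le) auto
next
  case False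
  have "cos a = cos (2 * pi - a)" by (simp add: cos_diff)
  also have "\<dots> \<le> cos c" using False assms by (intro cos_monotone_0_pi_le) auto
  finally show ?thesis .
qed

text \<open>The quotient map is a parameter because loops and maps are built on the disc and pushed
  down along it, and because on the torus it is later replaced by another one.\<close>

locale polygon_model =
  fixes g :: nat and S :: "'a::topological_space set" and q :: "complex \<Rightarrow> 'a"
  assumes g_pos: "g \<ge> 1"
    and quot: "quotient_map (top_of_set (cball (0::complex) 1)) (top_of_set S) q"
    and fibres: "\<And>z w. z \<in> cball 0 1 \<Longrightarrow> w \<in> cball 0 1 \<Longrightarrow> q z = q w \<longleftrightarrow> equivclp (polygon_glue g) z w"
begin

abbreviation D :: "complex set" where "D \<equiv> cball 0 1"

text \<open>Half the angle of an edge: edge \<open>k\<close> covers the angles from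
  \<open>2 k half\<close> to \<open>2 (k + 1) half\<close>.\<close>

definition half :: real where "half = pi / (4 * real g)"

lemma half: "0 < half" "half \<le> pi / 4" "8 * real g * half = 2 * pi"
proof -
  have g: "real g \<ge> 1" using g_pos by simp
  then show "0 < half" "8 * real g * half = 2 * pi" by (auto simp: half_def)
  have "pi * 1 \<le> pi * real g" using g by (intro mult_left_mono) auto
  then show "half \<le> pi / 4" using g by (simp add: half_def divide_simps)
qed

lemma polygon_edge_half: "polygon_edge g k t = cis (2 * half * (real k + t))"
  by (simp add: polygon_edge_def half_def)

lemma glue_D: "polygon_glue g z w \<Longrightarrow> z \<in> D \<and> w \<in> D"
  by (auto simp: polygon_glue_def polygon_edge_def)

lemma glue_q: "polygon_glue g z w \<Longrightarrow> q z = q w"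
  using glue_D fibres by (metis r_into_equivclp)

lemma q_continuous: "continuous_on D q"
  using quotient_imp_continuous_map[OF quot] by simp

lemma q_image: "q ` D = S"
  using quotient_imp_surjective_map[OF quot] by simp

lemma q_in_S: "z \<in> D \<Longrightarrow> q z \<in> S"
  using q_image by blast

text \<open>\<open>f\<close> may be meaningful over \<open>A\<close> only. A chain of gluings stays
  inside one fibre, so it never leaves the part over \<open>A\<close>.\<close>

lemma respects:
  assumes resp: "\<And>u v. polygon_glue g u v \<Longrightarrow> q u \<in> A \<Longrightarrow> f u = f v"
    and z: "z \<in> D" "w \<in> D" "q z = q w" "q z \<in> A"
  shows "f z = f w"
proof -
  have "equivclp (polygon_glue g) z w" using fibres z by blast
  then have "f z = f w \<and> q z = q w"
  proof (induction rule: equivclp_induct)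
    case (step y x)
    then have "q y = q x" using glue_q by metis
    then show ?case using step z(4) resp[of y x] resp[of x y] by auto
  qed simp
  then show ?thesis ..
qed

text \<open>The power wraps each edge once around the circle and forgets which edge it was. Since
  gluing reverses the parameter, it conjugates the power.\<close>

lemma polygon_edge_power: "polygon_edge g k t ^ (4 * g) = cis (2 * pi * t)"
proof -
  have "polygon_edge g k t ^ (4 * g) = cis (2 * pi * real k + 2 * pi * t)"
  proof -
    have "real (4 * g) * (2 * pi * (real k + t) / (4 * real g)) = 2 * pi * real k + 2 * pi * t"
      using g_pos by (simp add: field_simps)
    then show ?thesis unfolding polygon_edge_def Complex.DeMoivre by (rule arg_cong)
  qed
  also have "\<dots> = cis (2 * pi * real k) * cis (2 * pi * t)" by (simp only: cis_mult)
  also have "cis (2 * pi * real k) = 1"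
    using cis_multiple_2pi[of "real k"] by simp
  finally show ?thesis by simp
qed

lemma glue_power:
  assumes "polygon_glue g z w"
  shows "w ^ (4 * g) = cnj (z ^ (4 * g))"
proof -
  obtain t k l where "z = polygon_edge g k t" "w = polygon_edge g l (1 - t)"
    using assms by (auto simp: polygon_glue_def)
  moreover have "cis (2 * pi * (1 - t)) = cis (2 * pi) * cis (- (2 * pi * t))"
    by (simp only: cis_mult) (simp add: right_diff_distrib)
  ultimately show ?thesis by (simp only: polygon_edge_power cis_cnj) simp
qed

text \<open>The unordered pair of \<open>z ^ (4 * g)\<close> and its conjugate is constant along
  gluings, so a fibre consists of roots of at most two numbers.\<close>

lemma finite_fibre: "finite {w \<in> D. q w = p}"
proof (cases "\<exists>z\<in>D. q z = p")
  case True
  then obtain z where z: "z \<in> D" "q z = p" by blast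
  have "w ^ (4 * g) = z ^ (4 * g) \<or> w ^ (4 * g) = cnj (z ^ (4 * g))" if w: "w \<in> D" "q w = p" for w
  proof -
    have "{z ^ (4 * g), cnj (z ^ (4 * g))} = {w ^ (4 * g), cnj (w ^ (4 * g))}"
      by (rule respects[where A = UNIV and f = "\<lambda>z. {z ^ (4 * g), cnj (z ^ (4 * g))}"])
        (use z w in \<open>auto simp del: complex_cnj_power dest!: glue_power\<close>)
    then show ?thesis by blast
  qed
  then have "{w \<in> D. q w = p} \<subseteq> {w. w ^ (4 * g) = z ^ (4 * g)} \<union> {w. w ^ (4 * g) = cnj (z ^ (4 * g))}"
    by blast
  then show ?thesis
    using finite_nth_roots[of "4 * g"] g_pos by (elim finite_subset) auto
next
  case False
  then have empty: "{w \<in> D. q w = p} = {}" by blast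
  show ?thesis unfolding empty by simp
qed

lemma finite_preimage:
  assumes "finite P"
  shows "finite {z \<in> D. q z \<in> P}"
proof -
  have "{z \<in> D. q z \<in> P} = (\<Union>p\<in>P. {z \<in> D. q z = p})" by blast
  then show ?thesis using assms finite_fibre by simp
qed

text \<open>Over an open set a quotient map restricts to a quotient map. That \<open>S - P\<close>
  is open is seen in the disc, where its complement has a finite preimage; the ambient type provides
  no separation axiom.\<close>

lemma descend:
  fixes f :: "complex \<Rightarrow> 'b::topological_space"
  assumes P: "finite P" "P \<subseteq> S" and f: "continuous_on {z \<in> D. q z \<notin> P} f"
    and resp: "\<And>z w. polygon_glue g z w \<Longrightarrow> q z \<notin> P \<Longrightarrow> f z = f w"
  obtains h where "continuous_on (S - P) h" "\<And>z. z \<in> D \<Longrightarrow> q z \<notin> P \<Longrightarrow> h (q z) = f z"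
proof -
  have "closed {z \<in> D. q z \<in> P}" using finite_preimage[OF P(1)] by (rule finite_imp_closed)
  then have "openin (top_of_set D) (D - {z \<in> D. q z \<in> P})" by (intro openin_diff closed_subset) auto
  also have "D - {z \<in> D. q z \<in> P} = {z \<in> topspace (top_of_set D). q z \<in> S - P}" using q_in_S by auto
  finally have "openin (top_of_set D) {z \<in> topspace (top_of_set D). q z \<in> S - P}" .
  moreover have "\<forall>U. U \<subseteq> topspace (top_of_set S) \<longrightarrow>
      openin (top_of_set D) {z \<in> topspace (top_of_set D). q z \<in> U} = openin (top_of_set S) U"
    using quot unfolding quotient_map_def by (rule conjunct2)
  ultimately have open_P: "openin (top_of_set S) (S - P)" by (auto dest!: spec[of _ "S - P"])
  have U: "{z \<in> topspace (top_of_set D). q z \<in> S - P} = {z \<in> D. q z \<notin> P}" using q_in_S by auto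
  have "quotient_map (subtopology (top_of_set D) {z \<in> D. q z \<notin> P}) (subtopology (top_of_set S) (S - P)) q"
    by (rule quotient_map_restriction[OF quot U]) (use open_P in simp)
  then have "quotient_map (top_of_set {z \<in> D. q z \<notin> P}) (top_of_set (S - P)) q"
  proof -
    have "D \<inter> {z \<in> D. q z \<notin> P} = {z \<in> D. q z \<notin> P}" "S \<inter> (S - P) = S - P" by auto
    then show ?thesis
      using \<open>quotient_map (subtopology _ _) _ q\<close> by (simp only: subtopology_subtopology)
  qed
  moreover have "continuous_map (top_of_set {z \<in> D. q z \<notin> P}) euclidean f" using f by simp
  moreover have "f z = f w"
    if "z \<in> topspace (top_of_set {z \<in> D. q z \<notin> P})" "w \<in> topspace (top_of_set {z \<in> D. q z \<notin> P})" "q z = q w" for z w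
    by (rule respects[where A = "- P" and f = f]) (use that resp in auto)
  ultimately show ?thesis
    by (rule quotient_map_lift_exists) (use that in auto)
qed

lemma path_connected_punctured:
  assumes "finite P"
  shows "path_connected (S - P)"
proof -
  let ?Q = "{z \<in> D. q z \<in> P}"
  have "\<not> collinear D"
  proof
    assume "collinear D"
    then have "collinear {0, 1, \<i>}" by (rule collinear_subset) auto
    then show False by (simp add: collinear_iff_Reals complex_is_Real_iff)
  qed
  have "path_connected (D - ?Q)"
    by (rule path_connected_convex_diff_countable) (use \<open>\<not> collinear D\<close> finite_preimage[OF assms] in \<open>auto simp: countable_finite\<close>)
  moreover have "q ` (D - ?Q) = S - P" using q_image by auto
  ultimately show ?thesis
    using path_connected_continuous_image[of "D - ?Q" q] q_continuous continuous_on_subset[of D q "D - ?Q"] by auto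
qed

end

section \<open>Dehn twists\<close>

context polygon_model
begin

text \<open>The midpoint of edge \<open>e + 1\<close>. For \<open>e < 2\<close> it spans the axis of
  the reflection that exchanges the glued edges \<open>e\<close> and \<open>e + 2\<close>, which lie
  at angles between \<open>half\<close> and \<open>3 * half\<close> from it.\<close>

definition unit :: "nat \<Rightarrow> complex" where "unit e = cis (half * (3 + 2 * real e))"

abbreviation strip :: "real set" where "strip \<equiv> {cos (3 * half)<..<cos half}"

text \<open>Half the length of the chord of the unit circle at distance \<open>\<bar>s\<bar>\<close>
  from the centre.\<close>

definition lat :: "real \<Rightarrow> real" where "lat s = sqrt (1 - s\<^sup>2)"

text \<open>Rotated coordinates of the disc: \<open>ht\<close> is constant on the chords joining glued points of the
  edges 1 and 3, and \<open>\<tau> \<in> {0..1}\<close> is the position on such a chord.\<close>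

definition pt :: "real \<Rightarrow> real \<Rightarrow> complex" where
  "pt s \<tau> = unit 1 * (complex_of_real s + \<i> * complex_of_real (lat s * (2 * \<tau> - 1)))"

definition ht :: "complex \<Rightarrow> real" where "ht z = Re (z * cnj (unit 1))"

definition tau :: "complex \<Rightarrow> real" where "tau z = (Im (z * cnj (unit 1)) / lat (ht z) + 1) / 2"

lemma unit_cnj [simp]: "unit e * cnj (unit e) = 1" "cnj (unit e) * unit e = 1" "cmod (unit e) = 1"
  by (simp_all add: unit_def cis_cnj cis_mult)

text \<open>\<open>3 / 2 - \<phi> / (2 * half)\<close> is the parameter on edge \<open>e\<close> of
  the point at angle \<open>\<phi>\<close> before the axis.\<close>

lemma unit_edge:
  "unit e * cis (- \<phi>) = polygon_edge g e (3 / 2 - \<phi> / (2 * half))"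
  "unit e * cis \<phi> = polygon_edge g (e + 2) (1 - (3 / 2 - \<phi> / (2 * half)))"
proof -
  have "2 * half * (real e + (3 / 2 - \<phi> / (2 * half))) = half * (3 + 2 * real e) + - \<phi>"
    "2 * half * (real (e + 2) + (1 - (3 / 2 - \<phi> / (2 * half)))) = half * (3 + 2 * real e) + \<phi>"
    using half(1) by (simp_all add: field_simps)
  then show "unit e * cis (- \<phi>) = polygon_edge g e (3 / 2 - \<phi> / (2 * half))"
    "unit e * cis \<phi> = polygon_edge g (e + 2) (1 - (3 / 2 - \<phi> / (2 * half)))"
    unfolding polygon_edge_half unit_def cis_mult by simp_all
qed

lemma edge_pair:
  assumes "e < 2" "half \<le> \<phi>" "\<phi> \<le> 3 * half"
  shows "polygon_glue g (unit e * cis (- \<phi>)) (unit e * cis \<phi>)"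
proof -
  define t where "t = 3 / 2 - \<phi> / (2 * half)"
  have t: "t \<in> {0..1}" using assms half(1) by (auto simp: t_def divide_simps)
  have "e = 0 \<or> e = 1" using assms(1) by auto
  then show ?thesis
    unfolding polygon_glue_def unit_edge(1)[of e \<phi>] unit_edge(2)[of e \<phi>] t_def[symmetric] using g_pos t
    by (intro exI[of _ 0] conjI bexI[of _ t]) (auto simp: numeral_3_eq_3)
qed

lemma ht_cis: "ht (cis a) = cos (a - 5 * half)"
  by (simp add: ht_def unit_def cis_cnj cis_mult mult.commute)

lemma pt_rotated: "pt s \<tau> * cnj (unit 1) = complex_of_real s + \<i> * complex_of_real (lat s * (2 * \<tau> - 1))"
proof -
  have "pt s \<tau> * cnj (unit 1) =
      (complex_of_real s + \<i> * complex_of_real (lat s * (2 * \<tau> - 1))) * (unit 1 * cnj (unit 1))"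
    by (simp only: pt_def mult_ac)
  then show ?thesis by (simp only: unit_cnj mult_1_right)
qed

lemma ht_pt [simp]: "ht (pt s \<tau>) = s"
  unfolding ht_def pt_rotated by simp

lemma strip_bounds: "s \<in> strip \<Longrightarrow> \<bar>s\<bar> < 1"
  using cos_ge_minus_one[of "3 * half"] cos_le_one[of half]
  by (simp only: greaterThanLessThan_iff abs_less_iff) linarith

lemma lat_pos: "\<bar>s\<bar> < 1 \<Longrightarrow> lat s > 0"
  by (simp add: lat_def abs_square_less_1)

lemma tau_pt: "\<bar>s\<bar> < 1 \<Longrightarrow> tau (pt s \<tau>) = \<tau>"
proof -
  assume "\<bar>s\<bar> < 1"
  then have "lat s \<noteq> 0" using lat_pos by force
  then show ?thesis unfolding tau_def pt_rotated by simp
qed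

lemma pt_in_D: "\<bar>s\<bar> < 1 \<Longrightarrow> \<tau> \<in> {0..1} \<Longrightarrow> pt s \<tau> \<in> D"
proof -
  assume s: "\<bar>s\<bar> < 1" and \<tau>: "\<tau> \<in> {0..1}"
  have "(lat s * (2 * \<tau> - 1))\<^sup>2 = (1 - s\<^sup>2) * (2 * \<tau> - 1)\<^sup>2"
    using s by (simp add: lat_def power_mult_distrib abs_square_less_1 less_imp_le)
  also have "\<dots> \<le> (1 - s\<^sup>2) * 1"
    using s \<tau> by (intro mult_left_mono) (auto simp: abs_square_less_1 less_imp_le abs_square_le_1)
  finally have "s\<^sup>2 + (lat s * (2 * \<tau> - 1))\<^sup>2 \<le> 1" by simp
  then have "cmod (complex_of_real s + \<i> * complex_of_real (lat s * (2 * \<tau> - 1))) \<le> 1"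
    by (simp add: cmod_def)
  then show ?thesis by (simp add: pt_def norm_mult)
qed

lemma pt_tau:
  assumes "z \<in> D" "\<bar>ht z\<bar> < 1"
  shows "pt (ht z) (tau z) = z" "tau z \<in> {0..1}"
proof -
  define w where "w = z * cnj (unit 1)"
  have w: "cmod w \<le> 1" "Re w = ht z" using assms by (simp_all add: w_def norm_mult ht_def)
  have l: "lat (ht z) > 0" using assms lat_pos by blast
  have tau: "tau z = (Im w / lat (ht z) + 1) / 2" by (simp only: tau_def w_def)
  have t: "lat (ht z) * (2 * tau z - 1) = Im w" using l by (simp add: tau field_simps)
  have "pt (ht z) (tau z) = unit 1 * w"
    unfolding pt_def t using w(2) by (simp add: complex_eq_iff)
  also have "\<dots> = z" by (simp add: w_def mult.left_commute[of "unit 1"])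
  finally show "pt (ht z) (tau z) = z" .
  have "(cmod w)\<^sup>2 \<le> 1" using w(1) by (simp add: power_le_one)
  then have "(Im w)\<^sup>2 \<le> 1 - (ht z)\<^sup>2" using w(2) by (simp add: cmod_power2)
  then have "\<bar>Im w\<bar> \<le> lat (ht z)" unfolding lat_def by (metis real_sqrt_abs real_sqrt_le_mono)
  then have "\<bar>Im w / lat (ht z)\<bar> \<le> 1" using l by (simp add: abs_divide)
  then have "- 1 \<le> Im w / lat (ht z)" "Im w / lat (ht z) \<le> 1" by linarith+
  then show "tau z \<in> {0..1}" by (simp add: tau)
qed

lemma strip_angle:
  assumes "s \<in> strip"
  obtains \<phi> where "half < \<phi>" "\<phi> < 3 * half" "s = cos \<phi>" "lat s = sin \<phi>"
proof
  have s: "-1 \<le> s" "s \<le> 1" using strip_bounds[OF assms] by auto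
  have 3: "0 \<le> half" "3 * half \<le> pi" using half by auto
  show "s = cos (arccos s)" using s by simp
  show "half < arccos s"
    using arccos_less_arccos[of s "cos half"] assms s 3 arccos_cos[of half] by simp
  show "arccos s < 3 * half"
    using arccos_less_arccos[of "cos (3 * half)" s] assms s 3 arccos_cos[of "3 * half"] by simp
  show "lat s = sin (arccos s)" using s by (simp add: lat_def sin_arccos)
qed

lemma pt_cis: "pt (cos \<phi>) 1 = unit 1 * cis \<phi>" "pt (cos \<phi>) 0 = unit 1 * cis (- \<phi>)" if "lat (cos \<phi>) = sin \<phi>"
  unfolding pt_def that by (simp_all add: cis_conv_exp complex_eq_iff exp_eq_polar flip: cis_conv_exp)

lemma q_pt_wrap: "s \<in> strip \<Longrightarrow> q (pt s 0) = q (pt s 1)"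
proof -
  assume "s \<in> strip"
  then obtain \<phi> where \<phi>: "half < \<phi>" "\<phi> < 3 * half" "s = cos \<phi>" "lat s = sin \<phi>" by (rule strip_angle)
  then show ?thesis using glue_q[OF edge_pair[of 1 \<phi>]] pt_cis[of \<phi>] by simp
qed

text \<open>The axis is at angle \<open>5 * half\<close>. Edge 2 stays within \<open>half\<close> of
  it, while edge 0 and the edges from 4 on are at least \<open>3 * half\<close> away, so a boundary
  point with height in the open strip lies on edge 1 or 3.\<close>

lemma ht_outside:
  assumes "t \<in> {0..1}" "k = 0 \<or> k = 2 \<or> (4 \<le> k \<and> k < 4 * g)"
  shows "ht (polygon_edge g k t) \<notin> strip"
proof -
  define a where "a = 2 * half * (real k + t) - 5 * half"
  have ht: "ht (polygon_edge g k t) = cos a" by (simp add: polygon_edge_half ht_cis a_def)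
  have h: "0 < half" "half \<le> pi / 4" by (rule half)+
  consider "k = 0" | "k = 2" | "4 \<le> k" "k < 4 * g" using assms(2) by blast
  then show ?thesis
  proof cases
    case 1
    have "0 \<le> half * t" "half * t \<le> half * 1" using assms(1) h by (auto intro!: mult_left_mono)
    then have "cos (- a) \<le> cos (3 * half)"
      using h 1 by (intro cos_le_cos_outer) (auto simp: a_def)
    then show ?thesis using ht by simp
  next
    case 2
    have "0 \<le> half * t" "half * t \<le> half * 1" using assms(1) h by (auto intro!: mult_left_mono)
    then have "\<bar>a\<bar> \<le> half" using 2 by (auto simp: a_def algebra_simps abs_le_iff)
    then have "cos half \<le> cos \<bar>a\<bar>" using h by (intro cos_monotone_0_pi_le) auto
    then show ?thesis using ht by simp
  next
    case 3
    have "half * 4 \<le> half * (real k + t)" using 3 assms(1) h by (intro mult_left_mono) auto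
    moreover have "half * (real k + t) \<le> half * (4 * real g)"
    proof (intro mult_left_mono)
      have "real (k + 1) \<le> real (4 * g)" using 3 by (subst of_nat_le_iff) simp
      then show "real k + t \<le> 4 * real g" using assms(1) by simp
    qed (use h in simp)
    then have "4 * half \<le> half * (real k + t)" "half * (real k + t) \<le> pi"
    proof -
      have "half * (4 * real g) = pi" using half(3) by (simp add: algebra_simps)
      then show "4 * half \<le> half * (real k + t)" "half * (real k + t) \<le> pi"
        using \<open>half * 4 \<le> _\<close> \<open>half * (real k + t) \<le> half * (4 * real g)\<close> by linarith+
    qed
    then have "cos a \<le> cos (3 * half)"
      using h half(3) by (intro cos_le_cos_outer) (auto simp: a_def mult.assoc)
    then show ?thesis using ht by simp
  qed
qed

text \<open>Over the strip nothing is glued but the two ends of each chord: the chords close up to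
  circles and sweep out an annulus in \<open>S\<close>.\<close>

lemma glue_strip:
  assumes "polygon_glue g z w" "ht z \<in> strip \<or> ht w \<in> strip"
  obtains s where "s \<in> strip" "z = pt s 0" "w = pt s 1"
proof -
  obtain j t where j: "j < g" "t \<in> {0..1}"
    and zw: "z = polygon_edge g (4 * j) t \<and> w = polygon_edge g (4 * j + 2) (1 - t) \<or>
     z = polygon_edge g (4 * j + 1) t \<and> w = polygon_edge g (4 * j + 3) (1 - t)"
    using assms(1) unfolding polygon_glue_def by blast
  have t': "1 - t \<in> {0..1}" using j by auto
  have "j = 0" "z = polygon_edge g 1 t" "w = polygon_edge g 3 (1 - t)"
  proof -
    have "\<not> (z = polygon_edge g (4 * j) t \<and> w = polygon_edge g (4 * j + 2) (1 - t))"
      using assms(2) j t' ht_outside[of t "4 * j"] ht_outside[of "1 - t" "4 * j + 2"]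
      by (cases "j = 0") auto
    with zw have *: "z = polygon_edge g (4 * j + 1) t" "w = polygon_edge g (4 * j + 3) (1 - t)" by auto
    then show "j = 0"
      using assms(2) j t' ht_outside[of t "4 * j + 1"] ht_outside[of "1 - t" "4 * j + 3"]
      by (cases "j = 0") auto
    with * show "z = polygon_edge g 1 t" "w = polygon_edge g 3 (1 - t)" by simp_all
  qed
  \<comment> \<open>The angle between the axis and the point with parameter \<open>t\<close> on edge
    1.\<close>
  define \<phi> where "\<phi> = 3 * half - 2 * half * t"
  have "0 \<le> half * t" "half * t \<le> half * 1" using j half by (auto intro!: mult_left_mono)
  then have "0 \<le> \<phi>" "\<phi> \<le> pi" using half by (auto simp: \<phi>_def)
  then have l: "lat (cos \<phi>) = sin \<phi>" using sin_ge_zero by (simp add: lat_def sin_squared_eq[symmetric])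
  have "2 * half * (real 1 + t) = half * (3 + 2 * real 1) + - \<phi>"
    "2 * half * (real 3 + (1 - t)) = half * (3 + 2 * real 1) + \<phi>"
    by (simp_all add: \<phi>_def algebra_simps)
  then have "z = unit 1 * cis (- \<phi>)" "w = unit 1 * cis \<phi>"
    unfolding \<open>z = _\<close> \<open>w = _\<close> polygon_edge_half unit_def cis_mult by simp_all
  then have "z = pt (cos \<phi>) 0" "w = pt (cos \<phi>) 1" using pt_cis[OF l] by simp_all
  then show ?thesis using that[of "cos \<phi>"] assms(2) by auto
qed

section \<open>Shears of the annulus of chords\<close>

text \<open>The closed-up chord at height \<open>s\<close>, run through twice as
  \<open>\<tau>\<close> goes from 0 to 2. This range contains \<open>\<tau> + \<theta>\<close> for
  every position and every shift in \<open>[0, 1]\<close>.\<close>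

definition E2 :: "real \<Rightarrow> real \<Rightarrow> 'a" where
  "E2 s \<tau> = q (pt s (if \<tau> \<le> 1 then \<tau> else \<tau> - 1))"

lemma E2_first: "\<tau> \<in> {0..1} \<Longrightarrow> E2 s \<tau> = q (pt s \<tau>)"
  by (simp add: E2_def)

lemma E2_second: "s \<in> strip \<Longrightarrow> \<tau> \<in> {0..1} \<Longrightarrow> E2 s (\<tau> + 1) = q (pt s \<tau>)"
  using q_pt_wrap by (cases "\<tau> = 0") (auto simp: E2_def)

lemma continuous_on_pt: "A \<subseteq> {-1..1} \<times> UNIV \<Longrightarrow> continuous_on A (\<lambda>p. pt (fst p) (snd p))"
  unfolding pt_def lat_def by (intro continuous_intros)

lemma continuous_on_E2:
  assumes "J \<subseteq> strip"
  shows "continuous_on (J \<times> {0..2}) (\<lambda>p. E2 (fst p) (snd p))"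
proof -
  have J: "\<bar>s\<bar> < 1" if "s \<in> J" for s using that assms strip_bounds by blast
  have "continuous_on (J \<times> {0..2}) (\<lambda>p. if snd p \<le> 1 then q (pt (fst p) (snd p)) else q (pt (fst p) (snd p - 1)))"
  proof (rule continuous_on_cases_le)
    show "continuous_on {p \<in> J \<times> {0..2}. snd p \<le> 1} (\<lambda>p. q (pt (fst p) (snd p)))"
    proof (rule continuous_on_compose2[OF q_continuous continuous_on_pt])
      show "(\<lambda>p. pt (fst p) (snd p)) ` {p \<in> J \<times> {0..2}. snd p \<le> 1} \<subseteq> D"
        using pt_in_D J by fastforce
      show "{p \<in> J \<times> {0..2}. snd p \<le> 1} \<subseteq> {-1..1} \<times> UNIV" using J by force
    qed
    show "continuous_on {p \<in> J \<times> {0..2}. 1 \<le> snd p} (\<lambda>p. q (pt (fst p) (snd p - 1)))"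
    proof (rule continuous_on_compose2[OF q_continuous])
      show "(\<lambda>p. pt (fst p) (snd p - 1)) ` {p \<in> J \<times> {0..2}. 1 \<le> snd p} \<subseteq> D"
        using pt_in_D J by fastforce
      show "continuous_on {p \<in> J \<times> {0..2}. 1 \<le> snd p} (\<lambda>p. pt (fst p) (snd p - 1))"
        unfolding pt_def lat_def by (intro continuous_intros)
    qed
    show "q (pt (fst p) (snd p)) = q (pt (fst p) (snd p - 1))" if "p \<in> J \<times> {0..2}" "snd p = 1" for p
      using that assms q_pt_wrap[of "fst p"] by auto
  qed (intro continuous_intros)
  then show ?thesis by (simp add: E2_def if_distrib cong: if_cong)
qed

lemma continuous_on_ht: "continuous_on A ht"
  unfolding ht_def by (intro continuous_intros)

lemma continuous_on_tau:
  assumes "\<And>z. z \<in> A \<Longrightarrow> \<bar>ht z\<bar> < 1"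
  shows "continuous_on A tau"
proof -
  have "lat (ht z) \<noteq> 0" if "z \<in> A" for z using assms[OF that] lat_pos by force
  then show ?thesis
    unfolding tau_def lat_def by (intro continuous_intros continuous_on_ht) auto
qed

text \<open>A shift by 0 or by 1 is the identity on a circle, so the shear matches the identity at
  both ends of the interval. The profile \<open>\<theta>\<close> is left open in order to cover the
  twist as well as its inverse.\<close>

lemma shear_exists:
  assumes s: "s0 < s1" "{s0..s1} \<subseteq> strip"
    and \<theta>: "continuous_on {s0..s1} \<theta>" "\<And>s. s \<in> {s0..s1} \<Longrightarrow> \<theta> s \<in> {0..1}" "\<theta> s0 \<in> {0, 1}" "\<theta> s1 \<in> {0, 1}"
  obtains h where "continuous_on S h" "h \<in> S \<rightarrow> S"
    "\<And>z. z \<in> D \<Longrightarrow> ht z \<notin> {s0..s1} \<Longrightarrow> h (q z) = q z"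
    "\<And>s \<tau>. s \<in> {s0..s1} \<Longrightarrow> \<tau> \<in> {0..1} \<Longrightarrow> h (q (pt s \<tau>)) = E2 s (\<tau> + \<theta> s)"
proof -
  define E where "E z = E2 (ht z) (tau z + \<theta> (ht z))" for z
  define H where "H z = (if ht z \<le> s0 then q z else if ht z \<le> s1 then E z else q z)" for z
  have b: "\<bar>s\<bar> < 1" if "s \<in> {s0..s1}" for s using that s strip_bounds by blast
  have int: "E z = q z" if "z \<in> D" "ht z \<in> {s0..s1}" "\<theta> (ht z) \<in> {0, 1}" for z
    using that s b[of "ht z"] pt_tau[of z] E2_first[of "tau z" "ht z"] E2_second[of "ht z" "tau z"]
    by (auto simp: E_def)
  have H_strip: "H z = E z" if "z \<in> D" "ht z \<in> {s0..s1}" for z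
    using int[of z] that \<theta> by (auto simp: H_def)
  have H_outside: "H z = q z" if "ht z \<notin> {s0..s1}" for z using that by (auto simp: H_def)
  have H_pt: "H (pt r \<tau>) = E2 r (\<tau> + \<theta> r)" if "r \<in> {s0..s1}" "\<tau> \<in> {0..1}" for r \<tau>
    using H_strip[OF pt_in_D] that b[of r] by (simp add: E_def tau_pt)
  have contE: "continuous_on {z \<in> D. ht z \<in> {s0..s1}} E"
  proof -
    have "continuous_on {z \<in> D. ht z \<in> {s0..s1}} (\<lambda>z. (ht z, tau z + \<theta> (ht z)))"
      by (intro continuous_intros continuous_on_ht continuous_on_tau continuous_on_compose2[OF \<theta>(1)]) (use b in auto)
    moreover have "(\<lambda>z. (ht z, tau z + \<theta> (ht z))) ` {z \<in> D. ht z \<in> {s0..s1}} \<subseteq> {s0..s1} \<times> {0..2}"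
      using pt_tau(2) \<theta>(2) b by fastforce
    ultimately show ?thesis
      using continuous_on_compose2[OF continuous_on_E2[OF s(2)]] unfolding E_def by fastforce
  qed
  have contH: "continuous_on D H"
    unfolding H_def
  proof (rule continuous_on_cases_le)
    show "continuous_on {z \<in> D. s0 \<le> ht z} (\<lambda>z. if ht z \<le> s1 then E z else q z)"
    proof (rule continuous_on_cases_le)
      show "continuous_on {z \<in> {z \<in> D. s0 \<le> ht z}. ht z \<le> s1} E"
        by (rule continuous_on_subset[OF contE]) auto
      show "E z = q z" if "z \<in> {z \<in> D. s0 \<le> ht z}" "ht z = s1" for z
        using that s \<theta> by (intro int) auto
    qed (auto intro: continuous_on_subset[OF q_continuous] continuous_on_ht)
    show "q z = (if ht z \<le> s1 then E z else q z)" if "z \<in> D" "ht z = s0" for z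
      using that s \<theta> int[of z] by auto
  qed (auto intro: continuous_on_subset[OF q_continuous] continuous_on_ht)
  have glueH: "H z = H w" if zw: "polygon_glue g z w" for z w
  proof (cases "ht z \<in> strip \<or> ht w \<in> strip")
    case False
    then have "ht z \<notin> {s0..s1}" "ht w \<notin> {s0..s1}" using s(2) by blast+
    then show ?thesis using H_outside glue_q[OF zw] by simp
  next
    case True
    obtain r where r: "r \<in> strip" "z = pt r 0" "w = pt r 1" using glue_strip[OF zw True] by metis
    show ?thesis
    proof (cases "r \<in> {s0..s1}")
      case True
      \<comment> \<open>The two ends of a chord have positions 0 and 1, and a difference of one is a
        full turn.\<close>
      have "E2 r (0 + \<theta> r) = E2 r (1 + \<theta> r)"
        using E2_first[of "\<theta> r" r] E2_second[of r "\<theta> r"] \<theta>(2)[OF True] r(1) by (simp add: add.commute)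
      then show ?thesis using H_pt True r by simp
    next
      case False
      then show ?thesis using H_outside r glue_q[OF zw] by simp
    qed
  qed
  obtain h where h: "continuous_on (S - {}) h" "\<And>z. z \<in> D \<Longrightarrow> q z \<notin> {} \<Longrightarrow> h (q z) = H z"
  proof (rule descend)
    show "continuous_on {z \<in> D. q z \<notin> {}} H" using contH by (rule continuous_on_subset) auto
  qed (use glueH in auto)
  show ?thesis
  proof (rule that[of h])
    show "continuous_on S h" using h(1) by simp
    show "h (q z) = q z" if "z \<in> D" "ht z \<notin> {s0..s1}" for z using h(2) H_outside that by simp
    show *: "h (q (pt r \<tau>)) = E2 r (\<tau> + \<theta> r)" if "r \<in> {s0..s1}" "\<tau> \<in> {0..1}" for r \<tau>
      using h(2) H_pt pt_in_D b that by simp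
    have "h (q z) \<in> S" if z: "z \<in> D" for z
    proof (cases "ht z \<in> {s0..s1}")
      case True
      have t: "tau z + \<theta> (ht z) \<in> {0..2}" using pt_tau(2)[OF z] b[OF True] \<theta>(2)[OF True] by auto
      have "h (q z) = E2 (ht z) (tau z + \<theta> (ht z))"
        using *[OF True pt_tau(2)[OF z]] pt_tau(1)[OF z] b[OF True] by simp
      also have "\<dots> \<in> S" unfolding E2_def using t b[OF True] by (intro q_in_S pt_in_D) auto
      finally show ?thesis .
    next
      case False
      then show ?thesis using h(2)[OF z] H_outside q_in_S[OF z] by simp
    qed
    then show "h \<in> S \<rightarrow> S" using q_image by auto
  qed
qed

text \<open>The shears by \<open>\<theta>\<close> and \<open>1 - \<theta>\<close> are inverse to
  each other, because the total shift is one full turn.\<close>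

lemma twist_exists:
  assumes s: "s0 < s1" "{s0..s1} \<subseteq> strip"
  obtains h where "homeomorphic_map (top_of_set S) (top_of_set S) h"
    "\<And>z. z \<in> D \<Longrightarrow> ht z \<notin> {s0..s1} \<Longrightarrow> h (q z) = q z"
    "\<And>s \<tau>. s \<in> {s0..s1} \<Longrightarrow> \<tau> \<in> {0..1} \<Longrightarrow> h (q (pt s \<tau>)) = E2 s (\<tau> + (s - s0) / (s1 - s0))"
proof -
  define \<theta> where "\<theta> s = (s - s0) / (s1 - s0)" for s
  have c: "continuous_on A \<theta>" for A unfolding \<theta>_def using s by (intro continuous_intros) auto
  have r: "\<theta> s \<in> {0..1}" if "s \<in> {s0..s1}" for s using that s(1) by (auto simp: \<theta>_def divide_simps)
  have e: "\<theta> s0 = 0" "\<theta> s1 = 1" using s(1) by (auto simp: \<theta>_def)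
  obtain h where h: "continuous_on S h" "h \<in> S \<rightarrow> S"
    "\<And>z. z \<in> D \<Longrightarrow> ht z \<notin> {s0..s1} \<Longrightarrow> h (q z) = q z"
    "\<And>s \<tau>. s \<in> {s0..s1} \<Longrightarrow> \<tau> \<in> {0..1} \<Longrightarrow> h (q (pt s \<tau>)) = E2 s (\<tau> + \<theta> s)"
    using shear_exists[OF s c r] e by (metis insertCI)
  obtain h' where h': "continuous_on S h'" "h' \<in> S \<rightarrow> S"
    "\<And>z. z \<in> D \<Longrightarrow> ht z \<notin> {s0..s1} \<Longrightarrow> h' (q z) = q z"
    "\<And>s \<tau>. s \<in> {s0..s1} \<Longrightarrow> \<tau> \<in> {0..1} \<Longrightarrow> h' (q (pt s \<tau>)) = E2 s (\<tau> + (1 - \<theta> s))"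
    by (rule shear_exists[OF s, of "\<lambda>s. 1 - \<theta> s"]) (use r e in \<open>auto intro!: continuous_intros c\<close>)
  have b: "\<bar>s\<bar> < 1" if "s \<in> {s0..s1}" for s using that s strip_bounds by blast
  have inverse: "k (k' x) = x"
    if x: "x \<in> S" and out: "\<And>z. z \<in> D \<Longrightarrow> ht z \<notin> {s0..s1} \<Longrightarrow> k (q z) = q z"
      "\<And>z. z \<in> D \<Longrightarrow> ht z \<notin> {s0..s1} \<Longrightarrow> k' (q z) = q z"
      and k: "\<And>s \<tau>. s \<in> {s0..s1} \<Longrightarrow> \<tau> \<in> {0..1} \<Longrightarrow> k (q (pt s \<tau>)) = E2 s (\<tau> + (1 - \<eta> s))"
      and k': "\<And>s \<tau>. s \<in> {s0..s1} \<Longrightarrow> \<tau> \<in> {0..1} \<Longrightarrow> k' (q (pt s \<tau>)) = E2 s (\<tau> + \<eta> s)"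
      and \<eta>: "\<And>s. s \<in> {s0..s1} \<Longrightarrow> \<eta> s \<in> {0..1}"
    for k k' \<eta> x
  proof -
    obtain z where z: "z \<in> D" "x = q z" using x q_image by blast
    show ?thesis
    proof (cases "ht z \<in> {s0..s1}")
      case False
      then show ?thesis using out z by simp
    next
      case True
      define r t where "r = ht z" and "t = tau z"
      have rt: "r \<in> {s0..s1}" "r \<in> strip" "t \<in> {0..1}" "q (pt r t) = x" "\<eta> r \<in> {0..1}"
        using True z s pt_tau[OF z(1) b] \<eta> by (auto simp: r_def t_def)
      show ?thesis
      \<comment> \<open>Before the second shear is applied, the position after the first has to be
        brought back to \<open>[0, 1]\<close>.\<close>
      proof (cases "t + \<eta> r \<le> 1")
        case True
        then have "k' x = q (pt r (t + \<eta> r))"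
          using k'[of r t] E2_first[of "t + \<eta> r" r] rt by auto
        then have "k (k' x) = E2 r (t + 1)" using k[of r "t + \<eta> r"] True rt by auto
        then show ?thesis using E2_second[of r t] rt by simp
      next
        case False
        then have "k' x = q (pt r (t + \<eta> r - 1))"
          using k'[of r t] E2_second[of r "t + \<eta> r - 1"] rt by auto
        then have "k (k' x) = E2 r t" using k[of r "t + \<eta> r - 1"] False rt by auto
        then show ?thesis using E2_first[of t r] rt by simp
      qed
    qed
  qed
  have "homeomorphic_maps (top_of_set S) (top_of_set S) h h'"
    unfolding homeomorphic_maps_def
  proof (intro conjI ballI)
    show "continuous_map (top_of_set S) (top_of_set S) h" using h by (simp add: image_subset_iff_funcset)
    show "continuous_map (top_of_set S) (top_of_set S) h'" using h' by (simp add: image_subset_iff_funcset)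
    show "h' (h x) = x" if "x \<in> topspace (top_of_set S)" for x
      by (rule inverse[where \<eta> = \<theta> and k = h' and k' = h]) (use that h h' r in auto)
    show "h (h' x) = x" if "x \<in> topspace (top_of_set S)" for x
      by (rule inverse[where \<eta> = "\<lambda>s. 1 - \<theta> s" and k = h and k' = h']) (use that h h' r in auto)
  qed
  then have "homeomorphic_map (top_of_set S) (top_of_set S) h" using homeomorphic_map_maps by blast
  then show ?thesis using that h(3,4) by (simp add: \<theta>_def)
qed

end

section \<open>A pair of loops crossing once\<close>

lemma homotopic_paths_convex:
  fixes p r :: "real \<Rightarrow> 'a::real_normed_vector"
  assumes "convex C" "path p" "path_image p \<subseteq> C" "path r" "path_image r \<subseteq> C"
    and "pathstart r = pathstart p" "pathfinish r = pathfinish p"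
  shows "homotopic_paths C p r"
proof (rule homotopic_paths_linear)
  fix t :: real assume "t \<in> {0..1}"
  then have "p t \<in> C" "r t \<in> C" using assms by (auto simp: path_image_def)
  then show "closed_segment (p t) (r t) \<subseteq> C" using assms(1) by (simp add: closed_segment_subset)
qed (use assms in auto)

context polygon_model
begin

lemma pt_linepath: "pt s (linepath \<tau> \<tau>' t) = linepath (pt s \<tau>) (pt s \<tau>') t"
  by (simp add: linepath_def pt_def algebra_simps scaleR_conv_of_real)

lemma ht_linepath: "ht (linepath z w t) = linepath (ht z) (ht w) t"
  by (simp add: ht_def linepath_def scaleR_conv_of_real algebra_simps)

lemma strip_infinite: "infinite strip"
proof -
  have "cos (3 * half) < cos half" using half by (intro cos_monotone_0_pi) auto
  then show ?thesis by (rule infinite_Ioo)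
qed

text \<open>Both loops are closed-up chords, chosen to miss the finitely many points over
  \<open>P\<close>: \<open>a\<close> has constant height \<open>s0\<close>, and \<open>b\<close>
  runs from edge 0 to edge 2. The twist is supported on the heights \<open>s0\<close> to
  \<open>s1\<close> directly beyond \<open>a\<close>, so it fixes \<open>a\<close> pointwise, and
  \<open>b\<close> crosses the support in one arc that begins at the crossing point. The segments
  appear in the conclusion because the lifts to the plane are computed along them.\<close>

lemma transverse_loops:
  assumes P: "finite P" "P \<subseteq> S"
  obtains h a b y z u0 u1 v0 v1 t t' where
    "homeomorphic_map (top_of_set S) (top_of_set S) h" "\<And>p. p \<in> P \<Longrightarrow> h p = p" "h y = y"
    "loop_at (S - P) y a" "loop_at (S - P) y b"
    "homotopic_paths (S - P) (h \<circ> a) a" "homotopic_paths (S - P) (h \<circ> b) (a +++ b)"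
    "a = (q \<circ> linepath z u1) +++ (q \<circ> linepath u0 z)"
    "b = (q \<circ> linepath z v1) +++ (q \<circ> linepath v0 z)"
    "closed_segment z u1 \<union> closed_segment u0 z \<union> closed_segment z v1 \<union> closed_segment v0 z
      \<subseteq> {z \<in> D. q z \<notin> P}"
    "t \<in> {0<..<1}" "u0 = polygon_edge g 1 t" "u1 = polygon_edge g 3 (1 - t)"
    "t' \<in> {0<..<1}" "v0 = polygon_edge g 0 t'" "v1 = polygon_edge g 2 (1 - t')"
proof -
  define Q where "Q = {z \<in> D. q z \<in> P}"
  let ?Y = "S - P" and ?Z = "{z \<in> D. q z \<notin> P}"
  have finQ: "finite Q" unfolding Q_def using P(1) by (rule finite_preimage)
  have contq: "continuous_on A q" if "A \<subseteq> ?Z" for A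
    using that by (intro continuous_on_subset[OF q_continuous]) auto
  have qY: "q \<in> A \<rightarrow> ?Y" if "A \<subseteq> ?Z" for A using that q_in_S by auto
  \<comment> \<open>the transversal chord, joining the glued edges 0 and 2\<close>
  obtain d where d: "d \<in> strip" "d \<notin> (\<lambda>z. Re (z * cnj (unit 0))) ` Q"
    using strip_infinite finQ by (metis finite_imageI finite_subset subsetI)
  obtain \<phi> where \<phi>: "half < \<phi>" "\<phi> < 3 * half" "d = cos \<phi>" "lat d = sin \<phi>" using strip_angle[OF d(1)] .
  define v0 v1 where "v0 = unit 0 * cis (- \<phi>)" and "v1 = unit 0 * cis \<phi>"
  define t' where "t' = 3 / 2 - \<phi> / (2 * half)"
  have t': "t' \<in> {0<..<1}" "v0 = polygon_edge g 0 t'" "v1 = polygon_edge g 2 (1 - t')"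
    using \<phi> half(1) unit_edge[of 0 \<phi>] by (auto simp: t'_def v0_def v1_def divide_simps numeral_2_eq_2)
  have vD: "v0 \<in> D" "v1 \<in> D" by (simp_all add: v0_def v1_def norm_mult)
  have qv: "q v0 = q v1" unfolding v0_def v1_def using \<phi> by (intro glue_q edge_pair) auto
  have segV: "closed_segment v0 v1 \<subseteq> ?Z"
  proof
    fix z assume z: "z \<in> closed_segment v0 v1"
    have "Re (v0 * cnj (unit 0)) = d" "Re (v1 * cnj (unit 0)) = d"
      using \<phi>(3) by (simp_all add: v0_def v1_def unit_def cis_mult cis_cnj)
    moreover obtain r where r: "z = (1 - r) *\<^sub>R v0 + r *\<^sub>R v1" using z by (auto simp: in_segment)
    have "Re (z * cnj (unit 0)) = (1 - r) * Re (v0 * cnj (unit 0)) + r * Re (v1 * cnj (unit 0))"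
      unfolding r by (simp add: algebra_simps)
    ultimately have "Re (z * cnj (unit 0)) = d" by (simp add: algebra_simps)
    then have "z \<notin> Q" using d(2) by blast
    moreover have "z \<in> D" using z closed_segment_subset[OF vD convex_cball] by blast
    ultimately show "z \<in> ?Z" by (simp add: Q_def)
  qed
  \<comment> \<open>The transversal starts below the strip and ends above it, so it meets every
    height in the strip.\<close>
  have h0: "ht v0 \<le> cos (3 * half)"
  proof -
    have "ht v0 = cos (- (\<phi> + 2 * half))"
      by (simp add: v0_def unit_def cis_mult ht_cis algebra_simps)
    also have "\<dots> = cos (\<phi> + 2 * half)" by (rule cos_minus)
    also have "\<dots> \<le> cos (3 * half)" using \<phi> half by (intro cos_le_cos_outer) auto
    finally show ?thesis .
  qed
  have h1: "cos half \<le> ht v1"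
  proof -
    have "ht v1 = cos (\<phi> - 2 * half)"
      by (simp add: v1_def unit_def cis_mult ht_cis algebra_simps)
    also have "\<dots> = cos \<bar>\<phi> - 2 * half\<bar>" by simp
    finally show ?thesis using \<phi> half cos_monotone_0_pi_le[of "\<bar>\<phi> - 2 * half\<bar>" half] by auto
  qed
  \<comment> \<open>the support of the twist, bounded by the loop \<open>a\<close> at height \<open>s0\<close>\<close>
  obtain s0 where s0: "s0 \<in> strip" "s0 \<notin> ht ` Q"
    using strip_infinite finQ by (metis finite_imageI finite_subset subsetI)
  obtain e where e: "e > 0" "\<And>x. x \<in> ht ` Q \<Longrightarrow> e \<le> dist s0 x"
    using finite_set_avoid[of "ht ` Q" s0] finQ s0(2) by (metis finite_imageI)
  \<comment> \<open>Close enough to \<open>s0\<close> to exclude the heights of all points over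
    \<open>P\<close>, and to stay below the upper end of the strip.\<close>
  define s1 where "s1 = s0 + min (e / 2) ((cos half - s0) / 2)"
  have s1: "s0 < s1" "s1 \<le> s0 + e / 2" "s1 \<le> s0 + (cos half - s0) / 2"
    unfolding s1_def using e(1) s0(1)
    by (simp, intro add_left_mono min.cobounded1, intro add_left_mono min.cobounded2)
  have "s1 < cos half" using s1(3) s0(1) by (simp add: field_simps)
  then have s: "s0 < s1" "{s0..s1} \<subseteq> strip" using s1(1) s0(1) by auto
  have sQ: "x \<notin> ht ` Q" if "x \<in> {s0..s1}" for x
  proof
    assume "x \<in> ht ` Q"
    then have "e \<le> \<bar>s0 - x\<bar>" using e(2) by (simp add: dist_real_def)
    then show False using that e(1) s1(2) by auto
  qed
  have b1: "\<bar>r\<bar> < 1" if "r \<in> {s0..s1}" for r using that s strip_bounds by blast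
  have ptZ: "pt r \<tau> \<in> ?Z" if "r \<in> {s0..s1}" "\<tau> \<in> {0..1}" for r \<tau>
  proof -
    have "pt r \<tau> \<in> D" using pt_in_D b1 that by blast
    moreover have "pt r \<tau> \<notin> Q" using sQ[OF that(1)] by force
    ultimately show ?thesis by (simp add: Q_def)
  qed
  obtain h where h: "homeomorphic_map (top_of_set S) (top_of_set S) h"
    "\<And>z. z \<in> D \<Longrightarrow> ht z \<notin> {s0..s1} \<Longrightarrow> h (q z) = q z"
    "\<And>s \<tau>. s \<in> {s0..s1} \<Longrightarrow> \<tau> \<in> {0..1} \<Longrightarrow> h (q (pt s \<tau>)) = E2 s (\<tau> + (s - s0) / (s1 - s0))"
    using twist_exists[OF s] by metis
  have hP: "h p = p" if p: "p \<in> P" for p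
  proof -
    obtain z where z: "z \<in> D" "q z = p" using p P(2) q_image by blast
    then have "z \<in> Q" using p by (simp add: Q_def)
    then show ?thesis using h(2)[OF z(1)] z(2) sQ by blast
  qed
  have hcontY: "continuous_on ?Y h" and hY: "h \<in> ?Y \<rightarrow> ?Y"
    using homeomorphic_map_complement[OF h(1) hP] by simp_all
  \<comment> \<open>At the boundary heights \<open>s0\<close> and \<open>s1\<close> the shift is 0
    and one full turn.\<close>
  have h_low: "h (q z) = q z" if z: "z \<in> D" "ht z \<le> s0 \<or> s1 \<le> ht z" for z
  proof (cases "ht z \<in> {s0..s1}")
    case False
    then show ?thesis using h(2) z by blast
  next
    case True
    then have "ht z = s0 \<or> ht z = s1" using z by auto
    moreover have "h (q z) = E2 (ht z) (tau z + (ht z - s0) / (s1 - s0))"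
      using h(3)[OF True pt_tau(2)[OF z(1) b1[OF True]]] pt_tau(1)[OF z(1) b1[OF True]] by simp
    ultimately show ?thesis
      using E2_first[of "tau z" s0] E2_second[of s1 "tau z"] pt_tau[OF z(1) b1[OF True]] s
        subsetD[OF s(2), of s1] by auto
  qed
  \<comment> \<open>the crossing point \<open>z\<close>, and the point \<open>z'\<close> where the transversal leaves the support\<close>
  define ra where "ra x = (x - ht v0) / (ht v1 - ht v0)" for x
  have den: "ht v1 - ht v0 > 0" and ord: "ht v0 < s0" "s1 < ht v1" using h0 h1 s(1) s0(1) \<open>s1 < cos half\<close> by auto
  have ra: "ra x \<in> {0..1}" "ht (linepath v0 v1 (ra x)) = x" if "x \<in> {ht v0..ht v1}" for x
  proof -
    show "ra x \<in> {0..1}" using that den by (auto simp: ra_def divide_simps)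
    have "ht (linepath v0 v1 (ra x)) = ht v0 + ra x * (ht v1 - ht v0)"
      unfolding ht_linepath by (simp add: linepath_def algebra_simps)
    also have "\<dots> = x" using den by (simp add: ra_def)
    finally show "ht (linepath v0 v1 (ra x)) = x" .
  qed
  define z z' where "z = linepath v0 v1 (ra s0)" and "z' = linepath v0 v1 (ra s1)"
  have zV: "z \<in> closed_segment v0 v1" "z' \<in> closed_segment v0 v1"
    using ra(1)[of s0] ra(1)[of s1] ord s by (auto simp: z_def z'_def linepath_in_path)
  have hz: "ht z = s0" "ht z' = s1" using ra(2) ord s by (auto simp: z_def z'_def)
  have zD: "z \<in> D" using zV segV by blast
  define \<tau> where "\<tau> = tau z"
  have \<tau>: "\<tau> \<in> {0..1}" "pt s0 \<tau> = z" using pt_tau[OF zD] hz b1[of s0] s by (auto simp: \<tau>_def)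
  define u0 u1 where "u0 = pt s0 0" and "u1 = pt s0 1"
  obtain \<psi> where \<psi>: "half < \<psi>" "\<psi> < 3 * half" "s0 = cos \<psi>" "lat s0 = sin \<psi>" using strip_angle[OF s0(1)] .
  define t where "t = 3 / 2 - \<psi> / (2 * half)"
  have t: "t \<in> {0<..<1}" "u0 = polygon_edge g 1 t" "u1 = polygon_edge g 3 (1 - t)"
    using \<psi> half(1) unit_edge[of 1 \<psi>] pt_cis[of \<psi>]
    by (auto simp: t_def u0_def u1_def divide_simps numeral_3_eq_3)
  have qu: "q u0 = q u1" unfolding u0_def u1_def using s0(1) by (rule q_pt_wrap)
  have chord: "closed_segment (pt s0 \<tau>1) (pt s0 \<tau>2) \<subseteq> ?Z" if "\<tau>1 \<in> {0..1}" "\<tau>2 \<in> {0..1}" for \<tau>1 \<tau>2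
  proof -
    have "linepath \<tau>1 \<tau>2 r \<in> {0..1}" if "r \<in> {0..1}" for r
      using that \<open>\<tau>1 \<in> _\<close> \<open>\<tau>2 \<in> _\<close> closed_segment_subset[of \<tau>1 "{0..1}" \<tau>2] linepath_in_path[OF that, of \<tau>1 \<tau>2] by auto
    then have "linepath (pt s0 \<tau>1) (pt s0 \<tau>2) ` {0..1} \<subseteq> ?Z"
      using ptZ s(1) by (force simp flip: pt_linepath)
    then show ?thesis by (simp add: path_image_def flip: path_image_linepath)
  qed
  have segU: "closed_segment z u1 \<subseteq> ?Z" "closed_segment u0 z \<subseteq> ?Z"
    using chord[of \<tau> 1] chord[of 0 \<tau>] \<tau> by (simp_all add: u0_def u1_def)
  have sub: "closed_segment x y \<subseteq> closed_segment v0 v1" if "x \<in> closed_segment v0 v1" "y \<in> closed_segment v0 v1" for x y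
    using that by (simp add: closed_segment_subset)
  have segV': "closed_segment z v1 \<subseteq> ?Z" "closed_segment v0 z \<subseteq> ?Z" "closed_segment z z' \<subseteq> ?Z" "closed_segment z' v1 \<subseteq> ?Z"
    using sub[of z v1] sub[of v0 z] sub[of z z'] sub[of z' v1] zV segV by auto
  define A1 A2 B1 B2 C C' where
    "A1 = q \<circ> linepath z u1" and "A2 = q \<circ> linepath u0 z" and
    "B1 = q \<circ> linepath z v1" and "B2 = q \<circ> linepath v0 z" and
    "C = q \<circ> linepath z z'" and "C' = q \<circ> linepath z' v1"
  have qlp: "path (q \<circ> linepath x y)" "path_image (q \<circ> linepath x y) \<subseteq> ?Y"
    "pathstart (q \<circ> linepath x y) = q x" "pathfinish (q \<circ> linepath x y) = q y" if "closed_segment x y \<subseteq> ?Z" for x y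
    using that qY[OF that] contq[OF that]
    by (auto simp: path_image_compose pathstart_compose pathfinish_compose intro!: path_continuous_image)
  note paths = qlp[OF segU(1), folded A1_def] qlp[OF segU(2), folded A2_def] qlp[OF segV'(1), folded B1_def]
    qlp[OF segV'(2), folded B2_def] qlp[OF segV'(3), folded C_def] qlp[OF segV'(4), folded C'_def]
  define a b y where "a = A1 +++ A2" and "b = B1 +++ B2" and "y = q z"
  have loops: "loop_at ?Y y a" "loop_at ?Y y b"
    unfolding loop_at_def a_def b_def y_def using paths qu qv by (auto simp: path_image_join)
  have hy: "h y = y" unfolding y_def using h_low[OF zD] hz by simp
  have fixed: "homotopic_paths ?Y (h \<circ> (q \<circ> linepath x w)) (q \<circ> linepath x w)"
    if seg: "closed_segment x w \<subseteq> ?Z" and off: "\<And>v. v \<in> closed_segment x w \<Longrightarrow> ht v \<le> s0 \<or> s1 \<le> ht v" for x w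
  proof (rule homotopic_paths_sym[OF homotopic_paths_eq])
    show "(q \<circ> linepath x w) r = (h \<circ> (q \<circ> linepath x w)) r" if "r \<in> {0..1}" for r
      using linepath_in_path[OF that, of x w] seg off h_low by (simp add: subset_iff) 
  qed (use qlp[OF seg] in auto)
  have ht_seg: "ht v \<in> closed_segment (ht x) (ht w)" if "v \<in> closed_segment x w" for v x w
    using that ht_linepath[of x w] by (metis imageE path_image_linepath path_image_def linepath_in_path)
  have hA1: "homotopic_paths ?Y (h \<circ> A1) A1" unfolding A1_def
    using ht_seg[of _ z u1] hz by (intro fixed segU) (auto simp: u1_def)
  have hA2: "homotopic_paths ?Y (h \<circ> A2) A2" unfolding A2_def
    using ht_seg[of _ u0 z] hz by (intro fixed segU) (auto simp: u0_def)
  have ha: "homotopic_paths ?Y (h \<circ> a) a"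
    unfolding a_def path_compose_join
    by (rule homotopic_paths_join[OF hA1 hA2]) (use paths qu in \<open>simp add: pathstart_compose pathfinish_compose\<close>)
  have hB2: "homotopic_paths ?Y (h \<circ> B2) B2" unfolding B2_def
    using ht_seg[of _ v0 z] hz ord by (intro fixed segV') (auto simp: closed_segment_eq_real_ivl)
  have hC': "homotopic_paths ?Y (h \<circ> C') C'" unfolding C'_def
    using ht_seg[of _ z' v1] hz ord by (intro fixed segV') (auto simp: closed_segment_eq_real_ivl)
  have split: "homotopic_paths ?Y B1 (C +++ C')"
  proof -
    have "homotopic_paths (closed_segment v0 v1) (linepath z v1) (linepath z z' +++ linepath z' v1)"
      by (rule homotopic_paths_convex) (use sub zV in \<open>auto simp: path_image_join\<close>)
    then have "homotopic_paths ?Y (q \<circ> linepath z v1) (q \<circ> (linepath z z' +++ linepath z' v1))"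
      by (rule homotopic_paths_continuous_image[OF _ contq[OF segV] qY[OF segV]])
    then show ?thesis by (simp only: path_compose_join B1_def C_def C'_def)
  qed
  have hC: "homotopic_paths ?Y (h \<circ> C) ((A1 +++ A2) +++ C)"
  proof -
    \<comment> \<open>In the rectangle of heights and positions, \<open>h \<circ> C\<close> is the
      image of the sheared path \<open>p\<close>. By convexity \<open>p\<close> can be replaced by
      one full turn at height \<open>s0\<close>, whose pieces \<open>?p1\<close> and
      \<open>?p2\<close> become \<open>A1\<close> and \<open>A2\<close>, followed by the path
      \<open>p3\<close>, which is \<open>C\<close> with all positions raised by one and has the same
      image.\<close>
    let ?R = "{s0..s1} \<times> {0..2::real}"
    let ?F = "\<lambda>p. E2 (fst p) (snd p)"
    let ?c = "linepath z z'"
    define \<theta> where "\<theta> r = (r - s0) / (s1 - s0)" for r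
    have \<theta>: "\<theta> r \<in> {0..1}" if "r \<in> {s0..s1}" for r using that s(1) by (auto simp: \<theta>_def divide_simps)
    have c: "?c r \<in> D" "ht (?c r) \<in> {s0..s1}" "tau (?c r) \<in> {0..1}" "pt (ht (?c r)) (tau (?c r)) = ?c r"
      if r: "r \<in> {0..1}" for r
    proof -
      have cr: "?c r \<in> closed_segment z z'" using r by (rule linepath_in_path)
      then show D: "?c r \<in> D" using segV' by blast
      show H: "ht (?c r) \<in> {s0..s1}"
        using ht_seg[OF cr] hz s(1) by (simp add: closed_segment_eq_real_ivl)
      show "tau (?c r) \<in> {0..1}" "pt (ht (?c r)) (tau (?c r)) = ?c r" using pt_tau[OF D] b1[OF H] by auto
    qed
    have cont_c: "continuous_on {0..1} (\<lambda>r. ht (?c r))" "continuous_on {0..1} (\<lambda>r. tau (?c r))"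
    proof -
      have "continuous_on {0..1} ?c" using path_linepath[of z z'] by (simp only: path_def)
      moreover have "continuous_on (?c ` {0..1}) ht" by (rule continuous_on_ht)
      moreover have "continuous_on (?c ` {0..1}) tau"
        by (rule continuous_on_tau) (use c(2) b1 in blast)
      ultimately show "continuous_on {0..1} (\<lambda>r. ht (?c r))" "continuous_on {0..1} (\<lambda>r. tau (?c r))"
        using continuous_on_compose2[where t = "?c ` {0..1}"] by blast+
    qed
    define p where "p r = (ht (?c r), tau (?c r) + \<theta> (ht (?c r)))" for r
    define p3 where "p3 r = (ht (?c r), tau (?c r) + 1)" for r
    let ?p1 = "linepath (s0, \<tau>) (s0, 1)" and ?p2 = "linepath (s0, 1) (s0, \<tau> + 1)"
    have "path p" unfolding path_def p_def \<theta>_def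
      using s(1) by (intro continuous_intros cont_c) auto
    have "path p3" unfolding path_def p3_def by (intro continuous_intros cont_c)
    have pR: "p r \<in> ?R" "p3 r \<in> ?R" if "r \<in> {0..1}" for r
      using c(2,3)[OF that] \<theta>[OF c(2)[OF that]] by (auto simp: p_def p3_def)
    have pe: "p 0 = (s0, \<tau>)" "p 1 = (s1, tau z' + 1)" "p3 0 = (s0, \<tau> + 1)" "p3 1 = (s1, tau z' + 1)"
      using s(1) by (simp_all add: p_def p3_def \<theta>_def hz \<tau>_def linepath_def)
    have R: "convex ?R" by (intro convex_Times) auto
    have segR: "closed_segment (s0, \<tau>) (s0, 1) \<subseteq> ?R" "closed_segment (s0, 1) (s0, \<tau> + 1) \<subseteq> ?R"
      using \<tau>(1) s(1) by (simp_all add: closed_segment_subset R)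
    have "homotopic_paths ?R p ((?p1 +++ ?p2) +++ p3)"
    proof (rule homotopic_paths_convex[OF R \<open>path p\<close>])
      show "path_image p \<subseteq> ?R" unfolding path_image_def using pR(1) by blast
      have start: "pathstart p3 = (s0, \<tau> + 1)" using pe by (simp only: pathstart_def)
      then show "path ((?p1 +++ ?p2) +++ p3)"
        using \<open>path p3\<close> by simp
      have "path_image p3 \<subseteq> ?R" unfolding path_image_def using pR(2) by blast
      then show "path_image ((?p1 +++ ?p2) +++ p3) \<subseteq> ?R"
        using segR start by (simp only: path_image_join pathfinish_join pathfinish_linepath pathstart_linepath
            path_image_linepath Un_subset_iff)
      show "pathstart ((?p1 +++ ?p2) +++ p3) = pathstart p" "pathfinish ((?p1 +++ ?p2) +++ p3) = pathfinish p"
        using pe by (simp_all only: pathstart_join pathfinish_join pathstart_linepath pathstart_def[of p]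
            pathfinish_def[of p] pathfinish_def[of p3])
    qed
    then have "homotopic_paths ?Y (?F \<circ> p) (?F \<circ> ((?p1 +++ ?p2) +++ p3))"
    proof (rule homotopic_paths_continuous_image)
      show "continuous_on ?R ?F" using s(2) by (rule continuous_on_E2)
      show "?F \<in> ?R \<rightarrow> ?Y" using ptZ q_in_S by (auto simp: E2_def)
    qed
    then have main: "homotopic_paths ?Y (?F \<circ> p) (((?F \<circ> ?p1) +++ (?F \<circ> ?p2)) +++ (?F \<circ> p3))"
      by (simp only: path_compose_join)
    have e0: "homotopic_paths ?Y (h \<circ> C) (?F \<circ> p)"
    proof (rule homotopic_paths_eq)
      show "(h \<circ> C) r = (?F \<circ> p) r" if "r \<in> {0..1}" for r
        using h(3)[OF c(2,3)[OF that]] c(4)[OF that] by (simp add: C_def p_def \<theta>_def)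
      show "path (h \<circ> C)" "path_image (h \<circ> C) \<subseteq> ?Y"
        using paths hY hcontY by (auto simp: path_image_compose intro!: path_continuous_image intro: continuous_on_subset)
    qed
    have e1: "homotopic_paths ?Y A1 (?F \<circ> ?p1)"
    proof (rule homotopic_paths_eq)
      show "A1 r = (?F \<circ> ?p1) r" if r: "r \<in> {0..1}" for r
      proof -
        have "linepath \<tau> 1 r \<in> {0..1}" using \<tau> r linepath_in_path[OF r, of \<tau> 1] by (auto simp: closed_segment_eq_real_ivl)
        moreover have "?p1 r = (s0, linepath \<tau> 1 r)" by (simp add: linepath_def algebra_simps)
        ultimately show ?thesis
          using pt_linepath[of s0 \<tau> 1 r] \<tau>(2) by (simp add: A1_def E2_first u1_def)
      qed
    qed (use paths in auto)
    have e2: "homotopic_paths ?Y A2 (?F \<circ> ?p2)"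
    proof (rule homotopic_paths_eq)
      show "A2 r = (?F \<circ> ?p2) r" if r: "r \<in> {0..1}" for r
      proof -
        have "linepath 0 \<tau> r \<in> {0..1}" using \<tau> r linepath_in_path[OF r, of 0 \<tau>] by (auto simp: closed_segment_eq_real_ivl)
        moreover have "?p2 r = (s0, linepath 0 \<tau> r + 1)" by (simp add: linepath_def algebra_simps)
        ultimately show ?thesis
          using pt_linepath[of s0 0 \<tau> r] \<tau>(2) s0(1) by (simp add: A2_def E2_second u0_def)
      qed
    qed (use paths in auto)
    have e3: "homotopic_paths ?Y C (?F \<circ> p3)"
    proof (rule homotopic_paths_eq)
      show "C r = (?F \<circ> p3) r" if r: "r \<in> {0..1}" for r
        using E2_second[of "ht (?c r)" "tau (?c r)"] c(2,3,4)[OF r] s(2) by (auto simp: C_def p3_def)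
    qed (use paths in auto)
    have "homotopic_paths ?Y ((A1 +++ A2) +++ C) (((?F \<circ> ?p1) +++ (?F \<circ> ?p2)) +++ (?F \<circ> p3))"
      by (rule homotopic_paths_join[OF homotopic_paths_join[OF e1 e2] e3]) (use paths qu in auto)
    then show ?thesis
      by (rule homotopic_paths_trans[OF homotopic_paths_trans[OF e0 main] homotopic_paths_sym])
  qed
  have hB1: "homotopic_paths ?Y (h \<circ> B1) (a +++ B1)"
  proof -
    have 1: "homotopic_paths ?Y (h \<circ> B1) ((h \<circ> C) +++ (h \<circ> C'))"
      using homotopic_paths_continuous_image[OF split hcontY hY] by (simp only: path_compose_join)
    have 2: "homotopic_paths ?Y ((h \<circ> C) +++ (h \<circ> C')) (((A1 +++ A2) +++ C) +++ C')"
      by (rule homotopic_paths_join[OF hC hC']) (use paths in \<open>simp add: pathstart_compose pathfinish_compose\<close>)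
    have 3: "homotopic_paths ?Y (((A1 +++ A2) +++ C) +++ C') (a +++ (C +++ C'))"
      unfolding a_def by (rule homotopic_paths_sym[OF homotopic_paths_assoc])
        (use paths qu in \<open>auto simp: path_image_join\<close>)
    have 4: "homotopic_paths ?Y (a +++ (C +++ C')) (a +++ B1)"
      by (rule homotopic_paths_join[OF _ homotopic_paths_sym[OF split]])
        (use paths loops qu in \<open>auto simp: a_def loop_at_def\<close>)
    show ?thesis
      by (rule homotopic_paths_trans[OF 1 homotopic_paths_trans[OF 2 homotopic_paths_trans[OF 3 4]]])
  qed
  have hb: "homotopic_paths ?Y (h \<circ> b) (a +++ b)"
  proof -
    have 1: "homotopic_paths ?Y (h \<circ> b) ((a +++ B1) +++ B2)"
      unfolding b_def path_compose_join
      by (rule homotopic_paths_join[OF hB1 hB2]) (use paths qv in \<open>simp add: pathstart_compose pathfinish_compose\<close>)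
    have 2: "homotopic_paths ?Y ((a +++ B1) +++ B2) (a +++ b)"
      unfolding b_def by (rule homotopic_paths_sym[OF homotopic_paths_assoc])
        (use paths loops(1) qv in \<open>auto simp: loop_at_def y_def\<close>)
    show ?thesis by (rule homotopic_paths_trans[OF 1 2])
  qed
  show ?thesis
    by (rule that[OF h(1) hP hy loops ha hb a_def[unfolded A1_def A2_def] b_def[unfolded B1_def B2_def] _ t t'])
      (use segU segV' in auto)
qed

end

section \<open>A map to the Klein bottle\<close>

text \<open>A piecewise affine path through \<open>(0, 0), (-1, -2), (-1, -1), (0, 1), (0, 2)\<close>; its four
  pieces develop the first four edges of the polygon into the plane, compatibly with the gluing.\<close>

definition develop :: "real \<Rightarrow> real \<times> real" where
  "develop s = (let c = max 0 (s - 2) - max 0 (s - 3) in (max (- s) (- 1) + c, max (- 2 * s) (s - 3) + c))"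

lemma develop_02: "0 \<le> t \<Longrightarrow> t \<le> 1 \<Longrightarrow> develop (3 - t) = deck 0 1 (develop t)"
  by (simp add: develop_def deck_def Let_def max_def)

lemma develop_13: "1 \<le> s \<Longrightarrow> s \<le> 2 \<Longrightarrow> develop (5 - s) = deck 1 0 (develop s)"
  by (simp add: develop_def deck_def Let_def max_def)

lemma continuous_on_develop: "continuous_on A develop"
  unfolding develop_def Let_def by (intro continuous_intros)

lemma continuous_on_klein: "continuous_on A klein"
  unfolding klein_def by (intro continuous_intros continuous_on_cis)

context polygon_model
begin

lemma develop_glue_edges:
  assumes "0 \<le> t" "t \<le> 1"
  shows "klein (develop (3 - t)) = klein (develop t)" "klein (develop (4 - t)) = klein (develop (1 + t))"
  using develop_02[OF assms] develop_13[of "1 + t"] assms by simp_all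

text \<open>For \<open>g = 1\<close> the disc without the vertex \<open>1\<close> is retracted to its boundary along the lines
  through \<open>1\<close>.\<close>

lemma position_one:
  assumes "g = 1"
  obtains \<sigma> where "continuous_on (D - {1}) \<sigma>"
    "\<And>k t. k < 4 \<Longrightarrow> t \<in> {0..1} \<Longrightarrow> polygon_edge g k t \<noteq> 1 \<Longrightarrow> \<sigma> (polygon_edge g k t) = real k + t"
proof
  \<comment> \<open>The slope of the line from 1 to \<open>z\<close> determines the value. For
    \<open>z = cis (2 * x)\<close> the arctangent is \<open>x - pi / 2\<close>, an inscribed angle,
    so \<open>\<sigma>\<close> is \<open>4 * x / pi\<close>.\<close>
  define \<sigma> where "\<sigma> z = 2 + 4 / pi * arctan (- Im z / (1 - Re z))" for z
  have "Re z \<noteq> 1" if "z \<in> D - {1}" for z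
  proof
    assume "Re z = 1"
    moreover have "(cmod z)\<^sup>2 \<le> 1" using that by (simp add: power_le_one)
    ultimately have "Im z = 0" by (simp add: cmod_power2)
    then show False using \<open>Re z = 1\<close> that by (simp add: complex_eq_iff)
  qed
  then show "continuous_on (D - {1}) \<sigma>"
    unfolding \<sigma>_def by (intro continuous_intros) auto
  show "\<sigma> (polygon_edge g k t) = real k + t" if kt: "k < 4" "t \<in> {0..1}" "polygon_edge g k t \<noteq> 1" for k t
  proof -
    define x where "x = pi * (real k + t) / 4"
    have edge: "polygon_edge g k t = cis (2 * x)"
      using assms by (simp add: polygon_edge_def x_def field_simps)
    have "real k + t \<noteq> 0" using kt(3) by (auto simp: polygon_edge_def)
    moreover have "real k + t \<noteq> 4" using kt(3) assms by (auto simp: polygon_edge_def)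
    moreover have "real k + t \<le> 4" using kt(1,2) by auto
    ultimately have k: "0 < real k + t" "real k + t < 4" using kt by auto
    have x: "0 < x" "x < pi" unfolding x_def using k by (auto simp: divide_simps)
    have s: "sin x > 0" using x by (rule sin_gt_zero)
    have "arctan (- sin (2 * x) / (1 - cos (2 * x))) = x - pi / 2"
    proof (rule arctan_unique)
      have "- sin (2 * x) / (1 - cos (2 * x)) = - cos x / sin x"
        using s by (simp add: sin_double cos_double_sin power2_eq_square)
      also have "\<dots> = tan (x - pi / 2)"
        by (simp add: tan_def sin_diff cos_diff)
      finally show "tan (x - pi / 2) = - sin (2 * x) / (1 - cos (2 * x))" by simp
    qed (use x in auto)
    then show ?thesis by (simp add: \<sigma>_def edge) (simp add: x_def field_simps)
  qed
qed

text \<open>For \<open>g \<ge> 2\<close> the first two blocks of the boundary word \<open>a b a' b' c d c' d'\<close> are mirror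
  images if \<open>c = b\<close> and \<open>d = a\<close>, so that the disc can be projected to the axis of symmetry.\<close>

lemma position_many:
  assumes "g \<ge> 2"
  obtains \<sigma> where "continuous_on D \<sigma>"
    "\<And>k t. t \<in> {0..1} \<Longrightarrow> k < 8 \<Longrightarrow> \<sigma> (polygon_edge g k t) = 4 - \<bar>real k + t - 4\<bar>"
    "\<And>k t. t \<in> {0..1} \<Longrightarrow> 8 \<le> k \<Longrightarrow> k < 4 * g \<Longrightarrow> \<sigma> (polygon_edge g k t) = 0"
proof
  \<comment> \<open>The axis goes through the vertex between edges 3 and 4, at angle
    \<open>8 * half\<close>. The arccosine measures the distance from this vertex, in edges after
    division by \<open>2 * half\<close>; truncation at 0 collapses all edges from 8 on.\<close>
  define \<sigma> where "\<sigma> z = max 0 (4 - arccos (Re (z * cis (- (8 * half)))) / (2 * half))" for z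
  have "8 * half * 2 \<le> 8 * half * real g" using assms half(1) by (intro mult_left_mono) auto
  moreover have "8 * half * real g = 2 * pi" using half(3) by (simp add: mult_ac)
  ultimately have h: "0 < half" "8 * half \<le> pi" using half(1) by linarith+
  have "\<bar>Re (z * cis (- (8 * half)))\<bar> \<le> 1" if "z \<in> D" for z
    using abs_Re_le_cmod[of "z * cis (- (8 * half))"] that by (simp add: norm_mult)
  then have "- 1 \<le> Re (z * cis (- (8 * half)))" "Re (z * cis (- (8 * half))) \<le> 1" if "z \<in> D" for z
    using that by (fastforce simp only: abs_le_iff minus_le_iff)+
  then show "continuous_on D \<sigma>"
    unfolding \<sigma>_def using h by (intro continuous_intros) auto
  have Re: "Re (polygon_edge g k t * cis (- (8 * half))) = cos (2 * half * (real k + t - 4))" for k t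
    by (simp add: polygon_edge_half cis_mult algebra_simps del: mult_minus_right)
  show "\<sigma> (polygon_edge g k t) = 4 - \<bar>real k + t - 4\<bar>" if "t \<in> {0..1}" "k < 8" for k t
  proof -
    have k: "\<bar>real k + t - 4\<bar> \<le> 4" using that by auto
    have "2 * half * \<bar>real k + t - 4\<bar> \<le> 2 * half * 4" using k h by (intro mult_left_mono) auto
    then have "2 * half * \<bar>real k + t - 4\<bar> \<le> pi" using h by linarith
    moreover have "cos (2 * half * (real k + t - 4)) = cos (2 * half * \<bar>real k + t - 4\<bar>)"
      using h by (metis abs_mult abs_of_pos cos_abs_real mult_pos_pos zero_less_numeral)
    ultimately have "arccos (cos (2 * half * (real k + t - 4))) = 2 * half * \<bar>real k + t - 4\<bar>"
      using h by (simp add: arccos_cos)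
    then show ?thesis unfolding \<sigma>_def Re using h k by simp
  qed
  show "\<sigma> (polygon_edge g k t) = 0" if "t \<in> {0..1}" "8 \<le> k" "k < 4 * g" for k t
  proof -
    have "real (k + 1) \<le> real (4 * g)" using that by (subst of_nat_le_iff) simp
    then have "half * (real k + t) \<le> half * (4 * real g)" "half * 8 \<le> half * (real k + t)"
      using that h by (auto intro!: mult_left_mono)
    then have "half * (real k + t) \<le> pi" "half * 8 \<le> half * (real k + t)"
      using half(3) by (auto simp: mult_ac)
    then have "cos (2 * half * (real k + t - 4)) \<le> cos (8 * half)"
      using h by (intro cos_le_cos_outer) (auto simp: algebra_simps)
    then have "arccos (cos (8 * half)) \<le> arccos (cos (2 * half * (real k + t - 4)))"
      by (intro arccos_le_arccos) auto
    then have "8 * half \<le> arccos (cos (2 * half * (real k + t - 4)))"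
      using h by (simp add: arccos_cos)
    then show ?thesis unfolding \<sigma>_def Re using h by (simp add: divide_simps)
  qed
qed

text \<open>On the disc the map is \<open>klein \<circ> develop \<circ> \<sigma>\<close>, where
  \<open>\<sigma>\<close> is a real position along the first four edges. It factors through the
  line, so no filling of the polygon in the plane is needed; \<open>\<sigma>\<close> is kept since
  \<open>develop \<circ> \<sigma>\<close> provides the lifts.\<close>

lemma klein_map_exists:
  assumes P: "finite P" "P \<subseteq> S" and vertex: "g = 1 \<Longrightarrow> q 1 \<in> P"
  obtains \<Phi> \<sigma> where "continuous_on (S - P) \<Phi>" "\<Phi> ` (S - P) \<subseteq> range klein"
    "continuous_on {z \<in> D. q z \<notin> P} \<sigma>"
    "\<And>z. z \<in> D \<Longrightarrow> q z \<notin> P \<Longrightarrow> \<Phi> (q z) = klein (develop (\<sigma> z))"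
    "\<And>k t. k < 4 \<Longrightarrow> t \<in> {0..1} \<Longrightarrow> q (polygon_edge g k t) \<notin> P \<Longrightarrow> \<sigma> (polygon_edge g k t) = real k + t"
proof -
  obtain \<sigma> where \<sigma>: "continuous_on {z \<in> D. q z \<notin> P} \<sigma>"
    "\<And>k t. k < 4 \<Longrightarrow> t \<in> {0..1} \<Longrightarrow> q (polygon_edge g k t) \<notin> P \<Longrightarrow> \<sigma> (polygon_edge g k t) = real k + t"
    "\<And>z w. polygon_glue g z w \<Longrightarrow> q z \<notin> P \<Longrightarrow> klein (develop (\<sigma> z)) = klein (develop (\<sigma> w))"
  proof (cases "g = 1")
    case True
    obtain \<sigma> where \<sigma>: "continuous_on (D - {1}) \<sigma>"
      "\<And>k t. k < 4 \<Longrightarrow> t \<in> {0..1} \<Longrightarrow> polygon_edge g k t \<noteq> 1 \<Longrightarrow> \<sigma> (polygon_edge g k t) = real k + t"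
      by (rule position_one[OF True]) blast
    have pos: "\<sigma> (polygon_edge g k t) = real k + t"
      if "k < 4" "t \<in> {0..1}" "q (polygon_edge g k t) \<notin> P" for k t
      using \<sigma>(2) that vertex[OF True] by metis
    show ?thesis
    proof (rule that[of \<sigma>])
      show "continuous_on {z \<in> D. q z \<notin> P} \<sigma>"
        by (rule continuous_on_subset[OF \<sigma>(1)]) (use vertex[OF True] in auto)
      show "klein (develop (\<sigma> z)) = klein (develop (\<sigma> w))" if zw: "polygon_glue g z w" "q z \<notin> P" for z w
      proof -
        have "q w \<notin> P" using glue_q[OF zw(1)] zw(2) by simp
        obtain j t where j: "j < g" "t \<in> {0..1}"
          and edges: "z = polygon_edge g (4 * j) t \<and> w = polygon_edge g (4 * j + 2) (1 - t) \<or>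
           z = polygon_edge g (4 * j + 1) t \<and> w = polygon_edge g (4 * j + 3) (1 - t)"
          using zw(1) unfolding polygon_glue_def by blast
        then have "j = 0" and t: "0 \<le> t" "t \<le> 1" "1 - t \<in> {0..1}" using True by auto
        from edges show ?thesis
        proof
          assume e: "z = polygon_edge g (4 * j) t \<and> w = polygon_edge g (4 * j + 2) (1 - t)"
          then have "\<sigma> z = t" "\<sigma> w = 3 - t"
            using zw(2) \<open>q w \<notin> P\<close> \<open>j = 0\<close> j(2) t pos[of 0 t] pos[of 2 "1 - t"] by (auto simp: numeral_2_eq_2)
          then show ?thesis using develop_glue_edges(1)[OF t(1,2)] by simp
        next
          assume e: "z = polygon_edge g (4 * j + 1) t \<and> w = polygon_edge g (4 * j + 3) (1 - t)"
          then have "\<sigma> z = 1 + t" "\<sigma> w = 4 - t"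
            using zw(2) \<open>q w \<notin> P\<close> \<open>j = 0\<close> j(2) t pos[of 1 t] pos[of 3 "1 - t"] by auto
          then show ?thesis using develop_glue_edges(2)[OF t(1,2)] by simp
        qed
      qed
    qed (use pos in blast)
  next
    case False
    then have "g \<ge> 2" using g_pos by simp
    then obtain \<sigma> where \<sigma>: "continuous_on D \<sigma>"
      "\<And>k t. t \<in> {0..1} \<Longrightarrow> k < 8 \<Longrightarrow> \<sigma> (polygon_edge g k t) = 4 - \<bar>real k + t - 4\<bar>"
      "\<And>k t. t \<in> {0..1} \<Longrightarrow> 8 \<le> k \<Longrightarrow> k < 4 * g \<Longrightarrow> \<sigma> (polygon_edge g k t) = 0"
      using position_many by blast
    show ?thesis
    proof (rule that[of \<sigma>])
      show "continuous_on {z \<in> D. q z \<notin> P} \<sigma>" by (rule continuous_on_subset[OF \<sigma>(1)]) auto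
      show "\<sigma> (polygon_edge g k t) = real k + t" if "k < 4" "t \<in> {0..1}" for k t
      proof -
        have "real k + t \<le> 4" using that by auto
        then show ?thesis using \<sigma>(2)[of t k] that by simp
      qed
      show "klein (develop (\<sigma> z)) = klein (develop (\<sigma> w))" if zw: "polygon_glue g z w" for z w
      proof -
        obtain j t where j: "j < g" "t \<in> {0..1}"
          and zw: "z = polygon_edge g (4 * j) t \<and> w = polygon_edge g (4 * j + 2) (1 - t) \<or>
           z = polygon_edge g (4 * j + 1) t \<and> w = polygon_edge g (4 * j + 3) (1 - t)"
          using zw unfolding polygon_glue_def by blast
        have t: "0 \<le> t" "t \<le> 1" "1 - t \<in> {0..1}" using j by auto
        consider "j = 0" | "j = 1" | "j \<ge> 2" by linarith
        then show ?thesis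
        proof cases
          case 1
          have "\<sigma> (polygon_edge g 0 t) = t" "\<sigma> (polygon_edge g 1 t) = 1 + t"
            "\<sigma> (polygon_edge g 2 (1 - t)) = 3 - t" "\<sigma> (polygon_edge g 3 (1 - t)) = 4 - t"
            using \<sigma>(2)[of t 0] \<sigma>(2)[of t 1] \<sigma>(2)[of "1 - t" 2] \<sigma>(2)[of "1 - t" 3] t j by simp_all
          then show ?thesis using zw 1 develop_glue_edges[OF t(1,2)] by (auto simp: numeral_2_eq_2)
        next
          case 2
          \<comment> \<open>Under the reflection the gluing of edges 4 and 6 becomes that of edges 1
            and 3, and the gluing of 5 and 7 becomes that of 0 and 2.\<close>
          have "\<sigma> (polygon_edge g 4 t) = 4 - t" "\<sigma> (polygon_edge g 5 t) = 3 - t"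
            "\<sigma> (polygon_edge g 6 (1 - t)) = 1 + t" "\<sigma> (polygon_edge g 7 (1 - t)) = t"
            using \<sigma>(2)[of t 4] \<sigma>(2)[of t 5] \<sigma>(2)[of "1 - t" 6] \<sigma>(2)[of "1 - t" 7] t j by simp_all
          then show ?thesis using zw 2 develop_glue_edges[OF t(1,2)] by auto
        next
          case 3
          then show ?thesis
            using zw j t \<sigma>(3)[of t "4 * j"] \<sigma>(3)[of t "4 * j + 1"] \<sigma>(3)[of "1 - t" "4 * j + 2"]
              \<sigma>(3)[of "1 - t" "4 * j + 3"] by auto
        qed
      qed
    qed
  qed
  have "continuous_on {z \<in> D. q z \<notin> P} (\<lambda>z. klein (develop (\<sigma> z)))"
    by (intro continuous_on_compose2[OF continuous_on_klein[of UNIV]] continuous_on_compose2[OF continuous_on_develop[of UNIV]] \<sigma>(1)) auto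
  then obtain \<Phi> where \<Phi>: "continuous_on (S - P) \<Phi>"
    "\<And>z. z \<in> D \<Longrightarrow> q z \<notin> P \<Longrightarrow> \<Phi> (q z) = klein (develop (\<sigma> z))"
    using descend[OF P, of "\<lambda>z. klein (develop (\<sigma> z))"] \<sigma>(3) by blast
  show ?thesis
  proof (rule that[OF \<Phi>(1) _ \<sigma>(1) \<Phi>(2) \<sigma>(2)])
    show "\<Phi> ` (S - P) \<subseteq> range klein" using \<Phi>(2) q_image by fastforce
  qed
qed

lemma klein_path_linepath:
  assumes "closed_segment z w \<subseteq> {z \<in> D. q z \<notin> P}" "continuous_on {z \<in> D. q z \<notin> P} \<sigma>"
    and "\<And>z. z \<in> D \<Longrightarrow> q z \<notin> P \<Longrightarrow> \<Phi> (q z) = klein (develop (\<sigma> z))"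
  shows "klein_path \<Phi> (q \<circ> linepath z w) (develop (\<sigma> z)) (develop (\<sigma> w))"
proof -
  have "path (develop \<circ> (\<sigma> \<circ> linepath z w))"
    by (intro path_continuous_image continuous_on_develop) (use assms(1,2) continuous_on_subset in auto)
  then show ?thesis
    unfolding klein_path_def
    using assms(1,3) linepath_in_path[of _ z w]
    by (intro exI[of _ "develop \<circ> (\<sigma> \<circ> linepath z w)"])
      (auto simp: pathstart_compose pathfinish_compose subset_iff)
qed

end

section \<open>Homogeneity of the torus\<close>

text \<open>\<open>square\<close> maps the closed disc homeomorphically onto the square \<open>[-1,1]\<times>[-1,1]\<close>, preserving rays.\<close>

definition maxnorm :: "complex \<Rightarrow> real" where "maxnorm w = max \<bar>Re w\<bar> \<bar>Im w\<bar>"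

definition square :: "complex \<Rightarrow> complex" where "square w = (cmod w / maxnorm w) *\<^sub>R w"

lemma maxnorm_eq_0 [simp]: "maxnorm w = 0 \<longleftrightarrow> w = 0"
  by (auto simp: maxnorm_def max_def complex_eq_iff)

lemma maxnorm_nonneg: "maxnorm w \<ge> 0"
  by (simp add: maxnorm_def le_max_iff_disj)

lemma maxnorm_scale: "c \<ge> 0 \<Longrightarrow> maxnorm (c *\<^sub>R w) = c * maxnorm w"
  by (simp add: maxnorm_def abs_mult max_mult_distrib_left)

lemma maxnorm_square [simp]: "maxnorm (square w) = cmod w"
  by (cases "w = 0") (simp_all add: square_def maxnorm_scale maxnorm_nonneg)

lemma square_reflect: "square (cnj w) = cnj (square w)" "square (- w) = - square w"
  by (simp_all add: square_def maxnorm_def complex_eq_iff)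

lemma square_inj: "square w = square w' \<Longrightarrow> w = w'"
proof -
  assume eq: "square w = square w'"
  then have n: "cmod w = cmod w'" using maxnorm_square by metis
  show ?thesis
  proof (cases "w = 0")
    case True
    then show ?thesis using n by simp
  next
    case False
    then have w': "w' \<noteq> 0" using n by auto
    have "(1 / maxnorm w) *\<^sub>R w = (1 / maxnorm w') *\<^sub>R w'"
      using eq n False w' by (simp add: square_def divide_inverse flip: scaleR_scaleR)
    moreover from this have "cmod ((1 / maxnorm w) *\<^sub>R w) = cmod ((1 / maxnorm w') *\<^sub>R w')" by simp
    then have "maxnorm w = maxnorm w'"
      using n False w' maxnorm_nonneg by (simp add: divide_simps)
    ultimately show ?thesis using False w' by simp
  qed
qed

lemma square_surj:
  assumes "maxnorm v \<le> 1"
  obtains w where "w \<in> cball 0 1" "square w = v"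
proof (cases "v = 0")
  case True
  then show ?thesis using that[of 0] by (simp add: square_def)
next
  case False
  define w where "w = (maxnorm v / cmod v) *\<^sub>R v"
  have "cmod w = maxnorm v" using False maxnorm_nonneg by (simp add: w_def)
  moreover have "maxnorm w = maxnorm v / cmod v * maxnorm v"
    unfolding w_def by (rule maxnorm_scale) (simp add: maxnorm_nonneg)
  ultimately have "square w = v" using False by (simp add: square_def w_def)
  then show ?thesis using that[of w] assms \<open>cmod w = _\<close> by simp
qed

lemma continuous_on_square: "continuous_on A square"
proof -
  have "isCont square w" for w
  proof (cases "w = 0")
    case False
    then have "continuous_on (- {0}) square"
      unfolding square_def maxnorm_def
      by (intro continuous_intros) (use maxnorm_eq_0 in \<open>auto simp: maxnorm_def\<close>)
    then show ?thesis using False by (simp add: continuous_on_eq_continuous_at open_Compl)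
  next
    case True
    have "cmod (square v) \<le> 2 * cmod v" for v
    proof (cases "v = 0")
      case False
      have "cmod v \<le> \<bar>Re v\<bar> + \<bar>Im v\<bar>" by (rule cmod_le)
      also have "\<dots> \<le> 2 * maxnorm v" by (simp add: maxnorm_def)
      finally have "cmod v / maxnorm v \<le> 2"
        using False maxnorm_nonneg[of v] maxnorm_eq_0[of v] by (simp add: divide_simps)
      then have "cmod v / maxnorm v * cmod v \<le> 2 * cmod v" by (intro mult_right_mono) auto
      then show ?thesis using maxnorm_nonneg by (simp add: square_def)
    qed (simp add: square_def)
    then have "eventually (\<lambda>v. cmod (square v) \<le> 2 * cmod v) (at 0)" by (simp add: always_eventually)
    moreover have "((\<lambda>v::complex. 2 * cmod v) \<longlongrightarrow> 2 * cmod 0) (at 0)" by (intro tendsto_intros)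
    ultimately have "(square \<longlongrightarrow> 0) (at 0)"
      using Lim_null_comparison[of square "\<lambda>v. 2 * cmod v"] by simp
    then show ?thesis using True by (simp add: isCont_def square_def)
  qed
  then show ?thesis by (simp add: continuous_at_imp_continuous_on)
qed

section \<open>The closed surface of genus one as a product of two circles\<close>

text \<open>The rotation places the four arcs symmetrically about the coordinate axes, so that
  \<open>square\<close> maps them to the sides of the square. The exponentials then identify
  opposite sides.\<close>

definition torus_map :: "complex \<Rightarrow> complex \<times> complex" where
  "torus_map z = (let v = square (z * cis (- (pi / 4))) in (cis (pi * Re v), cis (pi * Im v)))"

lemma continuous_on_torus_map: "continuous_on A torus_map"
  unfolding torus_map_def Let_def
  by (intro continuous_intros continuous_on_cis continuous_on_compose2[OF continuous_on_square[of UNIV]]) auto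

lemma cis_pi_eqD:
  assumes "cis (pi * x) = cis (pi * y)" "\<bar>x\<bar> \<le> 1" "\<bar>y\<bar> \<le> 1"
  shows "x = y \<or> \<bar>x\<bar> = 1 \<and> y = - x"
proof -
  have "exp (\<i> * of_real (pi * x)) = exp (\<i> * of_real (pi * y))" using assms(1) by (simp add: cis_conv_exp)
  then obtain n :: int where "\<i> * of_real (pi * x) = \<i> * of_real (pi * y) + of_int (2 * n) * pi * \<i>"
    unfolding exp_eq by blast
  then have "pi * x = pi * y + 2 * n * pi" by (auto simp: complex_eq_iff)
  then have "pi * x = pi * (y + 2 * n)" by (simp add: algebra_simps)
  then have x: "x = y + 2 * n" by simp
  then have "\<bar>real_of_int (2 * n)\<bar> \<le> 2" using assms(2,3) by linarith
  then have "\<bar>n\<bar> \<le> 1" by linarith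
  then have "n = 0 \<or> n = 1 \<or> n = -1" by linarith
  then show ?thesis using x assms(2,3) by auto
qed

lemma unit_circle_right:
  assumes "cmod w = 1" "\<bar>Im w\<bar> \<le> Re w"
  obtains \<psi> where "w = cis \<psi>" "\<bar>\<psi>\<bar> \<le> pi / 4"
proof
  show w: "w = cis (Arg w)" using assms(1) by (metis rcis_cmod_Arg rcis_def mult_1 of_real_1)
  show "\<bar>Arg w\<bar> \<le> pi / 4"
  proof (rule ccontr)
    assume n: "\<not> \<bar>Arg w\<bar> \<le> pi / 4"
    have "\<bar>Arg w\<bar> \<le> pi" using Arg_bounded[of w] by auto
    then have "cos \<bar>Arg w\<bar> < cos (pi / 4)" using n by (intro cos_monotone_0_pi) auto
    then have "Re w < sqrt 2 / 2" by (subst w) (simp add: cos_45)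
    moreover have "0 \<le> Re w" using assms(2) by linarith
    ultimately have "(Re w)\<^sup>2 < (sqrt 2 / 2)\<^sup>2" by (intro power_strict_mono) auto
    moreover have "(Im w)\<^sup>2 \<le> (Re w)\<^sup>2" using assms(2) abs_le_square_iff[of "Im w" "Re w"] \<open>0 \<le> Re w\<close> by simp
    moreover have "(Re w)\<^sup>2 + (Im w)\<^sup>2 = 1" using assms(1) cmod_power2[of w] by simp
    ultimately show False by (simp add: power_divide)
  qed
qed

lemma square_right:
  assumes "w \<in> cball 0 1" "Re (square w) = 1"
  obtains \<psi> where "w = cis \<psi>" "\<bar>\<psi>\<bar> \<le> pi / 4"
proof -
  have "1 \<le> maxnorm (square w)" using assms(2) by (simp add: maxnorm_def)
  then have n: "cmod w = 1" using assms(1) by simp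
  then have "w \<noteq> 0" by auto
  have "Re (square w) = Re w / maxnorm w" using n by (simp add: square_def)
  then have "Re w = maxnorm w" using assms(2) \<open>w \<noteq> 0\<close> by (simp add: divide_eq_eq)
  then have "\<bar>Im w\<bar> \<le> Re w" by (simp add: maxnorm_def max_def split: if_splits)
  with n show ?thesis using unit_circle_right that by blast
qed

lemma square_rotate: "square (\<i> * w) = \<i> * square w"
  by (simp add: square_def maxnorm_def norm_mult max.commute complex_eq_iff)

lemma polygon_edge_1:
  "polygon_edge 1 k ((\<psi> + pi / 4) * 2 / pi) = cis (real k * pi / 2) * cis \<psi> * cis (pi / 4)"
  "polygon_edge 1 k (1 - (\<psi> + pi / 4) * 2 / pi) = cis (real k * pi / 2) * cis (- \<psi>) * cis (pi / 4)"
proof -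
  have "2 * pi * (real k + (\<psi> + pi / 4) * 2 / pi) / (4 * real 1) = real k * pi / 2 + \<psi> + pi / 4"
    "2 * pi * (real k + (1 - (\<psi> + pi / 4) * 2 / pi)) / (4 * real 1) = real k * pi / 2 + - \<psi> + pi / 4"
    by (simp_all add: field_simps)
  then show "polygon_edge 1 k ((\<psi> + pi / 4) * 2 / pi) = cis (real k * pi / 2) * cis \<psi> * cis (pi / 4)"
    "polygon_edge 1 k (1 - (\<psi> + pi / 4) * 2 / pi) = cis (real k * pi / 2) * cis (- \<psi>) * cis (pi / 4)"
    unfolding polygon_edge_def cis_mult by (simp_all only:)
qed

text \<open>\<open>\<psi>\<close> is the angle from the middle of an edge. Up to the rotation by
  \<open>pi / 4\<close>, the two gluings are the reflections in the coordinate axes, and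
  \<open>square\<close> commutes with these.\<close>

lemma polygon_glue_1:
  "polygon_glue 1 z w \<longleftrightarrow> (\<exists>\<psi>. \<bar>\<psi>\<bar> \<le> pi / 4 \<and>
     (z = cis \<psi> * cis (pi / 4) \<and> w = - cis (- \<psi>) * cis (pi / 4) \<or>
      z = \<i> * cis \<psi> * cis (pi / 4) \<and> w = - \<i> * cis (- \<psi>) * cis (pi / 4)))"
proof -
  have 3: "cis (3 * pi / 2) = - \<i>"
  proof -
    have "cis (3 * pi / 2) = cis (pi + pi / 2)" by (rule arg_cong[of _ _ cis]) simp
    also have "\<dots> = cis pi * cis (pi / 2)" by (simp only: cis_mult)
    also have "\<dots> = - \<i>" by simp
    finally show ?thesis .
  qed
  define t where "t \<psi> = (\<psi> + pi / 4) * 2 / pi" for \<psi>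
  have edges: "polygon_edge 1 0 (t \<psi>) = cis \<psi> * cis (pi / 4)"
    "polygon_edge 1 1 (t \<psi>) = \<i> * cis \<psi> * cis (pi / 4)"
    "polygon_edge 1 2 (1 - t \<psi>) = - cis (- \<psi>) * cis (pi / 4)"
    "polygon_edge 1 3 (1 - t \<psi>) = - \<i> * cis (- \<psi>) * cis (pi / 4)" for \<psi>
    unfolding t_def polygon_edge_1 using 3 by simp_all
  have glue: "polygon_glue 1 z w \<longleftrightarrow> (\<exists>t\<in>{0..1}. z = polygon_edge 1 0 t \<and> w = polygon_edge 1 2 (1 - t) \<or>
      z = polygon_edge 1 1 t \<and> w = polygon_edge 1 3 (1 - t))"
    unfolding polygon_glue_def by (simp only: less_one ex_simps mult_0_right add_0 simp_thms)
  have range: "t \<psi> \<in> {0..1} \<longleftrightarrow> \<bar>\<psi>\<bar> \<le> pi / 4" for \<psi>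
    by (auto simp: t_def divide_simps abs_le_iff)
  have surj: "r = t (r * pi / 2 - pi / 4)" for r by (simp add: t_def)
  show ?thesis
  proof
    assume "polygon_glue 1 z w"
    then obtain r where r: "r \<in> {0..1}" "z = polygon_edge 1 0 r \<and> w = polygon_edge 1 2 (1 - r) \<or>
      z = polygon_edge 1 1 r \<and> w = polygon_edge 1 3 (1 - r)" unfolding glue by blast
    define \<psi> where "\<psi> = r * pi / 2 - pi / 4"
    have "r = t \<psi>" unfolding \<psi>_def by (rule surj)
    then show "\<exists>\<psi>. \<bar>\<psi>\<bar> \<le> pi / 4 \<and>
     (z = cis \<psi> * cis (pi / 4) \<and> w = - cis (- \<psi>) * cis (pi / 4) \<or>
      z = \<i> * cis \<psi> * cis (pi / 4) \<and> w = - \<i> * cis (- \<psi>) * cis (pi / 4))"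
      using r range edges by metis
  next
    assume "\<exists>\<psi>. \<bar>\<psi>\<bar> \<le> pi / 4 \<and>
     (z = cis \<psi> * cis (pi / 4) \<and> w = - cis (- \<psi>) * cis (pi / 4) \<or>
      z = \<i> * cis \<psi> * cis (pi / 4) \<and> w = - \<i> * cis (- \<psi>) * cis (pi / 4))"
    then show "polygon_glue 1 z w" unfolding glue using range edges by metis
  qed
qed

lemma unrotate: "z * cis (- (pi / 4)) * cis (pi / 4) = z" "z * cis (pi / 4) * cis (- (pi / 4)) = z"
  by (simp_all add: mult.assoc cis_mult)

lemma glue_right:
  assumes "w \<in> cball 0 1" "Re (square w) = 1"
  shows "polygon_glue 1 (w * cis (pi / 4)) (- cnj w * cis (pi / 4))"
proof -
  obtain \<psi> where "w = cis \<psi>" "\<bar>\<psi>\<bar> \<le> pi / 4" using square_right assms by blast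
  then show ?thesis unfolding polygon_glue_1 by (intro exI[of _ \<psi>]) (simp add: cis_cnj)
qed

lemma glue_top:
  assumes "w \<in> cball 0 1" "Im (square w) = 1"
  shows "polygon_glue 1 (w * cis (pi / 4)) (cnj w * cis (pi / 4))"
proof -
  define v where "v = - \<i> * w"
  have w: "w = \<i> * v" by (simp add: v_def algebra_simps)
  have "Re (square v) = 1" using assms(2) unfolding w square_rotate by simp
  moreover have "v \<in> cball 0 1" using assms(1) by (simp add: v_def norm_mult)
  ultimately obtain \<psi> where "v = cis \<psi>" "\<bar>\<psi>\<bar> \<le> pi / 4" using square_right by blast
  then show ?thesis unfolding polygon_glue_1 w by (intro exI[of _ \<psi>]) (simp add: cis_cnj)
qed

lemma glue_torus_map:
  assumes "polygon_glue 1 z w"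
  shows "torus_map z = torus_map w"
proof -
  obtain \<psi> where \<psi>: "\<bar>\<psi>\<bar> \<le> pi / 4"
    and zw: "z = cis \<psi> * cis (pi / 4) \<and> w = - cis (- \<psi>) * cis (pi / 4) \<or>
      z = \<i> * cis \<psi> * cis (pi / 4) \<and> w = - \<i> * cis (- \<psi>) * cis (pi / 4)"
    using assms unfolding polygon_glue_1 by blast
  have c: "cos \<psi> > 0" using \<psi> pi_gt_zero by (intro cos_gt_zero_pi; linarith)
  have "0 \<le> cos (2 * \<psi>)" using \<psi> by (intro cos_ge_zero; linarith)
  then have "(sin \<psi>)\<^sup>2 \<le> (cos \<psi>)\<^sup>2" by (simp add: cos_double)
  then have "\<bar>sin \<psi>\<bar> \<le> cos \<psi>" using c abs_le_square_iff[of "sin \<psi>" "cos \<psi>"] by simp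
  then have "maxnorm (cis \<psi>) = cos \<psi>" using c by (simp add: maxnorm_def max_def)
  then have sq: "Re (square (cis \<psi>)) = 1" using c by (simp add: square_def)
  have n1: "cis (- pi) = - 1" by (simp add: complex_eq_iff)
  have tm: "torus_map (v * cis (pi / 4)) = (cis (pi * Re (square v)), cis (pi * Im (square v)))" for v
    by (simp only: torus_map_def unrotate Let_def)
  have sqs: "square (- cis (- \<psi>)) = - cnj (square (cis \<psi>))"
    "square (\<i> * cis \<psi>) = \<i> * square (cis \<psi>)" "square (- \<i> * cis (- \<psi>)) = cnj (\<i> * square (cis \<psi>))"
    using square_rotate[of "cis \<psi>"] square_reflect[of "cis \<psi>"] square_reflect(1)[of "\<i> * cis \<psi>"]
      square_reflect(2)[of "cis (- \<psi>)"] by (simp_all add: cis_cnj)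
  from zw show ?thesis
  proof (elim disjE conjE)
    assume z: "z = cis \<psi> * cis (pi / 4)" and w: "w = - cis (- \<psi>) * cis (pi / 4)"
    show ?thesis unfolding z w tm sqs using sq n1 by simp
  next
    assume z: "z = \<i> * cis \<psi> * cis (pi / 4)" and w: "w = - \<i> * cis (- \<psi>) * cis (pi / 4)"
    show ?thesis unfolding z w tm sqs using sq n1 by simp
  qed
qed

text \<open>One coordinate of the square is flipped at a time, via a point \<open>v\<close> that
  shares one coordinate with each of \<open>z\<close> and \<open>w\<close>. Opposite corners are
  connected only by such a chain of two gluings.\<close>

lemma torus_map_eqD:
  assumes z: "z \<in> cball 0 1" and w: "w \<in> cball 0 1" and eq: "torus_map z = torus_map w"
  shows "equivclp (polygon_glue 1) z w"
proof -
  define f where "f z = square (z * cis (- (pi / 4)))" for z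
  have f_inj: "u = v" if "f u = f v" for u v
    using square_inj[of "u * cis (- (pi / 4))" "v * cis (- (pi / 4))"] that by (simp add: f_def)
  have bound: "\<bar>Re (f u)\<bar> \<le> 1" "\<bar>Im (f u)\<bar> \<le> 1" if "u \<in> cball 0 1" for u
  proof -
    have "maxnorm (f u) \<le> 1" using that by (simp add: f_def norm_mult)
    then show "\<bar>Re (f u)\<bar> \<le> 1" "\<bar>Im (f u)\<bar> \<le> 1" by (simp_all add: maxnorm_def)
  qed
  have f_unrotate: "f (v * cis (pi / 4)) = square v" for v by (simp only: f_def unrotate)
  have flip_right: "equivclp (polygon_glue 1) u v"
    if "u \<in> cball 0 1" "Re (f u) = 1" "f v = - cnj (f u)" for u v
  proof -
    define a where "a = u * cis (- (pi / 4))"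
    have a: "a \<in> cball 0 1" "f u = square a" "u = a * cis (pi / 4)"
      using that(1) by (simp_all add: a_def f_def norm_mult unrotate)
    have "f (- cnj a * cis (pi / 4)) = f v"
      unfolding f_unrotate that(3) a(2) by (simp add: square_reflect)
    then have "v = - cnj a * cis (pi / 4)" using f_inj by metis
    then show ?thesis using glue_right[OF a(1)] that(2) a by (simp add: r_into_equivclp)
  qed
  have flip_top: "equivclp (polygon_glue 1) u v"
    if "u \<in> cball 0 1" "Im (f u) = 1" "f v = cnj (f u)" for u v
  proof -
    define a where "a = u * cis (- (pi / 4))"
    have a: "a \<in> cball 0 1" "f u = square a" "u = a * cis (pi / 4)"
      using that(1) by (simp_all add: a_def f_def norm_mult unrotate)
    have "f (cnj a * cis (pi / 4)) = f v"
      unfolding f_unrotate that(3) a(2) by (simp add: square_reflect)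
    then have "v = cnj a * cis (pi / 4)" using f_inj by metis
    then show ?thesis using glue_top[OF a(1)] that(2) a by (simp add: r_into_equivclp)
  qed
  have flip_x: "equivclp (polygon_glue 1) u v"
    if "u \<in> cball 0 1" "v \<in> cball 0 1" "\<bar>Re (f u)\<bar> = 1" "f v = - cnj (f u)" for u v
  proof (cases "Re (f u) = 1")
    case True
    then show ?thesis using flip_right that by blast
  next
    case False
    then have "Re (f v) = 1" "f u = - cnj (f v)" using that by (auto simp: complex_eq_iff)
    then show ?thesis using flip_right[of v u] that equivclp_sym by metis
  qed
  have flip_y: "equivclp (polygon_glue 1) u v"
    if "u \<in> cball 0 1" "v \<in> cball 0 1" "\<bar>Im (f u)\<bar> = 1" "f v = cnj (f u)" for u v
  proof (cases "Im (f u) = 1")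
    case True
    then show ?thesis using flip_top that by blast
  next
    case False
    then have "Im (f v) = 1" "f u = cnj (f v)" using that by (auto simp: complex_eq_iff)
    then show ?thesis using flip_top[of v u] that equivclp_sym by metis
  qed
  have "cis (pi * Re (f z)) = cis (pi * Re (f w))" "cis (pi * Im (f z)) = cis (pi * Im (f w))"
    using eq by (simp_all add: torus_map_def f_def Let_def)
  then have x: "Re (f z) = Re (f w) \<or> \<bar>Re (f z)\<bar> = 1 \<and> Re (f w) = - Re (f z)"
    and y: "Im (f z) = Im (f w) \<or> \<bar>Im (f z)\<bar> = 1 \<and> Im (f w) = - Im (f z)"
    using cis_pi_eqD bound z w by metis+
  obtain v where v: "v \<in> cball 0 1" "Re (f v) = Re (f w)" "Im (f v) = Im (f z)"
  proof -
    have "maxnorm (Complex (Re (f w)) (Im (f z))) \<le> 1"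
      using bound[OF z] bound[OF w] by (simp add: maxnorm_def)
    then obtain u where u: "u \<in> cball 0 1" "square u = Complex (Re (f w)) (Im (f z))"
      by (rule square_surj)
    then have "f (u * cis (pi / 4)) = Complex (Re (f w)) (Im (f z))"
      by (simp add: f_def mult.assoc cis_mult)
    then show ?thesis using that[of "u * cis (pi / 4)"] u by (simp add: norm_mult)
  qed
  have "equivclp (polygon_glue 1) z v"
  proof (cases "Re (f z) = Re (f w)")
    case True
    have "f z = f v" using v True by (simp add: complex_eq_iff)
    then have "z = v" by (rule f_inj)
    then show ?thesis by simp
  next
    case False
    then show ?thesis using flip_x[of z v] x z v by (simp add: complex_eq_iff)
  qed
  moreover have "equivclp (polygon_glue 1) v w"
  proof (cases "Im (f z) = Im (f w)")
    case True
    have "f v = f w" using v True by (simp add: complex_eq_iff)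
    then have "v = w" by (rule f_inj)
    then show ?thesis by simp
  next
    case False
    then show ?thesis using flip_y[of v w] y w v by (simp add: complex_eq_iff)
  qed
  ultimately show ?thesis by (rule equivclp_trans)
qed

definition torus :: "(complex \<times> complex) set" where
  "torus = {x. cmod (fst x) = 1 \<and> cmod (snd x) = 1}"

lemma torus_map_image: "torus_map ` cball 0 1 = torus"
proof (intro equalityI subsetI)
  fix x assume "x \<in> torus"
  then obtain \<zeta> \<eta> where x: "x = (\<zeta>, \<eta>)" "cmod \<zeta> = 1" "cmod \<eta> = 1"
    by (cases x) (auto simp: torus_def)
  define v where "v = Complex (Arg \<zeta> / pi) (Arg \<eta> / pi)"
  have "\<bar>Arg \<zeta>\<bar> \<le> pi" "\<bar>Arg \<eta>\<bar> \<le> pi" using Arg_bounded[of \<zeta>] Arg_bounded[of \<eta>] by auto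
  then have "maxnorm v \<le> 1" by (simp add: v_def maxnorm_def)
  then obtain w where w: "w \<in> cball 0 1" "square w = v" by (rule square_surj)
  have "\<zeta> = cis (Arg \<zeta>)" "\<eta> = cis (Arg \<eta>)"
    using x by (metis rcis_cmod_Arg rcis_def mult_1 of_real_1)+
  then have "torus_map (w * cis (pi / 4)) = x"
    using w x by (simp add: torus_map_def mult.assoc cis_mult v_def)
  moreover have "w * cis (pi / 4) \<in> cball 0 1" using w by (simp add: norm_mult)
  ultimately show "x \<in> torus_map ` cball 0 1" by blast
qed (auto simp: torus_map_def torus_def Let_def)

text \<open>\<open>S\<close> is identified with a product of two circles, where multiplication acts
  transitively. Composing \<open>q\<close> with the translation by the quotient \<open>c\<close> of
  the two points moves the vertex and leaves the fibres unchanged.\<close>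

lemma torus_homogeneous:
  fixes S :: "'a::topological_space set"
  assumes "polygon_model 1 S q" and p: "p \<in> S"
  obtains q' where "polygon_model 1 S q'" "q' 1 = p"
proof -
  interpret polygon_model 1 S q by fact
  obtain J where J: "continuous_on (S - {}) J" "\<And>z. z \<in> D \<Longrightarrow> q z \<notin> {} \<Longrightarrow> J (q z) = torus_map z"
    using descend[of "{}" torus_map] continuous_on_torus_map glue_torus_map by blast
  have "J ` S = (\<lambda>z. J (q z)) ` D" unfolding q_image[symmetric] image_image ..
  also have "\<dots> = torus_map ` D" using J(2) by (intro image_cong) auto
  finally have JS: "J ` S = torus" by (simp only: torus_map_image)
  have Jinj: "inj_on J S"
  proof (rule inj_onI)
    fix x y assume "x \<in> S" "y \<in> S" "J x = J y"
    then obtain z w where zw: "z \<in> D" "w \<in> D" "x = q z" "y = q w" using q_image by blast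
    then have "torus_map z = torus_map w" using J(2) \<open>J x = J y\<close> by simp
    then show "x = y" using torus_map_eqD[OF zw(1,2)] fibres zw by blast
  qed
  have "compact S" using compact_continuous_image[OF q_continuous compact_cball] q_image by simp
  then obtain K where K: "homeomorphism S torus J K"
    using homeomorphism_compact[OF _ _ JS Jinj] J(1) by auto
  then have KJ: "K (J x) = x" if "x \<in> S" for x using that by (simp add: homeomorphism_def)
  have JK: "J (K x) = x" if "x \<in> torus" for x using that K by (simp add: homeomorphism_def)
  have KS: "K x \<in> S" if "x \<in> torus" for x using that K by (auto simp: homeomorphism_def)
  have Kcont: "continuous_on torus K" using K by (simp add: homeomorphism_def)
  have JT: "J x \<in> torus" if "x \<in> S" for x using that JS by blast
  have "J (q 1) \<in> torus" "J p \<in> torus" using JT p q_in_S[of 1] by simp_all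
  then obtain \<zeta>1 \<eta>1 \<zeta>2 \<eta>2 where b: "J (q 1) = (\<zeta>1, \<eta>1)" "cmod \<zeta>1 = 1" "cmod \<eta>1 = 1"
    and e: "J p = (\<zeta>2, \<eta>2)" "cmod \<zeta>2 = 1" "cmod \<eta>2 = 1"
    by (cases "J (q 1)", cases "J p") (auto simp: torus_def)
  define M where "M c x = (fst c * fst x, snd c * snd x)" for c x :: "complex \<times> complex"
  have MT: "M c x \<in> torus" if "c \<in> torus" "x \<in> torus" for c x using that by (simp add: M_def torus_def norm_mult)
  have Mcont: "continuous_on A (M c)" for A c unfolding M_def by (intro continuous_intros)
  define \<tau> where "\<tau> c x = K (M c (J x))" for c x
  have \<tau>: "continuous_on S (\<tau> c)" "\<tau> c \<in> S \<rightarrow> S" if c: "c \<in> torus" for c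
  proof -
    have "continuous_on S (\<lambda>x. M c (J x))"
      by (rule continuous_on_compose2[OF Mcont[of UNIV]]) (use J(1) in auto)
    then show "continuous_on S (\<tau> c)"
      unfolding \<tau>_def by (rule continuous_on_compose2[OF Kcont]) (use MT[OF c] JT in blast)
    show "\<tau> c \<in> S \<rightarrow> S" unfolding \<tau>_def using KS MT[OF c] JT by blast
  qed
  have inv: "\<tau> c (\<tau> c' x) = x"
    if "c \<in> torus" "c' \<in> torus" "fst c * fst c' = 1" "snd c * snd c' = 1" "x \<in> S" for c c' x
  proof -
    have "M c (M c' (J x)) = J x" using that by (simp add: M_def prod_eq_iff flip: mult.assoc)
    then show ?thesis unfolding \<tau>_def using JK[OF MT[OF that(2) JT]] KJ that(5) by simp
  qed
  define c c' where "c = (\<zeta>2 / \<zeta>1, \<eta>2 / \<eta>1)" and "c' = (\<zeta>1 / \<zeta>2, \<eta>1 / \<eta>2)"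
  have nz: "\<zeta>1 \<noteq> 0" "\<eta>1 \<noteq> 0" "\<zeta>2 \<noteq> 0" "\<eta>2 \<noteq> 0" using b e by auto
  have c: "c \<in> torus" "c' \<in> torus" using b e by (simp_all add: c_def c'_def torus_def norm_divide)
  have "homeomorphic_maps (top_of_set S) (top_of_set S) (\<tau> c) (\<tau> c')"
    unfolding homeomorphic_maps_def using \<tau>[OF c(1)] \<tau>[OF c(2)] inv[OF c] inv[OF c(2,1)] nz
    by (simp add: c_def c'_def)
  then have hm: "homeomorphic_map (top_of_set S) (top_of_set S) (\<tau> c)" using homeomorphic_map_maps by blast
  have "\<tau> c (q 1) = p"
  proof -
    have "M c (J (q 1)) = J p" using b e nz by (simp add: M_def c_def)
    then show ?thesis using KJ p by (simp add: \<tau>_def)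
  qed
  moreover have "polygon_model 1 S (\<tau> c \<circ> q)"
  proof
    show "quotient_map (top_of_set D) (top_of_set S) (\<tau> c \<circ> q)"
      using quot hm by (intro quotient_map_compose) (auto simp: homeomorphic_map_def)
    show "(\<tau> c \<circ> q) z = (\<tau> c \<circ> q) w \<longleftrightarrow> equivclp (polygon_glue 1) z w" if "z \<in> D" "w \<in> D" for z w
      using fibres[OF that] q_in_S that homeomorphic_imp_injective_map[OF hm] by (simp add: inj_on_eq_iff)
  qed simp
  ultimately show ?thesis using that by simp
qed

section \<open>Infinite orbits\<close>

text \<open>Each loop jumps once between glued points, from \<open>u1\<close> to \<open>u0\<close>
  or from \<open>v1\<close> to \<open>v0\<close>. The deck transformation that relates their
  developed positions is the monodromy of the loop.\<close>

lemma (in polygon_model) twisted_loops: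
  assumes P: "finite P" "P \<subseteq> S" and vertex: "g = 1 \<Longrightarrow> q 1 \<in> P"
  obtains h y a b where
    "homeomorphic_map (top_of_set S) (top_of_set S) h" "\<And>p. p \<in> P \<Longrightarrow> h p = p" "h y = y"
    "loop_at (S - P) y a" "loop_at (S - P) y b"
    "homotopic_paths (S - P) (h \<circ> a) a" "homotopic_paths (S - P) (h \<circ> b) (a +++ b)"
    "twisting_pair (fundamental_group (S - P) y) (path_class (S - P) a) (path_class (S - P) b)"
proof -
  let ?Z = "{z \<in> D. q z \<notin> P}"
  obtain h a b y z u0 u1 v0 v1 t t' where
    h: "homeomorphic_map (top_of_set S) (top_of_set S) h" "\<And>p. p \<in> P \<Longrightarrow> h p = p" "h y = y"
    and loops: "loop_at (S - P) y a" "loop_at (S - P) y b"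
    and hab: "homotopic_paths (S - P) (h \<circ> a) a" "homotopic_paths (S - P) (h \<circ> b) (a +++ b)"
    and a: "a = (q \<circ> linepath z u1) +++ (q \<circ> linepath u0 z)"
    and b: "b = (q \<circ> linepath z v1) +++ (q \<circ> linepath v0 z)"
    and seg: "closed_segment z u1 \<union> closed_segment u0 z \<union> closed_segment z v1 \<union> closed_segment v0 z \<subseteq> ?Z"
    and t: "t \<in> {0<..<1}" "u0 = polygon_edge g 1 t" "u1 = polygon_edge g 3 (1 - t)"
    and t': "t' \<in> {0<..<1}" "v0 = polygon_edge g 0 t'" "v1 = polygon_edge g 2 (1 - t')"
    by (rule transverse_loops[OF P]) blast
  obtain \<Phi> \<sigma> where \<Phi>: "continuous_on (S - P) \<Phi>" "\<Phi> ` (S - P) \<subseteq> range klein"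
    and \<sigma>: "continuous_on ?Z \<sigma>" "\<And>z. z \<in> D \<Longrightarrow> q z \<notin> P \<Longrightarrow> \<Phi> (q z) = klein (develop (\<sigma> z))"
    and pos: "\<And>k t. k < 4 \<Longrightarrow> t \<in> {0..1} \<Longrightarrow> q (polygon_edge g k t) \<notin> P \<Longrightarrow> \<sigma> (polygon_edge g k t) = real k + t"
    by (rule klein_map_exists[OF P vertex]) (assumption, blast)
  have ends: "q u0 \<notin> P" "q u1 \<notin> P" "q v0 \<notin> P" "q v1 \<notin> P" using seg by auto
  \<comment> \<open>\<open>\<sigma> u1\<close> is \<open>4 - t\<close>, written in the form that
    \<open>develop_13\<close> expects.\<close>
  have su: "\<sigma> u0 = 1 + t" "\<sigma> u1 = 5 - (1 + t)"
    using pos[of 1 t] pos[of 3 "1 - t"] t ends by auto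
  have sv: "\<sigma> v0 = t'" "\<sigma> v1 = 3 - t'"
    using pos[of 0 t'] pos[of 2 "1 - t'"] t' ends by auto
  have du: "develop (\<sigma> u1) = deck 1 0 (develop (\<sigma> u0))" unfolding su using t(1) by (intro develop_13) auto
  have dv: "develop (\<sigma> v1) = deck 0 1 (develop (\<sigma> v0))" unfolding sv using t'(1) by (intro develop_02) auto
  have line: "klein_path \<Phi> (q \<circ> linepath v w) (develop (\<sigma> v)) (develop (\<sigma> w))"
    if "closed_segment v w \<subseteq> ?Z" for v w
    by (rule klein_path_linepath[OF that \<sigma>])
  have "klein_path \<Phi> a (develop (\<sigma> z)) (deck 1 0 (develop (\<sigma> z)))"
    unfolding a using line[of z u1] klein_path_deck[OF line[of u0 z], of 1 0] seg
    by (intro klein_path_join) (auto simp: du)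
  moreover have "klein_path \<Phi> b (develop (\<sigma> z)) (deck 0 1 (develop (\<sigma> z)))"
    unfolding b using line[of z v1] klein_path_deck[OF line[of v0 z], of 0 1] seg
    by (intro klein_path_join) (auto simp: dv)
  ultimately show ?thesis
    using that[OF h loops hab] klein_monodromy[OF \<Phi> loops(1) _ loops(2)] by blast
qed

text \<open>The twist powers \<open>h ^^ (N * k)\<close> represent mapping classes. Since
  \<open>x\<close> need not be fixed by \<open>h\<close>, their automorphisms
  \<open>\<phi> k\<close> are taken with connecting paths through the fixed crossing point
  \<open>y\<close>, where they send \<open>\<beta>\<close> to
  \<open>\<alpha>^(N k) \<beta>\<close>.\<close>

lemma (in polygon_model) infinite_mcg_orbit:
  fixes G :: "('g, 'v) monoid_scheme"
  assumes P: "finite P" "P \<subseteq> S" and vertex: "g = 1 \<Longrightarrow> q 1 \<in> P"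
    and \<omega>: "orientation_class S \<omega>" and x: "x \<in> S - P"
    and G: "group G" "\<pi> \<in> hom SL2C G" "\<pi> ` carrier SL2C = carrier G"
    and f: "f \<in> R" "\<And>A. det A = 1 \<Longrightarrow> f (\<pi> A) = (trace A)\<^sup>2"
    and \<rho>: "\<rho> \<in> mon (fundamental_group (S - P) x) G"
  shows "infinite (mcg_orbit S \<omega> P x G R \<rho>)"
proof
  assume fin: "finite (mcg_orbit S \<omega> P x G R \<rho>)"
  let ?Y = "S - P" and ?X = "top_of_set S"
  obtain h y a b where
    h: "homeomorphic_map ?X ?X h" "\<And>p. p \<in> P \<Longrightarrow> h p = p" "h y = y"
    and loops: "loop_at ?Y y a" "loop_at ?Y y b"
    and hab: "homotopic_paths ?Y (h \<circ> a) a" "homotopic_paths ?Y (h \<circ> b) (a +++ b)"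
    and pair: "twisting_pair (fundamental_group ?Y y) (path_class ?Y a) (path_class ?Y b)"
    by (rule twisted_loops[OF P vertex]) (assumption, blast)
  let ?\<Gamma> = "fundamental_group ?Y y" and ?\<Delta> = "fundamental_group ?Y x"
  define \<alpha> \<beta> where "\<alpha> = path_class ?Y a" and "\<beta> = path_class ?Y b"
  note pair = pair[folded \<alpha>_def \<beta>_def]
  have y: "y \<in> ?Y" using loops(1) by (rule loop_at_base)
  obtain d where d: "path d" "path_image d \<subseteq> ?Y" "pathstart d = x" "pathfinish d = y"
    using path_connected_punctured[OF P(1)] x y unfolding path_connected_def by blast
  define B where "B = induced_aut ?Y id d"
  have B_class: "B (path_class ?Y p) = path_class ?Y ((d +++ p) +++ reversepath d)" if "loop_at ?Y y p" for p
    unfolding B_def by (rule base_change_mon(2)[OF d that])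
  have B: "B \<in> mon ?\<Gamma> ?\<Delta>" unfolding B_def by (rule base_change_mon(1)[OF d])
  interpret \<Gamma>: group ?\<Gamma> using y by (rule group_fundamental_group)
  interpret \<Delta>: group ?\<Delta> using x by (rule group_fundamental_group)
  interpret B: group_hom ?\<Gamma> ?\<Delta> B by unfold_locales (use B in \<open>simp add: mon_def\<close>)
  have ab: "\<alpha> \<in> carrier ?\<Gamma>" "\<beta> \<in> carrier ?\<Gamma>"
    using pair by (simp_all add: twisting_pair_def)
  obtain N where N: "N > 0" "\<And>k. hom_induced 2 ?X {} ?X {} (h ^^ (N * k)) \<omega> = \<omega>"
    using homeomorphism_power_preserves_orientation[OF \<omega> h(1)] by blast
  have hk: "homeomorphic_map ?X ?X (h ^^ k)" "(h ^^ k) y = y" "\<And>p. p \<in> P \<Longrightarrow> (h ^^ k) p = p" for k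
  proof -
    show "homeomorphic_map ?X ?X (h ^^ k)"
    proof (induction k)
      case (Suc k)
      then show ?case unfolding funpow.simps using h(1) by (rule homeomorphic_map_compose)
    qed (simp only: funpow.simps homeomorphic_map_id)
    show "(h ^^ k) y = y" "\<And>p. p \<in> P \<Longrightarrow> (h ^^ k) p = p"
      by (induction k) (simp_all add: h(2,3))
  qed
  define \<phi> where "\<phi> k = induced_aut ?Y (h ^^ (N * k)) (d +++ reversepath (h ^^ (N * k) \<circ> d))" for k
  have orbit: "character_point ?\<Delta> G R (\<rho> \<circ> \<phi> k) \<in> mcg_orbit S \<omega> P x G R \<rho>" for k
  proof -
    define H where "H = h ^^ (N * k)"
    have H: "H \<in> pure_homeos S \<omega> P"
      unfolding H_def pure_homeos_def using hk N(2) by simp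
    define m where "m = isotopy_rel S \<omega> P `` {H}"
    have m: "m \<in> mapping_class_group S \<omega> P"
      unfolding m_def mapping_class_group_def using H by (rule quotientI)
    have "continuous_map ?X ?X H"
      unfolding H_def using hk(1) by (rule homeomorphic_imp_continuous_map)
    then have "H \<in> m" using H by (simp add: m_def isotopy_rel_def)
    moreover have cY: "continuous_on ?Y H" "H \<in> ?Y \<rightarrow> ?Y"
      unfolding H_def using homeomorphic_map_complement[OF hk(1,3)] by blast+
    have Hd: "path (H \<circ> d)" "path_image (H \<circ> d) \<subseteq> ?Y" "pathstart (H \<circ> d) = H x" "pathfinish (H \<circ> d) = y"
      using d cY hk(2) by (auto simp: H_def path_image_compose pathstart_compose pathfinish_compose
          intro!: path_continuous_image intro: continuous_on_subset)
    then have "path (d +++ reversepath (H \<circ> d))" "path_image (d +++ reversepath (H \<circ> d)) \<subseteq> ?Y"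
      "pathstart (d +++ reversepath (H \<circ> d)) = x" "pathfinish (d +++ reversepath (H \<circ> d)) = H x"
      using d by (simp_all add: path_image_join)
    ultimately have "\<phi> k \<in> induced_outer_aut ?Y x m"
      unfolding induced_outer_aut_def \<phi>_def H_def[symmetric] by blast
    then show ?thesis unfolding mcg_orbit_def using m by blast
  qed
  show False
  proof (rule infinite_character_points[OF \<Delta>.is_group G f \<rho>])
    show "twisting_pair ?\<Delta> (B \<alpha>) (B \<beta>)"
      by (rule twisting_pair_mon[OF \<Gamma>.is_group \<Delta>.is_group B pair])
    show "\<phi> k (B \<beta>) = B \<alpha> [^]\<^bsub>?\<Delta>\<^esub> (N * k) \<otimes>\<^bsub>?\<Delta>\<^esub> B \<beta>" for k
    proof -
      let ?H = "h ^^ (N * k)"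
      note H = homeomorphic_map_complement[OF hk(1)[of "N * k"] hk(3)]
      have "\<phi> k (B \<beta>) = path_class ?Y ((d +++ (?H \<circ> b)) +++ reversepath d)"
        unfolding \<phi>_def \<beta>_def B_class[OF loops(2)]
        by (rule induced_aut_conjugate[OF loops(2) H hk(2) d])
      also have "\<dots> = B (path_class ?Y (?H \<circ> b))"
        using B_class[of "?H \<circ> b"] loop_at_compose[OF loops(2) H] hk(2) by simp
      also have "path_class ?Y (?H \<circ> b) = \<alpha> [^]\<^bsub>?\<Gamma>\<^esub> (N * k) \<otimes>\<^bsub>?\<Gamma>\<^esub> \<beta>"
        unfolding \<alpha>_def \<beta>_def by (rule twist_power_path_class[OF homeomorphic_map_complement[OF h(1,2)] h(3) loops hab])
      also have "B \<dots> = B \<alpha> [^]\<^bsub>?\<Delta>\<^esub> (N * k) \<otimes>\<^bsub>?\<Delta>\<^esub> B \<beta>"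
        using ab by (simp add: B.hom_nat_pow)
      finally show ?thesis .
    qed
    show "finite (range (\<lambda>k. character_point ?\<Delta> G R (\<rho> \<circ> \<phi> k)))"
      using fin by (rule finite_subset[rotated]) (use orbit in blast)
  qed (use N(1) in simp_all)
qed

theorem corollary6p1:
  fixes S P :: "'a::topological_space set" and \<omega> :: "'a chain set" and x :: 'a
    and g n :: nat
  assumes "g \<ge> 1" and "2 * int g - 2 + int n > 0"
    and "oriented_punctured_surface g n S \<omega> P" and "x \<in> S - P"
  shows "(\<forall>\<rho> \<in> mon (fundamental_group (S - P) x) SL2C.
            \<not> finite (mcg_orbit S \<omega> P x SL2C SL2C_ring \<rho>)) \<and>
         (\<forall>\<rho> \<in> mon (fundamental_group (S - P) x) PSL2C.
            \<not> finite (mcg_orbit S \<omega> P x PSL2C PSL2C_ring \<rho>))"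
proof -
  have P: "finite P" "P \<subseteq> S" "card P = n" and \<omega>: "orientation_class S \<omega>" and "closed_surface g S"
    using assms(3) by (auto simp: oriented_punctured_surface_def)
  then obtain q0 where q0: "polygon_model g S q0"
    unfolding closed_surface_def polygon_model_def using assms(1) by blast
  obtain q where q: "polygon_model g S q" "g = 1 \<Longrightarrow> q 1 \<in> P"
  proof (cases "g = 1")
    case True
    \<comment> \<open>For genus one the inequality leaves \<open>n > 0\<close>, so there is a
      puncture to which the vertex can be moved.\<close>
    then have "P \<noteq> {}" using assms(2) P(3) by auto
    then obtain p where p: "p \<in> P" by blast
    have "p \<in> S" using p P(2) by blast
    then obtain q where "polygon_model 1 S q" "q 1 = p"
      using torus_homogeneous q0[unfolded True] by blast
    then show ?thesis using that[of q] True p by simp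
  next
    case False
    then show ?thesis using that[OF q0] by simp
  qed
  \<comment> \<open>For \<open>SL2C\<close> the identity plays the role of the projection.\<close>
  have id: "(\<lambda>A. A) \<in> hom SL2C SL2C" "(\<lambda>A. A) ` carrier SL2C = carrier SL2C"
    by (auto simp: hom_def group.is_monoid[OF group_SL2C] monoid.m_closed)
  show ?thesis
    using polygon_model.infinite_mcg_orbit[OF q(1) P(1,2) q(2) \<omega> assms(4) group_SL2C id trace_square_ring refl]
      polygon_model.infinite_mcg_orbit[OF q(1) P(1,2) q(2) \<omega> assms(4) PSL2C_projection(1,2,3)
        PSL2C_trace_square_ring PSL2C_trace_square_coset]
    by blast
qed

end
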